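(* Let $\lambda\in\mathbb{R}\setminus\{0\}$, $a\ge2$, $\Omega=(-a,a)$. Let $\varphi\in\mathcal{D}\cap H^3(\Omega)$ be such that $\partial_x\varphi\in H^1_0(\Omega)$. Let $u\in\mathcal{C}(\mathbb{R};H^2(\Omega))$ be the solution of $$ i\partial_t u+\partial_x^2u=\lambda u\log|u|^2 \ \text{ on } \mathbb{R}\times\Omega,\qquad \partial_xu(t,\pm a)=0,\qquad u(0)=\varphi. $$ Then there exists a maximal $T\in(0,\infty]$ such that $u\in\mathcal{C}((-T,T);H^3(\Omega))$ and, if $T<\infty$, then $$ \inf_{t\in[-T,T],\,x\in\Omega}\big|\mathcal{V}[\partial_xu(t)](x)\big|=0. $$
   Context: Functions are complex-valued; $z\log|z|^2$ is understood as $0$ at $z=0$. For $f\in L^\infty(\Omega)$, $\mathcal{V}[f](x)=\int_0^1f(\sigma x)\,d\sigma$ for $x\in\Omega$. $D_{\mathrm{Neu}}(\Delta)=\{\phi\in H^2(\Omega):\partial_x\phi(\pm a)=0\}$ and $\mathcal{D}=\{\phi\in D_{\mathrm{Neu}}(\Delta) : \phi\text{ odd},\ \phi(x)\neq0\text{ for all }x\in[-a,a]\setminus\{0\},\ \partial_x\phi(0)\neq0\}$. It is known that for every $\varphi\in D_{\mathrm{Neu}}(\Delta)$ the Neumann problem $i\partial_t u+\partial_x^2u=\lambda u\log|u|^2$ on $\mathbb{R}\times\Omega$, $\partial_xu(t,\pm a)=0$ for all $t\in\mathbb{R}$, $u(0)=\varphi$, has a unique solution $u\in\mathcal{C}(\mathbb{R};D_{\mathrm{Neu}}(\Delta))\cap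 W^{1,\infty}_{\rm loc}(\mathbb{R};L^2(\Omega))$, the equation holding in $L^2(\Omega)$ for all $t\in\mathbb{R}$. *)

theory Defs
  imports "HOL-Analysis.Analysis"
begin

text \<open>
  Elements of Lebesgue and Sobolev spaces on an open set \<open>\<Omega> \<subseteq> \<real>\<close> are represented by functions
  \<open>real \<Rightarrow> complex\<close>, of which only the almost-everywhere class on \<open>\<Omega>\<close> matters: the Sobolev notions below
  are invariant under changes on a null set and outside \<open>\<Omega>\<close>. Pointwise values
  (boundary values, parity, zeros) are always those of the continuous representative.
\<close>

section \<open>Sobolev spaces\<close>

definition test_fun :: "real set \<Rightarrow> (real \<Rightarrow> real) \<Rightarrow> bool" where
  "test_fun \<Omega> \<psi> \<longleftrightarrow>
     (\<forall>n x. (deriv ^^ n) \<psi> field_differentiable (at x)) \<and>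
     compact (closure {x. \<psi> x \<noteq> 0}) \<and> closure {x. \<psi> x \<noteq> 0} \<subseteq> \<Omega>"

definition loc_integrable :: "real set \<Rightarrow> (real \<Rightarrow> complex) \<Rightarrow> bool" where
  "loc_integrable \<Omega> f \<longleftrightarrow> (\<forall>K. compact K \<and> K \<subseteq> \<Omega> \<longrightarrow> set_integrable lebesgue K f)"

definition has_weak_deriv :: "real set \<Rightarrow> nat \<Rightarrow> (real \<Rightarrow> complex) \<Rightarrow> (real \<Rightarrow> complex) \<Rightarrow> bool" where
  "has_weak_deriv \<Omega> k f g \<longleftrightarrow> loc_integrable \<Omega> f \<and> loc_integrable \<Omega> g \<and>
     (\<forall>\<psi>. test_fun \<Omega> \<psi> \<longrightarrow>
        integral\<^sup>L (lebesgue_on \<Omega>) (\<lambda>x. (deriv ^^ k) \<psi> x *\<^sub>R f x)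
          = (-1) ^ k * integral\<^sup>L (lebesgue_on \<Omega>) (\<lambda>x. \<psi> x *\<^sub>R g x))"

text \<open>The choice is immaterial: weak derivatives are unique up to null sets.\<close>

definition wderiv :: "real set \<Rightarrow> nat \<Rightarrow> (real \<Rightarrow> complex) \<Rightarrow> real \<Rightarrow> complex" where
  "wderiv \<Omega> k f = (SOME g. has_weak_deriv \<Omega> k f g)"

definition L2 :: "real set \<Rightarrow> (real \<Rightarrow> complex) set" where
  "L2 \<Omega> = {f \<in> borel_measurable (lebesgue_on \<Omega>). integrable (lebesgue_on \<Omega>) (\<lambda>x. (cmod (f x))\<^sup>2)}"

definition L2_norm :: "real set \<Rightarrow> (real \<Rightarrow> complex) \<Rightarrow> real" where
  "L2_norm \<Omega> f = sqrt (integral\<^sup>L (lebesgue_on \<Omega>) (\<lambda>x. (cmod (f x))\<^sup>2))"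

definition L2_inner :: "real set \<Rightarrow> (real \<Rightarrow> complex) \<Rightarrow> (real \<Rightarrow> complex) \<Rightarrow> complex" where
  "L2_inner \<Omega> f w = integral\<^sup>L (lebesgue_on \<Omega>) (\<lambda>x. f x * cnj (w x))"

definition Hs :: "real set \<Rightarrow> nat \<Rightarrow> (real \<Rightarrow> complex) set" where
  "Hs \<Omega> k = {f \<in> L2 \<Omega>. \<forall>j\<le>k. \<exists>g\<in>L2 \<Omega>. has_weak_deriv \<Omega> j f g}"

definition Hs_norm :: "real set \<Rightarrow> nat \<Rightarrow> (real \<Rightarrow> complex) \<Rightarrow> real" where
  "Hs_norm \<Omega> k f = sqrt (\<Sum>j\<le>k. (L2_norm \<Omega> (wderiv \<Omega> j f))\<^sup>2)"

definition H1_0 :: "real set \<Rightarrow> (real \<Rightarrow> complex) set" where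
  "H1_0 \<Omega> = {f \<in> Hs \<Omega> 1. \<forall>\<epsilon>>0. \<exists>\<psi> \<eta>. test_fun \<Omega> \<psi> \<and> test_fun \<Omega> \<eta> \<and>
               Hs_norm \<Omega> 1 (\<lambda>x. f x - Complex (\<psi> x) (\<eta> x)) < \<epsilon>}"

text \<open>
  The representative continuous on the closure of \<open>\<Omega>\<close>, set to zero elsewhere. On a bounded
  interval it exists for every element of \<open>Hs \<Omega> 1\<close>, and its boundary values are the traces.
\<close>

definition cont_rep :: "real set \<Rightarrow> (real \<Rightarrow> complex) \<Rightarrow> real \<Rightarrow> complex" where
  "cont_rep \<Omega> f = (THE h. continuous_on (closure \<Omega>) h \<and>
      (AE x in lebesgue_on \<Omega>. h x = f x) \<and> (\<forall>x. x \<notin> closure \<Omega> \<longrightarrow> h x = 0))"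

text \<open>The spatial derivative of an \<open>H\<^sup>2\<close> function as a continuous function up to the boundary.\<close>

definition dx :: "real set \<Rightarrow> (real \<Rightarrow> complex) \<Rightarrow> real \<Rightarrow> complex" where
  "dx \<Omega> f = cont_rep \<Omega> (wderiv \<Omega> 1 f)"

section \<open>Functions of time with values in Sobolev spaces\<close>

definition cont_into_Hs :: "real set \<Rightarrow> nat \<Rightarrow> real set \<Rightarrow> (real \<Rightarrow> real \<Rightarrow> complex) \<Rightarrow> bool" where
  "cont_into_Hs \<Omega> k I u \<longleftrightarrow> (\<forall>t\<in>I. u t \<in> Hs \<Omega> k) \<and>
     (\<forall>t\<in>I. ((\<lambda>s. Hs_norm \<Omega> k (\<lambda>x. u s x - u t x)) \<longlongrightarrow> 0) (at t within I))"

definition has_L2_time_deriv ::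
    "real set \<Rightarrow> (real \<Rightarrow> real \<Rightarrow> complex) \<Rightarrow> real \<Rightarrow> (real \<Rightarrow> complex) \<Rightarrow> bool" where
  "has_L2_time_deriv \<Omega> u t v \<longleftrightarrow> v \<in> L2 \<Omega> \<and>
     ((\<lambda>s. L2_norm \<Omega> (\<lambda>x. (u s x - u t x) / complex_of_real (s - t) - v x)) \<longlongrightarrow> 0) (at t)"

text \<open>
  As \<open>L\<^sup>2\<close> is separable, strong measurability in time amounts to weak measurability (Pettis),
  and an identity between Bochner integrals may be tested against all \<open>w \<in> L\<^sup>2\<close>.
\<close>

definition Linf_loc_L2 :: "real set \<Rightarrow> (real \<Rightarrow> real \<Rightarrow> complex) \<Rightarrow> bool" where
  "Linf_loc_L2 \<Omega> u \<longleftrightarrow> (\<forall>t. u t \<in> L2 \<Omega>) \<and>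
     (\<forall>w\<in>L2 \<Omega>. (\<lambda>t. L2_inner \<Omega> (u t) w) \<in> borel_measurable lebesgue) \<and>
     (\<forall>K. compact K \<longrightarrow> (\<exists>C. AE t in lebesgue_on K. L2_norm \<Omega> (u t) \<le> C))"

definition W1inf_loc_L2 :: "real set \<Rightarrow> (real \<Rightarrow> real \<Rightarrow> complex) \<Rightarrow> bool" where
  "W1inf_loc_L2 \<Omega> u \<longleftrightarrow> Linf_loc_L2 \<Omega> u \<and>
     (\<exists>v. Linf_loc_L2 \<Omega> v \<and>
        (\<forall>\<eta> w. test_fun UNIV \<eta> \<and> w \<in> L2 \<Omega> \<longrightarrow>
           integral\<^sup>L lebesgue (\<lambda>t. deriv \<eta> t *\<^sub>R L2_inner \<Omega> (u t) w)
             = - integral\<^sup>L lebesgue (\<lambda>t. \<eta> t *\<^sub>R L2_inner \<Omega> (v t) w)))"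

section \<open>The Neumann problem for the logarithmic Schroedinger equation\<close>

definition D_Neu :: "real \<Rightarrow> (real \<Rightarrow> complex) set" where
  "D_Neu a = {\<phi> \<in> Hs {-a<..<a} 2. dx {-a<..<a} \<phi> a = 0 \<and> dx {-a<..<a} \<phi> (-a) = 0}"

definition D_odd :: "real \<Rightarrow> (real \<Rightarrow> complex) set" where
  "D_odd a = {\<phi> \<in> D_Neu a.
     (\<forall>x\<in>{-a..a}. cont_rep {-a<..<a} \<phi> (-x) = - cont_rep {-a<..<a} \<phi> x) \<and>
     (\<forall>x\<in>{-a..a} - {0}. cont_rep {-a<..<a} \<phi> x \<noteq> 0) \<and>
     dx {-a<..<a} \<phi> 0 \<noteq> 0}"

text \<open>The value at \<open>0\<close> is \<open>0\<close>, whatever the value of the logarithm there.\<close>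

definition zlog :: "complex \<Rightarrow> complex" where
  "zlog z = z * complex_of_real (ln ((cmod z)\<^sup>2))"

definition logNLS_solution ::
    "real \<Rightarrow> real \<Rightarrow> (real \<Rightarrow> complex) \<Rightarrow> (real \<Rightarrow> real \<Rightarrow> complex) \<Rightarrow> bool" where
  "logNLS_solution l a \<phi> u \<longleftrightarrow>
     (\<forall>t. u t \<in> D_Neu a) \<and> cont_into_Hs {-a<..<a} 2 UNIV u \<and> W1inf_loc_L2 {-a<..<a} u \<and>
     (\<forall>t. \<exists>v. has_L2_time_deriv {-a<..<a} u t v \<and>
        (AE x in lebesgue_on {-a<..<a}.
           \<i> * v x + wderiv {-a<..<a} 2 (u t) x = complex_of_real l * zlog (u t x))) \<and>
     (AE x in lebesgue_on {-a<..<a}. u 0 x = \<phi> x)"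

text \<open>\<open>avg f x\<close> depends only on the class of \<open>f\<close> for \<open>x \<noteq> 0\<close>, while \<open>avg f 0 = f 0\<close>.\<close>

definition avg :: "(real \<Rightarrow> complex) \<Rightarrow> real \<Rightarrow> complex" where
  "avg f x = integral\<^sup>L (lebesgue_on {0..1}) (\<lambda>\<sigma>. f (\<sigma> * x))"

end

theory Submission
  imports Defs "HOL-Real_Asymp.Real_Asymp"
begin

text \<open>
  Write \<open>w = \<partial>\<^sub>x u\<close> and \<open>V = \<V>[w]\<close>. By uniqueness \<open>u(t)\<close> stays odd, so \<open>u = x V\<close>, and as long as
  \<open>\<bar>V\<bar>\<close> is bounded below, \<open>\<partial>\<^sub>x(u log \<bar>u\<bar>\<^sup>2) = w log x\<^sup>2 + G(V, w)\<close> with \<open>G\<close> Lipschitz. The singular part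
  is a real multiple of \<open>w\<close>, so it drops out of the energy identity for \<open>\<parallel>\<partial>\<^sub>x z\<parallel>\<^sup>2\<close>, and Hardy's
  inequality controls \<open>V\<close> by \<open>w\<close>. With \<open>z = u(t + h) - u(t)\<close> and \<open>z = u(t) - u(t\<^sub>0)\<close>, Gronwall's
  inequality shows that \<open>\<partial>\<^sub>x u\<close> is Lipschitz in time with values in \<open>L\<^sup>2\<close> and that
  \<open>\<parallel>\<partial>\<^sub>x \<partial>\<^sub>t u(t)\<parallel> \<le> exp(L \<bar>t - s\<bar>) \<parallel>\<partial>\<^sub>x \<partial>\<^sub>t u(s)\<parallel>\<close>. Hence the norm of \<open>\<partial>\<^sub>x \<partial>\<^sub>t u\<close> is continuous, so
  \<open>\<partial>\<^sub>x \<partial>\<^sub>t u\<close> is strongly continuous, and the equation turns this into \<open>u \<in> C(H\<^sup>3)\<close>. The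
  nondegeneracy of \<open>V\<close> is an open condition in time, so it has to fail on \<open>[-T, T]\<close> if \<open>T < \<infinity>\<close>.
\<close>

section \<open>Smooth functions and test functions\<close>

text \<open>A solution in C(H2) has a time derivative only in L2, so the equation cannot simply be
  differentiated in x: a third x-derivative of u has to be bought with one x-derivative of the time
  derivative v. At first that derivative is known at t = 0 only, where the H3 datum and the equation
  supply it. Two comparisons carry it to other times. Against the shift u(t + h), there is no
  source, and the bound moves to any other time. Difference quotients then pass to the limit by
  lower semicontinuity. The weight log x^2 is unbounded but lies in L2, so its product with a
  bounded function is in L2. This suffices for continuity in time, where uniform control of W is at
  hand; the Gronwall constant instead needs the cancellation Re(i log x^2 |w|^2) = 0. Convergence in
  H2 makes W, hence V, converge uniformly in x, which is why a lower bound for |V| survives small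
  changes of time.\<close>

fun ndiff :: "nat \<Rightarrow> (real \<Rightarrow> real) \<Rightarrow> bool" where
  "ndiff 0 f = True"
| "ndiff (Suc n) f = (\<exists>f'. (\<forall>x. (f has_real_derivative f' x) (at x)) \<and> ndiff n f')"

definition smooth :: "(real \<Rightarrow> real) \<Rightarrow> bool" where
  "smooth f \<longleftrightarrow> (\<forall>n. ndiff n f)"

lemma ndiff_Suc_iff: "ndiff (Suc n) f \<longleftrightarrow> (\<forall>x. f field_differentiable at x) \<and> ndiff n (deriv f)"
proof
  assume "ndiff (Suc n) f"
  then obtain f' where f': "\<And>x. (f has_real_derivative f' x) (at x)" "ndiff n f'" by auto
  have "deriv f = f'" using f'(1) DERIV_imp_deriv by blast
  with f' show "(\<forall>x. f field_differentiable at x) \<and> ndiff n (deriv f)"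
    unfolding field_differentiable_def by auto
qed (auto simp flip: DERIV_deriv_iff_field_differentiable)

text \<open>Links the inductive form, in which closure under sums, products and affine substitution
  is a plain induction, with the iterated \<open>deriv\<close> that \<open>test_fun\<close>
  uses.\<close>

lemma ndiff_iff: "ndiff n f \<longleftrightarrow> (\<forall>m<n. \<forall>x. (deriv ^^ m) f field_differentiable at x)"
proof (induction n arbitrary: f)
  case (Suc n)
  have "(\<forall>m<Suc n. \<forall>x. (deriv ^^ m) f field_differentiable at x) \<longleftrightarrow>
    (\<forall>x. f field_differentiable at x) \<and> (\<forall>m<n. \<forall>x. (deriv ^^ m) (deriv f) field_differentiable at x)"
    by (auto simp: less_Suc_eq_0_disj funpow_swap1)
  then show ?case by (simp only: ndiff_Suc_iff Suc)
qed simp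

lemma smooth_iff: "smooth f \<longleftrightarrow> (\<forall>n x. (deriv ^^ n) f field_differentiable at x)"
  unfolding smooth_def ndiff_iff by blast

lemma ndiff_SucD: "ndiff (Suc n) f \<Longrightarrow> ndiff n f"
  by (simp add: ndiff_iff)

lemma smooth_deriv: "smooth f \<Longrightarrow> smooth (deriv f)"
  unfolding smooth_def using ndiff_Suc_iff by blast

lemma smooth_DERIV: "smooth f \<Longrightarrow> (f has_real_derivative deriv f x) (at x)"
  unfolding smooth_def using ndiff_Suc_iff DERIV_deriv_iff_field_differentiable by blast

lemma smooth_from_deriv:
  assumes "\<And>x. (f has_real_derivative f' x) (at x)" "smooth f'"
  shows "smooth f"
  unfolding smooth_def
proof
  fix n show "ndiff n f" using assms by (cases n) (auto simp: smooth_def)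
qed

lemma continuous_on_smooth: "smooth f \<Longrightarrow> continuous_on S f"
  by (meson DERIV_continuous_on has_field_derivative_at_within smooth_DERIV)

lemma ndiff_const: "ndiff n (\<lambda>_. c)"
proof (induction n arbitrary: c)
  case (Suc n) then show ?case by (auto intro!: exI[of _ "\<lambda>_. 0"])
qed simp

lemma ndiff_add: "ndiff n f \<Longrightarrow> ndiff n g \<Longrightarrow> ndiff n (\<lambda>x. f x + g x)"
proof (induction n arbitrary: f g)
  case (Suc n)
  then obtain f' g' where "\<forall>x. (f has_real_derivative f' x) (at x)" "ndiff n f'"
     "\<forall>x. (g has_real_derivative g' x) (at x)" "ndiff n g'" by auto
  with Suc show ?case
    by (auto intro!: exI[of _ "\<lambda>x. f' x + g' x"] derivative_intros)
qed simp

lemma ndiff_mult: "ndiff n f \<Longrightarrow> ndiff n g \<Longrightarrow> ndiff n (\<lambda>x. f x * g x)"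
proof (induction n arbitrary: f g)
  case (Suc n)
  then obtain f' g' where *: "\<forall>x. (f has_real_derivative f' x) (at x)" "ndiff n f'"
     "\<forall>x. (g has_real_derivative g' x) (at x)" "ndiff n g'" by auto
  have "ndiff n (\<lambda>x. f' x * g x + g' x * f x)"
    using * Suc ndiff_SucD by (intro ndiff_add) blast+
  with * show ?case
    by (auto intro!: exI[of _ "\<lambda>x. f' x * g x + g' x * f x"] derivative_eq_intros simp: algebra_simps)
qed simp

lemma ndiff_affine: "ndiff n f \<Longrightarrow> ndiff n (\<lambda>x. f (m * x + b))"
proof (induction n arbitrary: f)
  case (Suc n)
  then obtain f' where *: "\<And>x. (f has_real_derivative f' x) (at x)" "ndiff n f'" by auto
  have "ndiff n (\<lambda>x. m * f' (m * x + b))"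
    using * Suc by (intro ndiff_mult ndiff_const) auto
  moreover have "((\<lambda>x. f (m * x + b)) has_real_derivative m * f' (m * x + b)) (at x)" for x
    by (rule DERIV_cong[OF DERIV_chain2[OF *(1)]]) (auto intro!: derivative_eq_intros)
  ultimately show ?case by (auto intro!: exI[of _ "\<lambda>x. m * f' (m * x + b)"])
qed simp

lemma smooth_const: "smooth (\<lambda>_. c)"
  and smooth_add: "smooth f \<Longrightarrow> smooth g \<Longrightarrow> smooth (\<lambda>x. f x + g x)"
  and smooth_mult: "smooth f \<Longrightarrow> smooth g \<Longrightarrow> smooth (\<lambda>x. f x * g x)"
  and smooth_affine: "smooth f \<Longrightarrow> smooth (\<lambda>x. f (m * x + b))"
  by (simp_all add: smooth_def ndiff_const ndiff_add ndiff_mult ndiff_affine)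

text \<open>The family is closed under differentiation up to linear combinations, which gives smoothness.\<close>

definition exp_bump :: "nat \<Rightarrow> real \<Rightarrow> real" where
  "exp_bump k x = (if x > 0 then (1 / x) ^ k * exp (- (1 / x)) else 0)"

text \<open>With y = 1/x the quotient becomes y^(k+1) / exp y. It is the right-hand difference
  quotient at 0, so every member of the family is flat there.\<close>

lemma exp_bump_over_tendsto: "((\<lambda>x. exp_bump k x / x) \<longlongrightarrow> 0) (at_right 0)"
proof -
  have "((\<lambda>x::real. (inverse x) ^ Suc k / exp (inverse x)) \<longlongrightarrow> 0) (at_right 0)"
    using filterlim_compose[OF tendsto_power_div_exp_0 filterlim_inverse_at_top_right] .
  moreover have "eventually (\<lambda>x. (inverse x) ^ Suc k / exp (inverse x) = exp_bump k x / x) (at_right (0::real))"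
    by (rule eventually_at_right_less[of 0, THEN eventually_mono])
       (auto simp: exp_bump_def exp_minus field_simps)
  ultimately show ?thesis by (rule Lim_transform_eventually)
qed

lemma exp_bump_DERIV:
  "(exp_bump k has_real_derivative (- real k) * exp_bump (Suc k) x + exp_bump (Suc (Suc k)) x) (at x)"
proof -
  consider "x > 0" | "x < 0" | "x = 0" by linarith
  then show ?thesis
  proof cases
    case 1
    have "((\<lambda>x. (1 / x) ^ k * exp (- (1 / x))) has_real_derivative
        (- real k) * exp_bump (Suc k) x + exp_bump (Suc (Suc k)) x) (at x)"
      using 1 unfolding divide_inverse exp_bump_def by (cases k) (auto intro!: derivative_eq_intros simp: algebra_simps power2_eq_square,
        metis One_nat_def gr0I mult.commute power_minus_mult)
    then show ?thesis
      by (rule has_field_derivative_transform_within_open[of _ _ _ "{0<..}"]) (use 1 in \<open>auto simp: exp_bump_def\<close>)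
  next
    case 2
    have "((\<lambda>_. 0::real) has_real_derivative 0) (at x)" by simp
    then have "(exp_bump k has_real_derivative 0) (at x)"
      by (rule has_field_derivative_transform_within_open[of _ _ _ "{..<0}"])
        (use 2 in \<open>auto simp: exp_bump_def\<close>)
    then show ?thesis using 2 by (simp add: exp_bump_def[of _ x])
  next
    case 3
    have "((\<lambda>y. (exp_bump k y - exp_bump k 0) / (y - 0)) \<longlongrightarrow> 0) (at 0)"
      unfolding filterlim_at_split
    proof
      show "((\<lambda>y. (exp_bump k y - exp_bump k 0) / (y - 0)) \<longlongrightarrow> 0) (at_left 0)"
        by (rule tendsto_eventually) (auto simp: eventually_at_filter exp_bump_def)
      show "((\<lambda>y. (exp_bump k y - exp_bump k 0) / (y - 0)) \<longlongrightarrow> 0) (at_right 0)"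
        using exp_bump_over_tendsto[of k] by (simp add: exp_bump_def[of k 0])
    qed
    then show ?thesis using 3
      by (simp add: has_field_derivative_iff exp_bump_def[of "Suc _" 0])
  qed
qed

lemma ndiff_exp_bump: "ndiff n (exp_bump k)"
proof (induction n arbitrary: k)
  case (Suc n)
  have "ndiff n (\<lambda>x. (- real k) * exp_bump (Suc k) x + exp_bump (Suc (Suc k)) x)"
    by (intro ndiff_add ndiff_mult ndiff_const Suc)
  then show ?case unfolding ndiff.simps
    by (intro exI[of _ "\<lambda>x. (- real k) * exp_bump (Suc k) x + exp_bump (Suc (Suc k)) x"] conjI allI exp_bump_DERIV)
qed simp

text \<open>The factor \<open>Suc n\<close> steepens both flanks while the support stays in [c, d],
  so the bumps converge boundedly to the indicator of the open interval.\<close>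

definition bump :: "real \<Rightarrow> real \<Rightarrow> nat \<Rightarrow> real \<Rightarrow> real" where
  "bump c d n x = exp_bump 0 (real (Suc n) * (x - c)) * exp_bump 0 (real (Suc n) * (d - x))"

lemma smooth_bump: "smooth (bump c d n)"
proof -
  have "smooth (exp_bump 0)" by (simp add: smooth_def ndiff_exp_bump)
  from smooth_mult[OF smooth_affine[OF this, of "real (Suc n)" "- real (Suc n) * c"] smooth_affine[OF this, of "- real (Suc n)" "real (Suc n) * d"]]
  show ?thesis by (simp add: bump_def[abs_def] algebra_simps)
qed

lemma bump_eq_0: "x \<notin> {c<..<d} \<Longrightarrow> bump c d n x = 0"
  by (auto simp: bump_def exp_bump_def zero_less_mult_iff)

lemma bump_pos: "x \<in> {c<..<d} \<Longrightarrow> bump c d n x > 0"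
  by (auto simp: bump_def exp_bump_def zero_less_mult_iff)

lemma exp_bump_0_bounds: "0 \<le> exp_bump 0 x" "exp_bump 0 x \<le> 1"
  by (auto simp: exp_bump_def)

lemma bump_bounds: "0 \<le> bump c d n x" "bump c d n x \<le> 1"
  by (simp_all only: bump_def exp_bump_0_bounds mult_le_one mult_nonneg_nonneg)

lemma exp_bump_scaled_tendsto: "x > 0 \<Longrightarrow> (\<lambda>n. exp_bump 0 (real (Suc n) * x)) \<longlonglongrightarrow> 1"
  unfolding exp_bump_def by (simp add: mult_pos_pos) real_asymp

lemma bump_tendsto: "(\<lambda>n. bump c d n x) \<longlonglongrightarrow> indicator {c<..<d} x"
proof (cases "x \<in> {c<..<d}")
  case True
  then have "(\<lambda>n. bump c d n x) \<longlonglongrightarrow> 1 * 1"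
    unfolding bump_def by (intro tendsto_mult exp_bump_scaled_tendsto) auto
  then show ?thesis using True by simp
qed (simp add: bump_eq_0)

section \<open>Test functions and their supports\<close>

lemma test_fun_iff: "test_fun \<Omega> \<psi> \<longleftrightarrow>
  smooth \<psi> \<and> compact (closure {x. \<psi> x \<noteq> 0}) \<and> closure {x. \<psi> x \<noteq> 0} \<subseteq> \<Omega>"
  by (simp add: test_fun_def smooth_iff)

lemma test_funI:
  assumes "smooth \<psi>" "\<And>x. x \<notin> {c..d} \<Longrightarrow> \<psi> x = 0" "{c..d} \<subseteq> \<Omega>"
  shows "test_fun \<Omega> \<psi>"
proof -
  have "closure {x. \<psi> x \<noteq> 0} \<subseteq> {c..d}"
    using assms(2) by (intro closure_minimal subsetI; simp; metis)
  moreover from this have "compact (closure {x. \<psi> x \<noteq> 0})"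
    using compact_Icc bounded_subset compact_eq_bounded_closed by (metis closed_closure)
  ultimately show ?thesis using assms by (auto simp: test_fun_iff)
qed

lemma test_fun_bump: "{c..d} \<subseteq> \<Omega> \<Longrightarrow> test_fun \<Omega> (bump c d n)"
  by (rule test_funI[OF smooth_bump]) (auto intro!: bump_eq_0)

lemma test_fun_smooth: "test_fun \<Omega> \<psi> \<Longrightarrow> smooth \<psi>"
  by (simp add: test_fun_iff)

lemma test_fun_support:
  assumes "test_fun {l<..<r} \<psi>"
  obtains c d where "l < c" "d < r" "\<And>x. x \<notin> {c..d} \<Longrightarrow> \<psi> x = 0"
proof (cases "closure {x. \<psi> x \<noteq> 0} = {}")
  case True
  \<comment> \<open>For the zero function any bounds will do. Since \<open>l < r\<close> is not
    assumed, the interval offered may be empty.\<close>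
  show ?thesis by (rule that[of "l + 1" "r - 1"]) (use True in auto)
next
  case False
  let ?K = "closure {x. \<psi> x \<noteq> 0}"
  have K: "compact ?K" "?K \<subseteq> {l<..<r}" using assms by (auto simp: test_fun_iff)
  obtain c where c: "c \<in> ?K" "\<And>x. x \<in> ?K \<Longrightarrow> c \<le> x" using compact_attains_inf[OF K(1) False] by auto
  obtain d where d: "d \<in> ?K" "\<And>x. x \<in> ?K \<Longrightarrow> x \<le> d" using compact_attains_sup[OF K(1) False] by auto
  show ?thesis
  proof (rule that[of c d])
    fix x assume "x \<notin> {c..d}"
    then have "x \<notin> ?K" using c d by fastforce
    then show "\<psi> x = 0" using closure_subset[of "{x. \<psi> x \<noteq> 0}"] by blast
  qed (use c d K in auto)
qed

lemma test_fun_deriv: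
  assumes "test_fun {l<..<r} \<psi>" shows "test_fun {l<..<r} (deriv \<psi>)"
proof -
  obtain c d where cd: "l < c" "d < r" "\<And>x. x \<notin> {c..d} \<Longrightarrow> \<psi> x = 0"
    using test_fun_support[OF assms] by blast
  show ?thesis
  proof (rule test_funI[of _ c d])
    show "smooth (deriv \<psi>)" using assms smooth_deriv test_fun_smooth by blast
    fix x assume x: "x \<notin> {c..d}"
    have "((\<lambda>_. 0::real) has_real_derivative 0) (at x)" by simp
    then have "(\<psi> has_real_derivative 0) (at x)"
      by (rule has_field_derivative_transform_within_open[of _ _ _ "- {c..d}"])
         (use x cd(3) in \<open>auto simp: open_Compl\<close>)
    then show "deriv \<psi> x = 0" by (rule DERIV_imp_deriv)
  qed (use cd in auto)
qed

section \<open>The fundamental lemma of the calculus of variations\<close>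

lemma sigma_finite_lebesgue: "sigma_finite_measure (lebesgue :: real measure)"
proof
  show "\<exists>A. countable A \<and> A \<subseteq> sets (lebesgue :: real measure) \<and> \<Union> A = space lebesgue \<and>
      (\<forall>a\<in>A. emeasure lebesgue a \<noteq> \<infinity>)"
  proof (intro exI conjI ballI)
    show "\<Union> (range (\<lambda>n. {- real n..real n})) = space lebesgue"
      by (auto simp: abs_le_iff minus_le_iff) (metis abs_le_iff minus_le_iff real_arch_simple)
  qed auto
qed

text \<open>Dynkin's argument: open intervals form an intersection-stable generator of the Borel
  sets, and the sets over which g integrates to 0 are closed under complements and disjoint
  unions.\<close>

lemma AE_zero_if_interval_integrals_zero:
  fixes g :: "real \<Rightarrow> complex"
  assumes g: "integrable lebesgue g"
    and zero: "\<And>c d. integral\<^sup>L lebesgue (\<lambda>x. indicator {c<..<d} x *\<^sub>R g x) = 0"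
  shows "AE x in lebesgue. g x = 0"
proof (rule sigma_finite_measure.density_zero[OF _ g])
  show "sigma_finite_measure (lebesgue :: real measure)" by (rule sigma_finite_lebesgue)
  let ?I = "\<lambda>A. set_lebesgue_integral lebesgue A g"
  have int: "set_integrable lebesgue A g" if "A \<in> sets lebesgue" for A
    using g that unfolding set_integrable_def by (rule integrable_mult_indicator[rotated])
  \<comment> \<open>Complements need the integral over the whole line, reached by exhausting it with
    bounded intervals.\<close>
  have UN: "?I UNIV = 0"
  proof -
    have "(\<lambda>n. integral\<^sup>L lebesgue (\<lambda>x. indicator {- real n<..<real n} x *\<^sub>R g x))
       \<longlonglongrightarrow> integral\<^sup>L lebesgue (\<lambda>x. g x)"
    proof (rule integral_dominated_convergence[where w = "\<lambda>x. norm (g x)"])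
      show "AE x in lebesgue. (\<lambda>n. indicat_real {- real n<..<real n} x *\<^sub>R g x) \<longlonglongrightarrow> g x"
      proof (rule AE_I2)
        fix x :: real
        obtain N where "\<bar>x\<bar> < real N" using reals_Archimedean2 by blast
        then have "\<forall>n\<ge>N. indicat_real {- real n<..<real n} x *\<^sub>R g x = g x"
          by (auto simp: indicator_def)
        then show "(\<lambda>n. indicat_real {- real n<..<real n} x *\<^sub>R g x) \<longlonglongrightarrow> g x"
          by (intro tendsto_eventually) (auto simp: eventually_sequentially)
      qed
      show "(\<lambda>x. indicat_real {- real n<..<real n} x *\<^sub>R g x) \<in> borel_measurable lebesgue" for n
        using int[of "{- real n<..<real n}"] unfolding set_integrable_def by auto
    qed (use g in \<open>auto simp: indicator_def\<close>)
    then show ?thesis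
      using LIMSEQ_unique[OF tendsto_const, of 0] by (simp add: zero set_lebesgue_integral_def)
  qed
  have borel: "?I A = 0" if "A \<in> sets borel" for A
  proof -
    have "A \<in> sigma_sets UNIV (range (\<lambda>(a, b). {a<..<b::real}))"
      using that by (subst (asm) borel_eq_box[where 'a=real, unfolded box_real]) simp
    then show ?thesis
    proof (induction rule: sigma_sets_induct_disjoint[rotated 2, consumes 1, case_names basic empty compl union Int Pow])
      case (basic A) then show ?case by (auto simp: zero set_lebesgue_integral_def)
    next
      case (compl A)
      then have A: "A \<in> sets lebesgue"
        by (metis borel_eq_box[where 'a=real, unfolded box_real] sets_completionI_sets sets_lborel sets_measure_of subset_UNIV Pow_UNIV)
      have "?I (A \<union> (UNIV - A)) = ?I A + ?I (UNIV - A)"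
        by (rule set_integral_Un) (use A in \<open>auto intro!: int\<close>)
      then show ?case using compl UN by simp
    next
      case (union A)
      then have A: "A i \<in> sets lebesgue" for i
        by (metis borel_eq_box[where 'a=real, unfolded box_real] sets_completionI_sets sets_lborel sets_measure_of subset_UNIV Pow_UNIV range_subsetD)
      have "?I (\<Union>i. A i) = (\<Sum>i. ?I (A i))"
        by (rule lebesgue_integral_countable_add)
           (use A union in \<open>auto intro!: int simp: disjoint_family_on_def\<close>)
      then show ?case using union by simp
    next
      case Int
      show ?case
        unfolding Int_stable_def by (clarsimp simp: image_iff) blast
    qed (auto simp: set_lebesgue_integral_def)
  qed
  \<comment> \<open>A Lebesgue set differs from a Borel set by a null set, which no integral
    sees.\<close>
  fix A :: "real set" assume A: "A \<in> sets lebesgue"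
  then obtain S N N' where "A = S \<union> N" "N \<subseteq> N'" "N' \<in> null_sets lborel" "S \<in> sets lborel"
    by (auto elim: sets_completionE)
  then have "AE x in lebesgue. x \<in> A \<longleftrightarrow> x \<in> S"
    using AE_not_in[OF null_sets_completionI[of N' lborel]] by (auto elim!: eventually_mono)
  then have "?I A = ?I S"
    unfolding set_lebesgue_integral_def
    using int[OF A] int[of S] \<open>S \<in> sets lborel\<close>
    by (intro integral_cong_AE) (auto simp: set_integrable_def indicator_def elim!: eventually_mono)
  then show "?I A = 0" using borel \<open>S \<in> sets lborel\<close> by simp
qed

text \<open>Bumps approximate indicators of intervals, so g integrates to 0 over each of them. As g
  is only locally integrable, this is done inside compact subintervals [p, q] of the domain.\<close>

lemma fundamental_lemma_variations:
  assumes "open \<Omega>" and g: "loc_integrable \<Omega> g"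
    and zero: "\<And>\<psi>. test_fun \<Omega> \<psi> \<Longrightarrow> integral\<^sup>L (lebesgue_on \<Omega>) (\<lambda>x. \<psi> x *\<^sub>R g x) = 0"
  shows "AE x in lebesgue_on \<Omega>. g x = 0"
proof -
  have \<Omega>: "\<Omega> \<in> sets lebesgue" using \<open>open \<Omega>\<close> by simp
  have loc: "AE x in lebesgue. x \<in> {p<..<q} \<longrightarrow> g x = 0" if pq: "{p..q} \<subseteq> \<Omega>" for p q
  proof -
    define g0 where "g0 = (\<lambda>x. indicat_real {p<..<q} x *\<^sub>R g x)"
    have "set_integrable lebesgue {p..q} g" using g pq unfolding loc_integrable_def by blast
    then have "set_integrable lebesgue {p<..<q} g" by (rule set_integrable_subset) auto
    then have g0: "integrable lebesgue g0" by (simp add: g0_def set_integrable_def)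
    have "AE x in lebesgue. g0 x = 0"
    proof (rule AE_zero_if_interval_integrals_zero[OF g0])
      fix c d
      \<comment> \<open>Clipping to [p, q] keeps the support of the bump inside the domain.\<close>
      define c' d' where "c' = max c p" "d' = min d q"
      have eq: "indicat_real {c<..<d} x *\<^sub>R g0 x = indicat_real {c'<..<d'} x *\<^sub>R g0 x" for x
        by (auto simp: g0_def c'_d'_def indicator_def)
      show "integral\<^sup>L lebesgue (\<lambda>x. indicat_real {c<..<d} x *\<^sub>R g0 x) = 0"
      proof (cases "c' < d'")
        case True
        have "(\<lambda>n. integral\<^sup>L lebesgue (\<lambda>x. bump c' d' n x *\<^sub>R g0 x)) \<longlonglongrightarrow>
          integral\<^sup>L lebesgue (\<lambda>x. indicator {c'<..<d'} x *\<^sub>R g0 x)"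
        proof (rule integral_dominated_convergence[where w = "\<lambda>x. norm (g0 x)"])
          show "AE x in lebesgue. (\<lambda>n. bump c' d' n x *\<^sub>R g0 x) \<longlonglongrightarrow> indicat_real {c'<..<d'} x *\<^sub>R g0 x"
            by (intro AE_I2 tendsto_scaleR bump_tendsto tendsto_const)
          have "bump c' d' n \<in> borel_measurable lebesgue" for n
            using continuous_on_smooth[OF smooth_bump, of UNIV]
            by (intro measurable_completion) (simp add: borel_measurable_continuous_onI)
          then show "(\<lambda>x. bump c' d' n x *\<^sub>R g0 x) \<in> borel_measurable lebesgue" for n
            using g0 by auto
          show "(\<lambda>x. indicat_real {c'<..<d'} x *\<^sub>R g0 x) \<in> borel_measurable lebesgue"
            using g0 by (intro borel_measurable_scaleR borel_measurable_indicator) auto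
          show "AE x in lebesgue. norm (bump c' d' n x *\<^sub>R g0 x) \<le> norm (g0 x)" for n
            using bump_bounds by (auto intro!: mult_left_le_one_le)
        qed (use g0 in auto)
        moreover have "integral\<^sup>L lebesgue (\<lambda>x. bump c' d' n x *\<^sub>R g0 x) = 0" for n
        proof -
          have sub: "{c'..d'} \<subseteq> {p..q}" by (auto simp: c'_d'_def)
          have "integral\<^sup>L (lebesgue_on \<Omega>) (\<lambda>x. bump c' d' n x *\<^sub>R g x) = 0"
            by (rule zero[OF test_fun_bump]) (use sub pq in blast)
          moreover have "indicat_real \<Omega> x *\<^sub>R bump c' d' n x *\<^sub>R g x = bump c' d' n x *\<^sub>R g0 x" for x
            using pq bump_eq_0[of x c' d' n] by (auto simp: g0_def indicator_def c'_d'_def)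
          ultimately show ?thesis using \<Omega> by (simp add: integral_restrict_space)
        qed
        ultimately show ?thesis using LIMSEQ_unique[OF tendsto_const, of 0] by (simp add: eq)
      next
        case False
        then have "{c'<..<d'} = {}" by auto
        then show ?thesis by (simp add: eq)
      qed
    qed
    then show ?thesis by (auto simp: g0_def indicator_def elim!: eventually_mono split: if_splits)
  qed
  \<comment> \<open>Intervals with rational endpoints cover the open set by countably many pieces,
    so the exceptional null sets can be united.\<close>
  define P where "P = {(p, q) \<in> \<rat> \<times> \<rat>. {p..q::real} \<subseteq> \<Omega>}"
  have "countable P"
    by (rule countable_subset[of _ "\<rat> \<times> \<rat>"]) (auto simp: P_def intro: countable_rat)
  then have "AE x in lebesgue. \<forall>z\<in>P. x \<in> {fst z<..<snd z} \<longrightarrow> g x = 0"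
    using loc by (subst AE_ball_countable) (auto simp: P_def simp del: greaterThanLessThan_iff)
  then have "AE x in lebesgue. x \<in> \<Omega> \<longrightarrow> g x = 0"
  proof (rule eventually_mono, safe)
    fix x assume x: "\<forall>z\<in>P. x \<in> {fst z<..<snd z} \<longrightarrow> g x = 0" "x \<in> \<Omega>"
    obtain e where e: "e > 0" "cball x e \<subseteq> \<Omega>"
      using \<open>open \<Omega>\<close> x(2) open_contains_cball by blast
    obtain p where p: "p \<in> \<rat>" "x - e < p" "p < x" using Rats_dense_in_real[of "x - e" x] e by auto
    obtain q where q: "q \<in> \<rat>" "x < q" "q < x + e" using Rats_dense_in_real[of x "x + e"] e by auto
    have "{p..q} \<subseteq> cball x e" using p q by (auto simp: dist_real_def)
    then have "(p, q) \<in> P" using p q e by (auto simp: P_def)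
    then show "g x = 0" using x p q by force
  qed
  then show ?thesis using \<Omega> by (simp add: AE_restrict_space_iff)
qed

lemma integrable_test_fun_scaleR:
  assumes "test_fun {l<..<r} \<psi>" "loc_integrable {l<..<r} f"
  shows "integrable (lebesgue_on {l<..<r}) (\<lambda>x. \<psi> x *\<^sub>R f x)"
proof -
  obtain c d where cd: "l < c" "d < r" "\<And>x. x \<notin> {c..d} \<Longrightarrow> \<psi> x = 0"
    using test_fun_support[OF assms(1)] by blast
  have cont: "continuous_on UNIV \<psi>" using assms(1) continuous_on_smooth test_fun_smooth by blast
  have "set_integrable lebesgue {c..d} f"
    using assms(2) cd(1,2) unfolding loc_integrable_def by (simp add: subset_eq)
  then have f: "integrable lebesgue (\<lambda>x. indicat_real {c..d} x *\<^sub>R f x)" by (simp add: set_integrable_def)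
  obtain B where B: "\<And>x. x \<in> {c..d} \<Longrightarrow> norm (\<psi> x) \<le> B"
    using compact_imp_bounded[OF compact_continuous_image[OF continuous_on_subset[OF cont] compact_Icc[of c d]]]
    unfolding bounded_iff by blast
  have "integrable lebesgue (\<lambda>x. \<psi> x *\<^sub>R (indicat_real {c..d} x *\<^sub>R f x))"
  proof (rule Bochner_Integration.integrable_bound[OF integrable_scaleR_right[OF f, of B]])
    have "\<psi> \<in> borel_measurable lebesgue"
      using cont by (intro measurable_completion) (simp add: borel_measurable_continuous_onI)
    then show "(\<lambda>x. \<psi> x *\<^sub>R indicat_real {c..d} x *\<^sub>R f x) \<in> borel_measurable lebesgue"
      by (intro borel_measurable_scaleR[OF _ borel_measurable_integrable[OF f]])
    show "AE x in lebesgue. norm (\<psi> x *\<^sub>R indicat_real {c..d} x *\<^sub>R f x) \<le> norm (B *\<^sub>R indicat_real {c..d} x *\<^sub>R f x)"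
    proof (rule AE_I2)
      fix x
      show "norm (\<psi> x *\<^sub>R indicat_real {c..d} x *\<^sub>R f x) \<le> norm (B *\<^sub>R indicat_real {c..d} x *\<^sub>R f x)"
        using B[of x] by (auto simp: indicator_def intro!: mult_right_mono)
    qed
  qed
  also have "(\<lambda>x. \<psi> x *\<^sub>R (indicat_real {c..d} x *\<^sub>R f x)) = (\<lambda>x. indicat_real {l<..<r} x *\<^sub>R (\<psi> x *\<^sub>R f x))"
    using cd by (fastforce simp: indicator_def)
  finally show ?thesis by (simp add: integrable_restrict_space)
qed

section \<open>Functions with vanishing weak derivative\<close>

lemma loc_integrable_const: "loc_integrable \<Omega> (\<lambda>_. c)"
  unfolding loc_integrable_def
  by (auto simp: set_integrable_def intro!: absolutely_integrable_on_const[unfolded set_integrable_def] lmeasurable_compact)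

lemma loc_integrable_diff:
  "loc_integrable \<Omega> f \<Longrightarrow> loc_integrable \<Omega> g \<Longrightarrow> loc_integrable \<Omega> (\<lambda>x. f x - g x)"
  unfolding loc_integrable_def by (blast intro: set_integral_diff)

text \<open>Mean zero is exactly what makes the primitive vanish again to the right of the
  support.\<close>

lemma test_fun_antiderivative:
  assumes "test_fun {l<..<r} \<theta>" and "integral\<^sup>L (lebesgue_on {l<..<r}) \<theta> = 0"
  obtains \<psi> where "test_fun {l<..<r} \<psi>" "deriv \<psi> = \<theta>"
proof -
  obtain c d where cd: "l < c" "d < r" "\<And>x. x \<notin> {c..d} \<Longrightarrow> \<theta> x = 0"
    using test_fun_support[OF assms(1)] by blast
  have cont: "continuous_on S \<theta>" for S using assms(1) continuous_on_smooth test_fun_smooth by blast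
  have "integrable (lebesgue_on {l<..<r}) \<theta>"
    using integrable_test_fun_scaleR[OF assms(1) loc_integrable_const, of 1]
    by (simp add: scaleR_conv_of_real complex_of_real_integrable_eq)
  then have "(\<theta> has_integral 0) {l<..<r}"
    using has_integral_integral_lebesgue_on[of "{l<..<r}" \<theta>] assms(2) by auto
  then have "((\<lambda>x. if x \<in> {l<..<r} then \<theta> x else 0) has_integral 0) UNIV"
    by (rule has_integral_restrict_UNIV[THEN iffD2])
  also have "(\<lambda>x. if x \<in> {l<..<r} then \<theta> x else 0) = \<theta>" using cd by fastforce
  finally have int0: "(\<theta> has_integral 0) UNIV" .
  \<comment> \<open>Starting one unit to the left of the support makes every point from c on
    interior to the domain of integration, so the derivative there is two-sided.\<close>
  define \<psi> where "\<psi> = (\<lambda>x. integral {c - 1..x} \<theta>)"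
  have left: "\<psi> x = 0" if "x < c" for x
    unfolding \<psi>_def by (intro integral_unique has_integral_is_0) (use that cd in auto)
  have right: "\<psi> x = 0" if "x > d" for x
  proof (cases "x < c")
    case False
    have "((\<lambda>y. if y \<in> {c-1..x} then \<theta> y else 0) has_integral 0) UNIV"
      by (rule has_integral_eq[OF _ int0]) (use that cd(3) False in \<open>auto\<close>)
    then have "(\<theta> has_integral 0) {c-1..x}" by (simp only: has_integral_restrict_UNIV)
    then show ?thesis by (auto simp: \<psi>_def)
  qed (use left in auto)
  have der: "(\<psi> has_real_derivative \<theta> x) (at x)" for x
  proof (cases "x < c")
    case True
    have "((\<lambda>_. 0) has_real_derivative \<theta> x) (at x)" using cd(3)[of x] True by simp
    then show ?thesis
      by (rule has_field_derivative_transform_within_open[of _ _ _ "{..<c}"]) (use True left in auto)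
  next
    case False
    have "(\<psi> has_real_derivative \<theta> x) (at x within {c - 1..x + 1})"
      unfolding \<psi>_def has_real_derivative_iff_has_vector_derivative
      by (rule integral_has_vector_derivative[OF cont]) (use False in auto)
    then show ?thesis using False by (simp add: at_within_Icc_at)
  qed
  show ?thesis
  proof (rule that)
    have "smooth \<psi>" by (rule smooth_from_deriv[OF der]) (use assms test_fun_smooth in blast)
    then show "test_fun {l<..<r} \<psi>"
      by (rule test_funI[of _ c d]) (use left right cd in force)+
    show "deriv \<psi> = \<theta>" using der DERIV_imp_deriv by blast
  qed
qed

lemma test_fun_linear:
  assumes "test_fun {l<..<r} f" "test_fun {l<..<r} g"
  shows "test_fun {l<..<r} (\<lambda>x. f x + k * g x)"
proof -
  obtain c d where cd: "l < c" "d < r" "\<And>x. x \<notin> {c..d} \<Longrightarrow> f x = 0"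
    using test_fun_support[OF assms(1)] by blast
  obtain c' d' where cd': "l < c'" "d' < r" "\<And>x. x \<notin> {c'..d'} \<Longrightarrow> g x = 0"
    using test_fun_support[OF assms(2)] by blast
  show ?thesis
  proof (rule test_funI[of _ "min c c'" "max d d'"])
    show "smooth (\<lambda>x. f x + k * g x)"
      using assms by (intro smooth_add smooth_mult smooth_const test_fun_smooth)
    fix x assume "x \<notin> {min c c'..max d d'}"
    then have "x \<notin> {c..d}" "x \<notin> {c'..d'}" by auto
    then show "f x + k * g x = 0" using cd(3) cd'(3) by simp
  qed (use cd cd' in auto)
qed

text \<open>Subtracting a multiple of one fixed bump \<open>\<rho>\<close> gives any test function
  mean zero and makes it a derivative. The constant is the \<open>\<rho>\<close>-weighted mean of
  f.\<close>

lemma du_Bois_Reymond: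
  assumes "l < r" and f: "loc_integrable {l<..<r} f"
    and zero: "\<And>\<psi>. test_fun {l<..<r} \<psi> \<Longrightarrow>
      integral\<^sup>L (lebesgue_on {l<..<r}) (\<lambda>x. deriv \<psi> x *\<^sub>R f x) = 0"
  obtains c where "AE x in lebesgue_on {l<..<r}. f x = c"
proof -
  let ?M = "lebesgue_on {l<..<r}"
  define m where "m = (r - l) / 4"
  define \<rho> where "\<rho> = bump (l + m) (r - m) 0"
  have m: "m > 0" "l + m < r - m" using \<open>l < r\<close> by (auto simp: m_def field_simps)
  have \<rho>: "test_fun {l<..<r} \<rho>"
    unfolding \<rho>_def by (rule test_fun_bump) (use m in auto)
  have int1: "integrable ?M \<psi>" if "test_fun {l<..<r} \<psi>" for \<psi>
    using integrable_test_fun_scaleR[OF that loc_integrable_const, of 1]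
    by (simp add: scaleR_conv_of_real complex_of_real_integrable_eq)
  define J where "J = integral\<^sup>L ?M \<rho>"
  have "J \<noteq> 0"
  proof
    assume "J = 0"
    then have "AE x in ?M. \<rho> x = 0"
      using integral_nonneg_eq_0_iff_AE[OF int1[OF \<rho>]] bump_bounds by (auto simp: J_def \<rho>_def)
    then have "AE x in lebesgue. x \<in> {l<..<r} \<longrightarrow> \<rho> x = 0" by (simp add: AE_restrict_space_iff)
    then have "AE x in lebesgue. x \<notin> {l+m<..<r-m}"
    proof (rule eventually_mono)
      fix x assume x: "x \<in> {l<..<r} \<longrightarrow> \<rho> x = 0"
      show "x \<notin> {l+m<..<r-m}"
      proof
        assume "x \<in> {l+m<..<r-m}"
        then have "\<rho> x > 0" "x \<in> {l<..<r}" using m by (auto simp: \<rho>_def intro!: bump_pos)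
        then show False using x by simp
      qed
    qed
    then have "{l+m<..<r-m} \<in> null_sets lebesgue" by (subst AE_iff_null_sets) auto
    then show False using m by (auto simp: null_sets_def)
  qed
  define c where "c = (1 / J) *\<^sub>R integral\<^sup>L ?M (\<lambda>x. \<rho> x *\<^sub>R f x)"
  have "AE x in ?M. f x - c = 0"
  proof (rule fundamental_lemma_variations)
    show "loc_integrable {l<..<r} (\<lambda>x. f x - c)" by (intro loc_integrable_diff f loc_integrable_const)
    fix \<eta> assume \<eta>: "test_fun {l<..<r} \<eta>"
    define k where "k = - (integral\<^sup>L ?M \<eta> / J)"
    have "integral\<^sup>L ?M (\<lambda>x. \<eta> x + k * \<rho> x) = 0"
      using int1[OF \<eta>] int1[OF \<rho>] \<open>J \<noteq> 0\<close> by (simp add: k_def J_def)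
    then obtain \<psi> where \<psi>: "test_fun {l<..<r} \<psi>" "deriv \<psi> = (\<lambda>x. \<eta> x + k * \<rho> x)"
      using test_fun_antiderivative[OF test_fun_linear[OF \<eta> \<rho>]] by metis
    have "0 = integral\<^sup>L ?M (\<lambda>x. (\<eta> x + k * \<rho> x) *\<^sub>R f x)" using zero[OF \<psi>(1)] \<psi>(2) by simp
    also have "\<dots> = integral\<^sup>L ?M (\<lambda>x. \<eta> x *\<^sub>R f x + k *\<^sub>R (\<rho> x *\<^sub>R f x))"
      by (simp add: algebra_simps)
    also have "\<dots> = integral\<^sup>L ?M (\<lambda>x. \<eta> x *\<^sub>R f x) + k *\<^sub>R integral\<^sup>L ?M (\<lambda>x. \<rho> x *\<^sub>R f x)"
      using integrable_test_fun_scaleR[OF \<eta> f] integrable_test_fun_scaleR[OF \<rho> f] by (simp del: scaleR_scaleR)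
    also have "\<dots> = integral\<^sup>L ?M (\<lambda>x. \<eta> x *\<^sub>R f x) - integral\<^sup>L ?M (\<lambda>x. \<eta> x *\<^sub>R c)"
      using int1[OF \<eta>] by (simp add: k_def c_def)
    also have "\<dots> = integral\<^sup>L ?M (\<lambda>x. \<eta> x *\<^sub>R (f x - c))"
      using integrable_test_fun_scaleR[OF \<eta> f] int1[OF \<eta>] by (simp add: scaleR_diff_right)
    finally show "integral\<^sup>L ?M (\<lambda>x. \<eta> x *\<^sub>R (f x - c)) = 0" by simp
  qed auto
  then show ?thesis using that by simp
qed

section \<open>The Hilbert space of square-integrable functions on the line\<close>

lemma norm_add_square_le: "(norm (x + y))\<^sup>2 \<le> 2 * (norm x)\<^sup>2 + 2 * (norm (y :: 'a :: real_normed_vector))\<^sup>2"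
proof -
  have "(norm (x + y))\<^sup>2 \<le> (norm x + norm y)\<^sup>2" by (intro power_mono norm_triangle_ineq norm_ge_zero)
  also have "\<dots> \<le> 2 * (norm x)\<^sup>2 + 2 * (norm y)\<^sup>2"
    using zero_le_power2[of "norm x - norm y"] by (simp add: power2_eq_square algebra_simps)
  finally show ?thesis .
qed

lemma abs_inner_le_squares: "\<bar>inner x y\<bar> \<le> (norm x)\<^sup>2 + (norm y)\<^sup>2"
proof -
  have "\<bar>inner x y\<bar> \<le> norm x * norm y" by (rule Cauchy_Schwarz_ineq2)
  also have "\<dots> \<le> (norm x)\<^sup>2 + (norm y)\<^sup>2"
  proof -
    have "0 \<le> norm x * norm y" by simp
    moreover have "2 * (norm x * norm y) \<le> (norm x)\<^sup>2 + (norm y)\<^sup>2"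
      using zero_le_power2[of "norm x - norm y"] by (simp add: power2_eq_square algebra_simps)
    ultimately show ?thesis by linarith
  qed
  finally show ?thesis .
qed

definition sq_int :: "(real \<Rightarrow> complex) \<Rightarrow> bool" where
  "sq_int f \<longleftrightarrow> f \<in> borel_measurable lebesgue \<and> integrable lebesgue (\<lambda>x. (cmod (f x))\<^sup>2)"

lemma sq_int_measurable [measurable_dest]: "sq_int f \<Longrightarrow> f \<in> borel_measurable lebesgue"
  and sq_int_integrable: "sq_int f \<Longrightarrow> integrable lebesgue (\<lambda>x. (cmod (f x))\<^sup>2)"
  by (auto simp: sq_int_def)

lemma sq_int_add: assumes "sq_int f" "sq_int g" shows "sq_int (\<lambda>x. f x + g x)"
  unfolding sq_int_def
proof
  show m: "(\<lambda>x. f x + g x) \<in> borel_measurable lebesgue"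
    using assms by (auto dest!: sq_int_measurable)
  have "integrable lebesgue (\<lambda>x. 2 * (cmod (f x))\<^sup>2 + 2 * (cmod (g x))\<^sup>2)"
    using assms by (auto dest!: sq_int_integrable)
  then show "integrable lebesgue (\<lambda>x. (cmod (f x + g x))\<^sup>2)"
    by (rule Bochner_Integration.integrable_bound) (use m norm_add_square_le in \<open>auto intro!: AE_I2\<close>)
qed

lemma sq_int_scaleR: "sq_int f \<Longrightarrow> sq_int (\<lambda>x. c *\<^sub>R f x)"
  by (auto simp: sq_int_def power_mult_distrib)

lemma sq_int_zero: "sq_int (\<lambda>_. 0)" by (simp add: sq_int_def)

lemma integrable_inner_sq_int:
  assumes "sq_int f" "sq_int g" shows "integrable lebesgue (\<lambda>x. f x \<bullet> g x)"
proof -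
  have "integrable lebesgue (\<lambda>x. (cmod (f x))\<^sup>2 + (cmod (g x))\<^sup>2)"
    using assms by (auto dest!: sq_int_integrable)
  then show ?thesis
    by (rule Bochner_Integration.integrable_bound)
       (use assms abs_inner_le_squares in \<open>auto dest!: sq_int_measurable intro!: AE_I2\<close>)
qed

text \<open>Only a partial equivalence: functions that are not square-integrable are related to
  nothing, so the quotient contains exactly the classes of L2.\<close>

definition l2_rel :: "(real \<Rightarrow> complex) \<Rightarrow> (real \<Rightarrow> complex) \<Rightarrow> bool" where
  "l2_rel f g \<longleftrightarrow> sq_int f \<and> sq_int g \<and> (AE x in lebesgue. f x = g x)"

quotient_type l2 = "real \<Rightarrow> complex" / partial: l2_rel
proof (rule part_equivpI)
  show "\<exists>f. l2_rel f f" by (rule exI[of _ "\<lambda>_. 0"]) (simp add: l2_rel_def sq_int_zero)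
  show "symp l2_rel" by (auto simp: symp_def l2_rel_def elim!: eventually_mono)
  show "transp l2_rel" by (auto simp: transp_def l2_rel_def elim!: eventually_elim2)
qed

instantiation l2 :: real_vector
begin

lift_definition zero_l2 :: l2 is "\<lambda>_. 0" by (simp add: l2_rel_def sq_int_zero)

lift_definition plus_l2 :: "l2 \<Rightarrow> l2 \<Rightarrow> l2" is "\<lambda>f g x. f x + g x"
  by (auto simp: l2_rel_def intro: sq_int_add elim!: eventually_elim2)

lift_definition scaleR_l2 :: "real \<Rightarrow> l2 \<Rightarrow> l2" is "\<lambda>c f x. c *\<^sub>R f x"
  by (auto simp: l2_rel_def intro: sq_int_scaleR elim!: eventually_mono)

definition uminus_l2 :: "l2 \<Rightarrow> l2" where "uminus_l2 f = (-1) *\<^sub>R f"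
definition minus_l2 :: "l2 \<Rightarrow> l2 \<Rightarrow> l2" where "minus_l2 f g = f + (-1) *\<^sub>R g"

instance
proof
  fix f g h :: l2 and c d :: real
  show "f + g + h = f + (g + h)"
    by transfer (auto simp: l2_rel_def algebra_simps intro!: sq_int_add)
  show "f + g = g + f"
    by transfer (auto simp: l2_rel_def algebra_simps intro!: sq_int_add)
  show "0 + f = f" by transfer (auto simp: l2_rel_def)
  show "- f + f = 0" unfolding uminus_l2_def
    by transfer (auto simp: l2_rel_def sq_int_zero intro!: sq_int_add sq_int_scaleR)
  show "f - g = f + - g" by (simp add: uminus_l2_def minus_l2_def)
  show "c *\<^sub>R (f + g) = c *\<^sub>R f + c *\<^sub>R g"
    by transfer (auto simp: l2_rel_def algebra_simps intro!: sq_int_add sq_int_scaleR)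
  show "(c + d) *\<^sub>R f = c *\<^sub>R f + d *\<^sub>R f"
    by transfer (auto simp: l2_rel_def algebra_simps intro!: sq_int_add sq_int_scaleR)
  show "c *\<^sub>R d *\<^sub>R f = (c * d) *\<^sub>R f"
    by transfer (auto simp: l2_rel_def algebra_simps intro!: sq_int_scaleR)
  show "1 *\<^sub>R f = f" by transfer (auto simp: l2_rel_def)
qed

end

instantiation l2 :: real_inner
begin

text \<open>The pointwise product is Re(z cnj w), so \<open>l2\<close> is a real Hilbert space. The
  real part is what energy identities see, and multiplication by \<open>\<i>\<close> becomes
  skew.\<close>

lift_definition inner_l2 :: "l2 \<Rightarrow> l2 \<Rightarrow> real" is "\<lambda>f g. \<integral>x. f x \<bullet> g x \<partial>lebesgue"
  by (rule integral_cong_AE) (auto simp: l2_rel_def dest!: sq_int_measurable elim!: eventually_elim2)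

definition norm_l2 :: "l2 \<Rightarrow> real" where "norm_l2 f = sqrt (f \<bullet> f)"
definition dist_l2 :: "l2 \<Rightarrow> l2 \<Rightarrow> real" where "dist_l2 f g = norm (f - g)"
definition sgn_l2 :: "l2 \<Rightarrow> l2" where "sgn_l2 f = f /\<^sub>R norm f"
definition uniformity_l2 :: "(l2 \<times> l2) filter" where
  "uniformity_l2 = (INF e\<in>{0<..}. principal {(x, y). dist x y < e})"
definition open_l2 :: "l2 set \<Rightarrow> bool" where
  "open_l2 U \<longleftrightarrow> (\<forall>x\<in>U. \<forall>\<^sub>F (x', y) in uniformity. x' = x \<longrightarrow> y \<in> U)"

instance
proof
  fix f g h :: l2 and c d :: real and U :: "l2 set"
  show "dist f g = norm (f - g)" by (simp add: dist_l2_def)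
  show "sgn f = f /\<^sub>R norm f" by (simp add: sgn_l2_def)
  show "uniformity = (INF e\<in>{0<..}. principal {(x, y :: l2). dist x y < e})"
    by (simp add: uniformity_l2_def)
  show "open U \<longleftrightarrow> (\<forall>x\<in>U. \<forall>\<^sub>F (x', y) in uniformity. x' = x \<longrightarrow> y \<in> U)"
    by (simp add: open_l2_def)
  show "f \<bullet> g = g \<bullet> f" by transfer (simp add: inner_commute)
  show "(f + g) \<bullet> h = f \<bullet> h + g \<bullet> h"
    by transfer (auto simp: l2_rel_def inner_add_left integrable_inner_sq_int)
  show "(c *\<^sub>R f) \<bullet> g = c * (f \<bullet> g)" by transfer simp
  show "0 \<le> f \<bullet> f" by transfer simp
  show "f \<bullet> f = 0 \<longleftrightarrow> f = 0"
  proof transfer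
    fix f assume "l2_rel f f"
    then have f: "sq_int f" by (simp add: l2_rel_def)
    show "(\<integral>x. f x \<bullet> f x \<partial>lebesgue) = 0 \<longleftrightarrow> l2_rel f (\<lambda>_. 0)"
      using integral_nonneg_eq_0_iff_AE[OF integrable_inner_sq_int[OF f f]] f
      by (simp add: l2_rel_def sq_int_zero)
  qed
  show "norm f = sqrt (f \<bullet> f)" by (simp add: norm_l2_def)
qed

end

lemma abs_l2_add: "sq_int f \<Longrightarrow> sq_int g \<Longrightarrow> abs_l2 (\<lambda>x. f x + g x) = abs_l2 f + abs_l2 g"
  by (simp add: plus_l2.abs_eq l2_rel_def)

lemma abs_l2_scaleR: "sq_int f \<Longrightarrow> abs_l2 (\<lambda>x. c *\<^sub>R f x) = c *\<^sub>R abs_l2 f"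
  by (simp add: scaleR_l2.abs_eq l2_rel_def)

lemma sq_int_diff: "sq_int f \<Longrightarrow> sq_int g \<Longrightarrow> sq_int (\<lambda>x. f x - g x)"
  using sq_int_add[OF _ sq_int_scaleR[of g "-1"]] by simp

lemma abs_l2_diff: "sq_int f \<Longrightarrow> sq_int g \<Longrightarrow> abs_l2 (\<lambda>x. f x - g x) = abs_l2 f - abs_l2 g"
  using abs_l2_add[OF _ sq_int_scaleR[of g "-1"]] abs_l2_scaleR[of g "-1"] by simp

lemma inner_abs_l2: "sq_int f \<Longrightarrow> sq_int g \<Longrightarrow> abs_l2 f \<bullet> abs_l2 g = (\<integral>x. f x \<bullet> g x \<partial>lebesgue)"
  by (simp add: inner_l2.abs_eq l2_rel_def)

lemma norm_abs_l2: "sq_int f \<Longrightarrow> (norm (abs_l2 f))\<^sup>2 = (\<integral>x. (cmod (f x))\<^sup>2 \<partial>lebesgue)"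
  by (simp add: power2_norm_eq_inner inner_abs_l2)

lemma nn_integral_norm_abs_l2:
  "sq_int f \<Longrightarrow> (\<integral>\<^sup>+x. ennreal ((cmod (f x))\<^sup>2) \<partial>lebesgue) = ennreal ((norm (abs_l2 f))\<^sup>2)"
  by (simp add: norm_abs_l2 nn_integral_eq_integral sq_int_integrable)

lemma obtain_rep_l2: obtains f where "sq_int f" "abs_l2 f = F"
  by (metis Quotient_l2 Quotient_rel_rep Quotient_abs_rep l2_rel_def)

text \<open>The squared increments have integral at most 16^(-k); weighted by 4^k they still sum to
  a finite integral. Hence almost everywhere the increments are at most a constant times 2^(-k), and
  the series telescopes.\<close>

lemma rapid_cauchy_l2_pointwise:
  assumes f: "\<And>k. sq_int (f k)"
    and rapid: "\<And>k. norm (abs_l2 (f (Suc k)) - abs_l2 (f k)) \<le> (1/4) ^ k"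
  shows "AE x in lebesgue. convergent (\<lambda>k. f k x)"
proof -
  define a where "a = (\<lambda>k x. cmod (f (Suc k) x - f k x))"
  have m [measurable]: "a k \<in> borel_measurable lebesgue" for k
    using f unfolding a_def by (auto dest!: sq_int_measurable)
  have "(\<integral>\<^sup>+x. (\<Sum>k. ennreal (4 ^ k * (a k x)\<^sup>2)) \<partial>lebesgue)
      = (\<Sum>k. \<integral>\<^sup>+x. ennreal (4 ^ k * (a k x)\<^sup>2) \<partial>lebesgue)"
    by (rule nn_integral_suminf) measurable
  also have "\<dots> \<le> (\<Sum>k. ennreal ((1/4) ^ k))"
  proof (rule suminf_le)
    fix k
    have sq: "sq_int (\<lambda>x. f (Suc k) x - f k x)" by (intro sq_int_diff f)
    have "(\<integral>\<^sup>+x. ennreal (4 ^ k * (a k x)\<^sup>2) \<partial>lebesgue) = ennreal (4 ^ k) * (\<integral>\<^sup>+x. ennreal ((a k x)\<^sup>2) \<partial>lebesgue)"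
      by (simp add: ennreal_mult' nn_integral_cmult)
    also have "\<dots> = ennreal (4 ^ k) * ennreal ((norm (abs_l2 (f (Suc k)) - abs_l2 (f k)))\<^sup>2)"
      unfolding a_def by (subst nn_integral_norm_abs_l2[OF sq]) (simp add: abs_l2_diff f)
    also have "\<dots> \<le> ennreal (4 ^ k) * ennreal (((1/4) ^ k)\<^sup>2)"
      by (intro mult_left_mono ennreal_leI power_mono rapid) auto
    also have "\<dots> = ennreal ((1/4) ^ k)"
      by (subst ennreal_mult[symmetric]) (auto simp: power2_eq_square power_divide)
    finally show "(\<integral>\<^sup>+x. ennreal (4 ^ k * (a k x)\<^sup>2) \<partial>lebesgue) \<le> ennreal ((1/4) ^ k)" .
  qed auto
  also have "\<dots> < \<infinity>"
    by (subst suminf_ennreal2) (auto intro: summable_geometric)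
  finally have "AE x in lebesgue. (\<Sum>k. ennreal (4 ^ k * (a k x)\<^sup>2)) \<noteq> \<infinity>"
    by (intro nn_integral_PInf_AE) auto
  then show ?thesis
  proof (rule eventually_mono)
    fix x assume fin: "(\<Sum>k. ennreal (4 ^ k * (a k x)\<^sup>2)) \<noteq> \<infinity>"
    define B where "B = enn2real (\<Sum>k. ennreal (4 ^ k * (a k x)\<^sup>2))"
    have "a k x \<le> sqrt B * (1/2) ^ k" for k
    proof -
      have "ennreal (4 ^ k * (a k x)\<^sup>2) \<le> (\<Sum>k. ennreal (4 ^ k * (a k x)\<^sup>2))"
      proof -
        have "sum (\<lambda>k. ennreal (4 ^ k * (a k x)\<^sup>2)) {k} \<le> (\<Sum>k. ennreal (4 ^ k * (a k x)\<^sup>2))"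
          by (rule sum_le_suminf[OF summableI]) auto
        then show ?thesis by (simp only: sum.insert[OF finite.emptyI] sum.empty empty_iff not_False_eq_True add_0_right)
      qed
      also have "\<dots> = ennreal B" using fin by (simp add: B_def less_top)
      finally have "4 ^ k * (a k x)\<^sup>2 \<le> B" by (simp add: B_def ennreal_le_iff)
      then have "sqrt (4 ^ k * (a k x)\<^sup>2) \<le> sqrt B" by simp
      then have "2 ^ k * a k x \<le> sqrt B"
        by (simp add: real_sqrt_mult a_def real_sqrt_power)
      then show ?thesis by (simp add: field_simps power_divide)
    qed
    then have "summable (\<lambda>k. f (Suc k) x - f k x)"
      by (intro summable_norm_cancel[of "\<lambda>k. f (Suc k) x - f k x"]
          summable_comparison_test'[OF summable_mult[OF summable_geometric[of "1/2::real"], of "sqrt B"], of 0])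
         (auto simp: a_def)
    then have "convergent (\<lambda>n. (\<Sum>k<n. f (Suc k) x - f k x))"
      by (simp add: summable_iff_convergent)
    then have "convergent (\<lambda>n. (f n x - f 0 x) + f 0 x)"
      by (intro convergent_add convergent_const) (simp add: sum_lessThan_telescope[of "\<lambda>k. f k x"])
    then show "convergent (\<lambda>k. f k x)" by simp
  qed
qed

text \<open>Riesz-Fischer: a rapid subsequence converges almost everywhere, Fatou's lemma identifies
  the pointwise limit as its limit in norm, and a Cauchy sequence follows its subsequence.\<close>

instance l2 :: complete_space
proof
  fix X :: "nat \<Rightarrow> l2" assume X: "Cauchy X"
  have "\<exists>N. \<forall>m\<ge>N. \<forall>n\<ge>N. norm (X m - X n) < (1/4) ^ k" for k
    using X by (auto simp: Cauchy_def dist_norm)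
  then obtain N where N: "\<And>k m n. m \<ge> N k \<Longrightarrow> n \<ge> N k \<Longrightarrow> norm (X m - X n) < (1/4) ^ k"
    by metis
  \<comment> \<open>The maximum makes the indices strictly increasing and at the same time beyond
    every threshold \<open>N k\<close>.\<close>
  define r where "r = rec_nat (N 0) (\<lambda>k i. max (Suc i) (N (Suc k)))"
  have r: "strict_mono r" by (rule strict_monoI_Suc) (simp add: r_def)
  have rN: "r k \<ge> N k" for k by (cases k) (simp_all add: r_def)
  have "\<exists>f. sq_int f \<and> abs_l2 f = X (r k)" for k by (metis obtain_rep_l2)
  then obtain f where f: "\<And>k. sq_int (f k)" "\<And>k. abs_l2 (f k) = X (r k)" by metis
  have "r (Suc k) \<ge> N k" for k
    using rN[of k] strict_monoD[OF r, of k "Suc k"] by linarith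
  then have conv: "AE x in lebesgue. convergent (\<lambda>k. f k x)"
    using N rN f by (intro rapid_cauchy_l2_pointwise) (auto intro!: less_imp_le)
  define F where "F = (\<lambda>x. lim (\<lambda>k. f k x))"
  have lim: "AE x in lebesgue. (\<lambda>k. f k x) \<longlonglongrightarrow> F x"
    using conv by (rule eventually_mono) (simp add: F_def convergent_LIMSEQ_iff)
  have fm [measurable]: "f k \<in> borel_measurable lebesgue" for k using f(1) by (simp add: sq_int_def)
  have Fm [measurable]: "F \<in> borel_measurable lebesgue" unfolding F_def by measurable
  \<comment> \<open>Fatou's lemma for m to infinity, with k fixed.\<close>
  have bound: "(\<integral>\<^sup>+x. ennreal ((cmod (F x - f k x))\<^sup>2) \<partial>lebesgue) \<le> ennreal (((1/4) ^ j)\<^sup>2)" if "k \<ge> j" for j k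
  proof -
    have "(\<integral>\<^sup>+x. ennreal ((cmod (F x - f k x))\<^sup>2) \<partial>lebesgue)
      = (\<integral>\<^sup>+x. liminf (\<lambda>m. ennreal ((cmod (f m x - f k x))\<^sup>2)) \<partial>lebesgue)"
    proof (rule nn_integral_cong_AE, use lim in \<open>rule eventually_mono\<close>)
      fix x assume "(\<lambda>k. f k x) \<longlonglongrightarrow> F x"
      then have "(\<lambda>m. ennreal ((cmod (f m x - f k x))\<^sup>2)) \<longlonglongrightarrow> ennreal ((cmod (F x - f k x))\<^sup>2)"
        by (intro tendsto_ennrealI tendsto_intros)
      then show "ennreal ((cmod (F x - f k x))\<^sup>2) = liminf (\<lambda>m. ennreal ((cmod (f m x - f k x))\<^sup>2))"
        by (intro lim_imp_Liminf[symmetric]) auto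
    qed
    also have "\<dots> \<le> liminf (\<lambda>m. \<integral>\<^sup>+x. ennreal ((cmod (f m x - f k x))\<^sup>2) \<partial>lebesgue)"
      by (rule nn_integral_liminf) measurable
    also have "\<dots> \<le> ennreal (((1/4) ^ j)\<^sup>2)"
    proof (rule Liminf_le)
      show "\<forall>\<^sub>F m in sequentially. (\<integral>\<^sup>+x. ennreal ((cmod (f m x - f k x))\<^sup>2) \<partial>lebesgue) \<le> ennreal (((1/4) ^ j)\<^sup>2)"
        unfolding eventually_sequentially
      proof (intro exI allI impI)
        fix m assume "m \<ge> j"
        have "norm (X (r m) - X (r k)) \<le> (1/4) ^ j"
          using N[of j "r m" "r k"] rN[of j] strict_mono_leD[OF r \<open>m \<ge> j\<close>] strict_mono_leD[OF r that] by linarith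
        then show "(\<integral>\<^sup>+x. ennreal ((cmod (f m x - f k x))\<^sup>2) \<partial>lebesgue) \<le> ennreal (((1/4) ^ j)\<^sup>2)"
          by (subst nn_integral_norm_abs_l2)
             (auto intro!: sq_int_diff f ennreal_leI power_mono simp: abs_l2_diff f)
      qed
    qed simp
    finally show ?thesis .
  qed
  have sqd: "sq_int (\<lambda>x. F x - f k x)" for k
    unfolding sq_int_def
  proof
    show "integrable lebesgue (\<lambda>x. (cmod (F x - f k x))\<^sup>2)"
      by (rule integrableI_bounded) (use le_less_trans[OF bound[of 0 k]] in auto)
  qed measurable
  have F: "sq_int F" using sq_int_add[OF sqd[of 0] f(1)[of 0]] by simp
  have nb: "norm (abs_l2 F - X (r k)) \<le> (1/4) ^ k" for k
  proof -
    have "ennreal ((norm (abs_l2 F - X (r k)))\<^sup>2) \<le> ennreal (((1/4) ^ k)\<^sup>2)"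
      using bound[of k k] nn_integral_norm_abs_l2[OF sqd[of k]] by (simp add: abs_l2_diff F f)
    then have "(norm (abs_l2 F - X (r k)))\<^sup>2 \<le> ((1/4) ^ k)\<^sup>2"
      by (simp add: ennreal_le_iff)
    then show ?thesis by (rule power2_le_imp_le) simp
  qed
  have "(X \<circ> r) \<longlonglongrightarrow> abs_l2 F"
  proof (rule Lim_null_comparison[THEN LIM_zero_cancel])
    show "\<forall>\<^sub>F k in sequentially. norm ((X \<circ> r) k - abs_l2 F) \<le> (1/4) ^ k"
      using nb by (auto simp: norm_minus_commute)
    show "(\<lambda>k. (1/4 :: real) ^ k) \<longlonglongrightarrow> 0" by (rule LIMSEQ_power_zero) simp
  qed
  then show "convergent X"
    using Cauchy_converges_subseq[OF X r] by (auto simp: convergent_def)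
qed

text \<open>Minimising the second component over the slices of \<open>\<Gamma>\<close> near \<open>f\<close> replaces weak compactness:
  near-minimisers form a Cauchy sequence by the parallelogram law.\<close>

lemma closed_graph_bounded_limit:
  fixes \<Gamma> :: "('a :: real_inner \<times> 'b :: {real_inner, complete_space}) set"
  assumes \<Gamma>: "closed \<Gamma>" "subspace \<Gamma>"
    and approx: "\<And>e. e > 0 \<Longrightarrow> \<exists>f' g. (f', g) \<in> \<Gamma> \<and> norm (f' - f) < e \<and> norm g \<le> M"
  obtains g where "(f, g) \<in> \<Gamma>" "norm g \<le> M"
proof -
  define \<epsilon> where "\<epsilon> = (\<lambda>n. inverse (real (Suc n)))"
  have \<epsilon>: "\<epsilon> n > 0" "m \<le> n \<Longrightarrow> \<epsilon> n \<le> \<epsilon> m" for m n by (auto simp: \<epsilon>_def)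
  have \<epsilon>0: "\<epsilon> \<longlonglongrightarrow> 0" unfolding \<epsilon>_def by (rule LIMSEQ_inverse_real_of_nat)
  define S where "S = (\<lambda>n. {g. \<exists>f'. (f', g) \<in> \<Gamma> \<and> norm (f' - f) < \<epsilon> n})"
  define d where "d = (\<lambda>n. Inf (norm ` S n))"
  have bdd: "bdd_below (norm ` A)" for A :: "'b set" by (rule bdd_belowI[of _ 0]) auto
  have ne: "\<exists>g\<in>S n. norm g \<le> M" for n using approx[OF \<epsilon>(1)[of n]] by (auto simp: S_def)
  have d_le: "g \<in> S n \<Longrightarrow> d n \<le> norm g" for g n unfolding d_def by (intro cInf_lower bdd) auto
  have dM: "d n \<le> M" for n using ne[of n] d_le by force
  have S_mono: "S n \<subseteq> S m" if "m \<le> n" for m n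
    using \<epsilon>(2)[OF that] by (fastforce simp: S_def)
  have d0: "d n \<ge> 0" for n unfolding d_def by (rule cInf_greatest) (use ne[of n] in auto)
  have d_mono: "incseq d"
  proof (rule incseq_SucI)
    show "d n \<le> d (Suc n)" for n
      unfolding d_def by (rule cInf_superset_mono) (use ne bdd S_mono[of n "Suc n"] in auto)
  qed
  obtain D where D: "d \<longlonglongrightarrow> D" "\<And>n. d n \<le> D"
    using incseq_convergent[OF d_mono, of M] dM by auto
  have "D \<le> M" using LIMSEQ_le_const2[OF D(1)] dM by blast
  have "\<exists>g\<in>S n. norm g < d n + \<epsilon> n" for n
  proof -
    have "\<exists>y\<in>norm ` S n. y < d n + \<epsilon> n"
      using ne[of n] bdd \<epsilon>(1)[of n] unfolding d_def by (subst cInf_less_iff[symmetric]) auto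
    then show ?thesis by auto
  qed
  then obtain g where g: "\<And>n. g n \<in> S n" "\<And>n. norm (g n) < d n + \<epsilon> n" by metis
  have "\<exists>h. (h, g n) \<in> \<Gamma> \<and> norm (h - f) < \<epsilon> n" for n using g(1)[of n] by (auto simp: S_def)
  then obtain h where h: "\<And>n. (h n, g n) \<in> \<Gamma>" "\<And>n. norm (h n - f) < \<epsilon> n"
    by metis
  \<comment> \<open>The bound from the parallelogram law: the midpoint of two near-minimisers again
    lies in \<open>S n\<close>, so its norm is at least \<open>d n\<close>. As d tends to D and
    \<open>\<epsilon>\<close> to 0, b tends to 2 D^2 + 2 D^2 - 4 D^2 = 0.\<close>
  define b where "b = (\<lambda>n. 2 * (d n + \<epsilon> n)\<^sup>2 + 2 * (D + \<epsilon> n)\<^sup>2 - 4 * (d n)\<^sup>2)"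
  have "b \<longlonglongrightarrow> 2 * (D + 0)\<^sup>2 + 2 * (D + 0)\<^sup>2 - 4 * D\<^sup>2"
    unfolding b_def by (intro tendsto_intros D \<epsilon>0)
  then have b0: "b \<longlonglongrightarrow> 0" by simp
  have gb: "(norm (g n - g m))\<^sup>2 \<le> b n" if "n \<le> m" for n m
  proof -
    define c where "c = (1/2) *\<^sub>R (g n + g m)"
    have "((1/2) *\<^sub>R (h n + h m), c) = (1/2) *\<^sub>R ((h n, g n) + (h m, g m))" by (simp add: c_def)
    then have "((1/2) *\<^sub>R (h n + h m), c) \<in> \<Gamma>" using h \<Gamma>(2) by (simp only: subspace_add subspace_scale)
    moreover have "norm ((1/2) *\<^sub>R (h n + h m) - f) < \<epsilon> n"
    proof -
      have "(1/2) *\<^sub>R (h n + h m) - f = (1/2) *\<^sub>R ((h n - f) + (h m - f))"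
        by (simp add: algebra_simps flip: scaleR_add_left)
      then have "norm ((1/2) *\<^sub>R (h n + h m) - f) \<le> (1/2) * (norm (h n - f) + norm (h m - f))"
        using norm_triangle_ineq[of "h n - f" "h m - f"] by simp
      also have "\<dots> < (1/2) * (\<epsilon> n + \<epsilon> n)"
        using h(2)[of n] order_less_le_trans[OF h(2)[of m] \<epsilon>(2)[OF that]] by (intro mult_strict_left_mono add_strict_mono) auto
      finally show ?thesis by simp
    qed
    ultimately have "d n \<le> norm c" by (intro d_le) (auto simp: S_def)
    then have 1: "4 * (d n)\<^sup>2 \<le> (norm (g n + g m))\<^sup>2"
      using power_mono[OF _ d0, of n "norm c" 2] by (simp add: c_def power_divide)
    have 2: "(norm (g n - g m))\<^sup>2 = 2 * (norm (g n))\<^sup>2 + 2 * (norm (g m))\<^sup>2 - (norm (g n + g m))\<^sup>2"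
      by (simp add: power2_norm_eq_inner algebra_simps inner_commute)
    have 3: "(norm (g n))\<^sup>2 \<le> (d n + \<epsilon> n)\<^sup>2" using g(2)[of n] by (intro power_mono) auto
    have "norm (g m) \<le> D + \<epsilon> n" using g(2)[of m] D(2)[of m] \<epsilon>(2)[OF that] by linarith
    then have 4: "(norm (g m))\<^sup>2 \<le> (D + \<epsilon> n)\<^sup>2" by (intro power_mono) auto
    from 1 3 4 show ?thesis unfolding b_def 2 by linarith
  qed
  have "Cauchy g"
  proof (rule CauchyI)
    fix e :: real assume "e > 0"
    then have "\<forall>\<^sub>F n in sequentially. b n < e\<^sup>2" by (intro order_tendstoD(2)[OF b0]) simp
    then obtain N where N: "\<And>n. n \<ge> N \<Longrightarrow> b n < e\<^sup>2" by (auto simp: eventually_sequentially)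
    have "norm (g m - g n) < e" if "N \<le> m" "m \<le> n" for m n
      using gb[OF that(2)] N[OF that(1)] \<open>e > 0\<close> by (intro power2_less_imp_less[of _ e]) auto
    then show "\<exists>N. \<forall>m\<ge>N. \<forall>n\<ge>N. norm (g m - g n) < e"
      by (metis linear norm_minus_commute)
  qed
  then obtain G where G: "g \<longlonglongrightarrow> G" using Cauchy_convergent_iff convergent_def by blast
  have "h \<longlonglongrightarrow> f"
    by (rule Lim_null_comparison[OF _ \<epsilon>0, THEN LIM_zero_cancel]) (use h(2) in \<open>auto intro!: always_eventually less_imp_le\<close>)
  then have "(\<lambda>n. (h n, g n)) \<longlonglongrightarrow> (f, G)" using G by (rule tendsto_Pair)
  then have "(f, G) \<in> \<Gamma>" by (rule closed_sequentially[OF \<Gamma>(1) h(1)])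
  moreover have "norm G \<le> M"
  proof -
    have "norm G \<le> D"
      using g(2) by (intro LIMSEQ_le[OF tendsto_norm[OF G] tendsto_add[OF D(1) \<epsilon>0, simplified]]) (auto intro: less_imp_le)
    then show ?thesis using \<open>D \<le> M\<close> by simp
  qed
  ultimately show ?thesis using that by blast
qed

section \<open>Absolutely continuous functions on a symmetric interval\<close>

locale symm_interval =
  fixes a :: real
  assumes a_pos: "0 < a"
begin

abbreviation "\<Omega> \<equiv> {-a<..<a}"
abbreviation "M \<equiv> lebesgue_on \<Omega>"

sublocale finite_measure M
  by (rule finite_measure_lebesgue_on) simp

lemma AE_M_iff: "(AE x in M. P x) \<longleftrightarrow> (AE x in lebesgue. x \<in> \<Omega> \<longrightarrow> P x)"
  by (rule AE_restrict_space_iff) simp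

lemma AE_M_I: "(\<And>x. x \<in> \<Omega> \<Longrightarrow> P x) \<Longrightarrow> AE x in M. P x"
  by (intro AE_I2) simp

lemma AE_M_mono: "AE x in M. P x \<Longrightarrow> (\<And>x. x \<in> \<Omega> \<Longrightarrow> P x \<Longrightarrow> Q x) \<Longrightarrow> AE x in M. Q x"
  by (rule lebesgue_on_mono)

lemma AE_M_nonzero: "AE x in M. x \<noteq> 0"
  unfolding AE_M_iff
  by (rule eventually_mono[OF AE_not_in[of "{0}"]]) (auto intro: null_sets_completionI)

definition cut :: "(real \<Rightarrow> complex) \<Rightarrow> real \<Rightarrow> complex" where
  "cut f x = (if x \<in> \<Omega> then f x else 0)"

text \<open>A type cannot depend on a, so L2 of the interval is realised isometrically, by extension
  with zero, inside the single Hilbert space \<open>l2\<close> of the line.\<close>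

definition emb :: "(real \<Rightarrow> complex) \<Rightarrow> l2" where "emb f = abs_l2 (cut f)"

lemma L2_iff_cut: "f \<in> L2 \<Omega> \<longleftrightarrow> sq_int (cut f)"
proof -
  have eq: "(\<lambda>x. (cmod (cut f x))\<^sup>2) = (\<lambda>x. if x \<in> \<Omega> then (cmod (f x))\<^sup>2 else 0)"
    by (auto simp: cut_def)
  have "cut f \<in> borel_measurable lebesgue \<longleftrightarrow> f \<in> borel_measurable M"
    unfolding cut_def[abs_def] by (rule borel_measurable_if) simp
  moreover have "integrable lebesgue (\<lambda>x. (cmod (cut f x))\<^sup>2) \<longleftrightarrow> integrable M (\<lambda>x. (cmod (f x))\<^sup>2)"
    unfolding eq by (rule Lebesgue_Measure.integrable_restrict_UNIV) simp
  ultimately show ?thesis unfolding sq_int_def L2_def by simp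
qed

lemma L2_measurable: "f \<in> L2 \<Omega> \<Longrightarrow> f \<in> borel_measurable M"
  and L2_sq_integrable: "f \<in> L2 \<Omega> \<Longrightarrow> integrable M (\<lambda>x. (cmod (f x))\<^sup>2)"
  by (auto simp: L2_def)

lemma cut_add: "cut (\<lambda>x. f x + g x) = (\<lambda>x. cut f x + cut g x)"
  and cut_scaleR: "cut (\<lambda>x. c *\<^sub>R f x) = (\<lambda>x. c *\<^sub>R cut f x)"
  and cut_diff: "cut (\<lambda>x. f x - g x) = (\<lambda>x. cut f x - cut g x)"
  by (auto simp: cut_def)

lemma L2_add: "f \<in> L2 \<Omega> \<Longrightarrow> g \<in> L2 \<Omega> \<Longrightarrow> (\<lambda>x. f x + g x) \<in> L2 \<Omega>"
  and L2_diff: "f \<in> L2 \<Omega> \<Longrightarrow> g \<in> L2 \<Omega> \<Longrightarrow> (\<lambda>x. f x - g x) \<in> L2 \<Omega>"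
  and L2_scaleR: "f \<in> L2 \<Omega> \<Longrightarrow> (\<lambda>x. c *\<^sub>R f x) \<in> L2 \<Omega>"
  by (simp_all add: L2_iff_cut cut_add cut_diff cut_scaleR sq_int_add sq_int_diff sq_int_scaleR)

lemma emb_add: "f \<in> L2 \<Omega> \<Longrightarrow> g \<in> L2 \<Omega> \<Longrightarrow> emb (\<lambda>x. f x + g x) = emb f + emb g"
  and emb_diff: "f \<in> L2 \<Omega> \<Longrightarrow> g \<in> L2 \<Omega> \<Longrightarrow> emb (\<lambda>x. f x - g x) = emb f - emb g"
  and emb_scaleR: "f \<in> L2 \<Omega> \<Longrightarrow> emb (\<lambda>x. c *\<^sub>R f x) = c *\<^sub>R emb f"
  by (simp_all add: emb_def L2_iff_cut cut_add cut_diff cut_scaleR abs_l2_add abs_l2_diff abs_l2_scaleR)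

lemma L2_bound:
  assumes "f \<in> L2 \<Omega>" "g \<in> borel_measurable M" "AE x in M. cmod (g x) \<le> C * cmod (f x)"
  shows "g \<in> L2 \<Omega>"
proof -
  have "integrable M (\<lambda>x. C\<^sup>2 * (cmod (f x))\<^sup>2)" using L2_sq_integrable[OF assms(1)] by simp
  then have "integrable M (\<lambda>x. (cmod (g x))\<^sup>2)"
  proof (rule Bochner_Integration.integrable_bound)
    show "AE x in M. norm ((cmod (g x))\<^sup>2) \<le> norm (C\<^sup>2 * (cmod (f x))\<^sup>2)"
      using assms(3) by (rule eventually_mono) (auto simp flip: power_mult_distrib intro!: power_mono)
  qed (use assms(2) in auto)
  then show ?thesis using assms(2) by (simp add: L2_def)
qed

lemma L2_cmult: "f \<in> L2 \<Omega> \<Longrightarrow> (\<lambda>x. c * f x) \<in> L2 \<Omega>"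
  by (rule L2_bound[of f _ "cmod c"]) (auto simp: norm_mult dest: L2_measurable)

lemma L2_cnj: "f \<in> L2 \<Omega> \<Longrightarrow> (\<lambda>x. cnj (f x)) \<in> L2 \<Omega>"
  by (rule L2_bound[of f _ 1]) (auto dest!: L2_measurable intro: borel_measurable_continuous_on[of cnj] continuous_intros)

lemma L2_zero: "(\<lambda>_. 0) \<in> L2 \<Omega>" by (simp add: L2_def)

lemma AE_cut: "(AE x in lebesgue. cut f x = cut g x) \<longleftrightarrow> (AE x in M. f x = g x)"
proof -
  have "cut f x = cut g x \<longleftrightarrow> (x \<in> \<Omega> \<longrightarrow> f x = g x)" for x by (auto simp: cut_def)
  then show ?thesis by (simp add: AE_M_iff)
qed

lemma L2_cong_AE:
  assumes "f \<in> L2 \<Omega>" "AE x in M. f x = g x" shows "g \<in> L2 \<Omega>"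
proof (rule L2_bound[OF assms(1), of _ 1])
  have "cut g \<in> borel_measurable lebesgue"
  proof (rule borel_measurable_AE)
    show "cut f \<in> borel_measurable lebesgue" using assms(1) by (simp only: L2_iff_cut sq_int_def)
    show "AE x in lebesgue. cut f x = cut g x" using assms(2) by (simp only: AE_cut)
  qed
  then show "g \<in> borel_measurable M"
    unfolding cut_def[abs_def] using borel_measurable_if[of \<Omega> g] by simp
qed (use assms(2) in \<open>auto elim!: eventually_mono\<close>)

lemma emb_eq_iff: "f \<in> L2 \<Omega> \<Longrightarrow> g \<in> L2 \<Omega> \<Longrightarrow> emb f = emb g \<longleftrightarrow> (AE x in M. f x = g x)"
  unfolding emb_def L2_iff_cut AE_cut[symmetric]
  using Quotient_rel[OF Quotient_l2, of "cut f" "cut g"] by (auto simp: l2_rel_def)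

lemma emb_cong_AE: "f \<in> L2 \<Omega> \<Longrightarrow> AE x in M. f x = g x \<Longrightarrow> emb f = emb g"
  using emb_eq_iff L2_cong_AE by blast

lemma inner_emb: "f \<in> L2 \<Omega> \<Longrightarrow> g \<in> L2 \<Omega> \<Longrightarrow> emb f \<bullet> emb g = (\<integral>x. f x \<bullet> g x \<partial>M)"
proof -
  assume "f \<in> L2 \<Omega>" "g \<in> L2 \<Omega>"
  then have "emb f \<bullet> emb g = (\<integral>x. cut f x \<bullet> cut g x \<partial>lebesgue)"
    by (simp add: emb_def inner_abs_l2 L2_iff_cut)
  also have "(\<lambda>x. cut f x \<bullet> cut g x) = (\<lambda>x. if x \<in> \<Omega> then f x \<bullet> g x else 0)" by (auto simp: cut_def)
  also have "integral\<^sup>L lebesgue \<dots> = (\<integral>x. f x \<bullet> g x \<partial>M)" by (rule Lebesgue_Measure.integral_restrict_UNIV) simp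
  finally show ?thesis .
qed

lemma integrable_inner: "f \<in> L2 \<Omega> \<Longrightarrow> g \<in> L2 \<Omega> \<Longrightarrow> integrable M (\<lambda>x. f x \<bullet> g x)"
proof -
  assume "f \<in> L2 \<Omega>" "g \<in> L2 \<Omega>"
  then have "integrable lebesgue (\<lambda>x. cut f x \<bullet> cut g x)" by (simp add: integrable_inner_sq_int L2_iff_cut)
  also have "(\<lambda>x. cut f x \<bullet> cut g x) = (\<lambda>x. if x \<in> \<Omega> then f x \<bullet> g x else 0)" by (auto simp: cut_def)
  finally show ?thesis using Lebesgue_Measure.integrable_restrict_UNIV[of \<Omega> "\<lambda>x. f x \<bullet> g x"] by simp
qed

lemma norm_emb_sq: "f \<in> L2 \<Omega> \<Longrightarrow> (norm (emb f))\<^sup>2 = (\<integral>x. (cmod (f x))\<^sup>2 \<partial>M)"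
  by (simp add: power2_norm_eq_inner inner_emb)

lemma norm_emb: "f \<in> L2 \<Omega> \<Longrightarrow> norm (emb f) = L2_norm \<Omega> f"
  unfolding L2_norm_def norm_emb_sq[symmetric] by simp

lemma norm_emb_mono:
  assumes "f \<in> L2 \<Omega>" "g \<in> L2 \<Omega>" "0 \<le> C" "AE x in M. cmod (g x) \<le> C * cmod (f x)"
  shows "norm (emb g) \<le> C * norm (emb f)"
proof (rule power2_le_imp_le)
  have "(norm (emb g))\<^sup>2 \<le> (\<integral>x. C\<^sup>2 * (cmod (f x))\<^sup>2 \<partial>M)"
    unfolding norm_emb_sq[OF assms(2)]
  proof (rule integral_mono_AE)
    show "integrable M (\<lambda>x. C\<^sup>2 * (cmod (f x))\<^sup>2)" using L2_sq_integrable[OF assms(1)] by simp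
    show "AE x in M. (cmod (g x))\<^sup>2 \<le> C\<^sup>2 * (cmod (f x))\<^sup>2"
      using assms(4) by (rule eventually_mono) (auto simp flip: power_mult_distrib intro!: power_mono)
  qed (rule L2_sq_integrable[OF assms(2)])
  also have "\<dots> = (C * norm (emb f))\<^sup>2" by (simp add: power_mult_distrib norm_emb_sq assms)
  finally show "(norm (emb g))\<^sup>2 \<le> (C * norm (emb f))\<^sup>2" .
qed (use assms in simp)

lemma norm_emb_cmult: "f \<in> L2 \<Omega> \<Longrightarrow> norm (emb (\<lambda>x. c * f x)) = cmod c * norm (emb f)"
  by (rule power2_eq_imp_eq) (simp_all add: norm_emb_sq L2_cmult norm_mult power_mult_distrib)

lemma measure_\<Omega>: "measure M \<Omega> = 2 * a"
  using a_pos by (simp add: measure_restrict_space)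

lemma integrable_L2: assumes "f \<in> L2 \<Omega>" shows "integrable M f"
proof (rule Bochner_Integration.integrable_bound)
  show "integrable M (\<lambda>x. 1 + (cmod (f x))\<^sup>2)" using L2_sq_integrable[OF assms] by simp
  have "t \<le> 1 + t\<^sup>2" for t :: real
  proof -
    have "2 * t \<le> 1 + t\<^sup>2" using zero_le_power2[of "t - 1"] by (simp add: power2_eq_square algebra_simps)
    moreover have "0 \<le> t\<^sup>2" by simp
    ultimately show ?thesis by linarith
  qed
  then show "AE x in M. norm (f x) \<le> norm (1 + (cmod (f x))\<^sup>2)" by simp
qed (use assms L2_measurable in blast)

lemma L2_const: "(\<lambda>_. c) \<in> L2 \<Omega>" by (simp add: L2_def)

text \<open>Cauchy-Schwarz against the constant 1, whose norm on the interval is sqrt(2a). This is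
  the origin of every \<open>sqrt (2 * a)\<close> below.\<close>

lemma integral_cmod_le:
  assumes "f \<in> L2 \<Omega>" shows "(\<integral>x. cmod (f x) \<partial>M) \<le> sqrt (2 * a) * norm (emb f)"
proof -
  have n: "(\<lambda>x. complex_of_real (cmod (f x))) \<in> L2 \<Omega>"
    using L2_measurable[OF assms] by (intro L2_bound[OF assms, of _ 1]) auto
  have "(\<integral>x. cmod (f x) \<partial>M) = emb (\<lambda>_. 1) \<bullet> emb (\<lambda>x. complex_of_real (cmod (f x)))"
    by (simp add: inner_emb L2_const n)
  also have "\<dots> \<le> norm (emb (\<lambda>_. 1)) * norm (emb (\<lambda>x. complex_of_real (cmod (f x))))"
    by (rule norm_cauchy_schwarz)
  also have "norm (emb (\<lambda>_. 1)) = sqrt (2 * a)"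
    by (simp add: norm_emb L2_const L2_norm_def measure_\<Omega>)
  also have "norm (emb (\<lambda>x. complex_of_real (cmod (f x)))) \<le> 1 * norm (emb f)"
    by (rule norm_emb_mono[OF assms n]) auto
  finally show ?thesis using a_pos by (simp add: mult_left_mono)
qed

lemma continuous_L2: assumes "continuous_on {-a..a} f" shows "f \<in> L2 \<Omega>"
proof -
  have 1: "f \<in> borel_measurable (lebesgue_on {-a..a})"
    using assms by (rule continuous_imp_measurable_on_sets_lebesgue) simp
  then have "f \<in> borel_measurable M"
    by (rule measurable_restrict_mono) auto
  moreover obtain B where "\<And>x. x \<in> {-a..a} \<Longrightarrow> cmod (f x) \<le> B"
    using compact_imp_bounded[OF compact_continuous_image[OF assms compact_Icc]]
    unfolding bounded_iff by blast
  then have "AE x in M. cmod (f x) \<le> B * cmod 1" by (intro AE_M_I) auto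
  ultimately show ?thesis by (intro L2_bound[OF L2_const[of 1], of f B])
qed

text \<open>\<open>acd f g\<close>: on \<open>[-a, a]\<close> the function \<open>f\<close> is absolutely continuous with derivative \<open>g \<in> L\<^sup>2\<close>.\<close>

definition acd :: "(real \<Rightarrow> complex) \<Rightarrow> (real \<Rightarrow> complex) \<Rightarrow> bool" where
  "acd f g \<longleftrightarrow> g \<in> L2 \<Omega> \<and> (\<forall>x\<in>{-a..a}. f x = f (-a) + integral {-a..x} g)"

lemma acdD: "acd f g \<Longrightarrow> g \<in> L2 \<Omega>" "acd f g \<Longrightarrow> x \<in> {-a..a} \<Longrightarrow> f x = f (-a) + integral {-a..x} g"
  unfolding acd_def by blast+

lemma acdI:
  "g \<in> L2 \<Omega> \<Longrightarrow> (\<And>x. x \<in> {-a..a} \<Longrightarrow> f x = f (-a) + integral {-a..x} g) \<Longrightarrow> acd f g"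
  unfolding acd_def by blast

lemma L2_abs_integrable: assumes "g \<in> L2 \<Omega>" shows "g absolutely_integrable_on {-a..a}"
proof -
  have "g absolutely_integrable_on \<Omega>"
    using integrable_L2[OF assms] by (simp add: integrable_restrict_space set_integrable_def)
  then show ?thesis
  proof (rule absolutely_integrable_spike_set)
    show "negligible {x \<in> \<Omega> - {-a..a}. g x \<noteq> 0}" by (rule negligible_subset[of "{}"]) auto
    show "negligible {x \<in> {-a..a} - \<Omega>. g x \<noteq> 0}" by (rule negligible_subset[of "{-a, a}"]) auto
  qed
qed

lemma L2_integrable_on: "g \<in> L2 \<Omega> \<Longrightarrow> {c..d} \<subseteq> {-a..a} \<Longrightarrow> g integrable_on {c..d}"
  by (rule integrable_on_subinterval[OF set_lebesgue_integral_eq_integral(1)[OF L2_abs_integrable]])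

lemma borel_measurable_indicator_M [measurable]:
  "A \<in> sets lebesgue \<Longrightarrow> indicat_real A \<in> borel_measurable M"
  by (intro measurable_restrict_space1 borel_measurable_indicator)

lemma integrable_indicator_M:
  assumes "A \<in> sets lebesgue" "integrable M (g :: real \<Rightarrow> complex)"
  shows "integrable M (\<lambda>s. indicat_real A s *\<^sub>R g s)"
proof (rule Bochner_Integration.integrable_bound[OF assms(2)])
  show "(\<lambda>s. indicat_real A s *\<^sub>R g s) \<in> borel_measurable M"
    by (intro borel_measurable_scaleR borel_measurable_integrable[OF assms(2)] borel_measurable_indicator_M assms(1))
qed (auto simp: indicator_def)

text \<open>Rewrites the primitive as an integral over a fixed measure space, ready for Fubini. Both
  forms are used because the complement of s <= x, read as a condition on x, is the strict x <
  s.\<close>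

lemma integral_as_indicator:
  assumes g: "g \<in> L2 \<Omega>" and x: "x \<in> {-a..a}"
  shows "(\<integral>s. indicat_real {..x} s *\<^sub>R g s \<partial>M) = integral {-a..x} g"
    and "(\<integral>s. indicat_real {..<x} s *\<^sub>R g s \<partial>M) = integral {-a..x} g"
proof -
  have int: "integrable M (\<lambda>s. indicat_real {..<x} s *\<^sub>R g s)"
    by (intro integrable_indicator_M integrable_L2 g) auto
  have "((\<lambda>s. indicat_real {..<x} s *\<^sub>R g s) has_integral (\<integral>s. indicat_real {..<x} s *\<^sub>R g s \<partial>M)) \<Omega>"
    by (rule has_integral_integral_lebesgue_on[OF int]) simp
  then have "((\<lambda>s. if s \<in> {-a<..<x} then g s else 0) has_integral (\<integral>s. indicat_real {..<x} s *\<^sub>R g s \<partial>M)) UNIV"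
    unfolding has_integral_restrict_UNIV[of \<Omega>, symmetric]
    by (rule has_integral_eq[rotated]) (use x in \<open>auto simp: indicator_def\<close>)
  then have "(g has_integral (\<integral>s. indicat_real {..<x} s *\<^sub>R g s \<partial>M)) {-a<..<x}"
    by (simp only: has_integral_restrict_UNIV)
  then have "(g has_integral (\<integral>s. indicat_real {..<x} s *\<^sub>R g s \<partial>M)) {-a..x}"
    using has_integral_Icc_iff_Ioo by blast
  then show 2: "(\<integral>s. indicat_real {..<x} s *\<^sub>R g s \<partial>M) = integral {-a..x} g" by (simp add: integral_unique)
  have "AE s in M. indicat_real {..x} s *\<^sub>R g s = indicat_real {..<x} s *\<^sub>R g s"
    unfolding AE_M_iff
    by (rule eventually_mono[OF AE_not_in[of "{x}"]]) (auto intro: null_sets_completionI simp: indicator_def)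
  moreover have "(\<lambda>s. indicat_real {..x} s *\<^sub>R g s) \<in> borel_measurable M"
    by (intro borel_measurable_scaleR L2_measurable[OF g] borel_measurable_indicator_M) auto
  ultimately show "(\<integral>s. indicat_real {..x} s *\<^sub>R g s \<partial>M) = integral {-a..x} g"
    unfolding 2[symmetric] using int by (intro integral_cong_AE) auto
qed

lemma acd_continuous: assumes "acd f g" shows "continuous_on {-a..a} f"
proof -
  have "continuous_on {-a..a} (\<lambda>x. f (-a) + integral {-a..x} g)"
    by (intro continuous_intros indefinite_integral_continuous_1 L2_integrable_on acdD(1)[OF assms]) auto
  then show ?thesis by (rule continuous_on_eq) (use acdD(2)[OF assms] in metis)
qed

lemma acd_L2: "acd f g \<Longrightarrow> f \<in> L2 \<Omega>" by (rule continuous_L2[OF acd_continuous])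

lemma acd_end: assumes "acd f g" shows "f a - f (-a) = (\<integral>x. g x \<partial>M)"
proof -
  have "(\<integral>s. indicat_real {..<a} s *\<^sub>R g s \<partial>M) = (\<integral>s. g s \<partial>M)"
    by (rule Bochner_Integration.integral_cong) (auto simp: indicator_def)
  then show ?thesis
    using acdD(2)[OF assms, of a] integral_as_indicator(2)[OF acdD(1)[OF assms], of a] a_pos by simp
qed

text \<open>The embedding of H1 into continuous functions; with a known zero of f it turns L2
  control of the derivative into uniform control of f.\<close>

lemma acd_diff_bound:
  assumes "acd f g" "x \<in> {-a..a}" "y \<in> {-a..a}"
  shows "cmod (f x - f y) \<le> sqrt (2 * a) * norm (emb g)"
proof -
  have *: "cmod (f x - f y) \<le> sqrt (2 * a) * norm (emb g)" if "y \<le> x" "x \<in> {-a..a}" "y \<in> {-a..a}" for x y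
  proof -
    have g: "g \<in> L2 \<Omega>" using assms acdD by blast
    have "f x - f y = (\<integral>s. indicat_real {..<x} s *\<^sub>R g s \<partial>M) - (\<integral>s. indicat_real {..<y} s *\<^sub>R g s \<partial>M)"
      using acdD(2)[OF assms(1) that(2)] acdD(2)[OF assms(1) that(3)] that
      by (simp add: integral_as_indicator(2)[OF g])
    also have "\<dots> = (\<integral>s. indicat_real {..<x} s *\<^sub>R g s - indicat_real {..<y} s *\<^sub>R g s \<partial>M)"
      by (intro Bochner_Integration.integral_diff[symmetric] integrable_indicator_M integrable_L2 g) auto
    also have "cmod \<dots> \<le> (\<integral>s. cmod (indicat_real {..<x} s *\<^sub>R g s - indicat_real {..<y} s *\<^sub>R g s) \<partial>M)"
      by (rule integral_norm_bound)
    also have "\<dots> \<le> (\<integral>s. cmod (g s) \<partial>M)"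
      by (intro integral_mono integrable_norm Bochner_Integration.integrable_diff integrable_indicator_M integrable_L2 g)
         (auto simp: indicator_def)
    also have "\<dots> \<le> sqrt (2 * a) * norm (emb g)" by (rule integral_cmod_le[OF g])
    finally show ?thesis .
  qed
  show ?thesis
    using *[of y x] *[of x y] assms(2,3) by (cases "y \<le> x") (auto simp: norm_minus_commute)
qed

lemma acd_add:
  assumes "acd f f'" "acd g g'" shows "acd (\<lambda>x. f x + g x) (\<lambda>x. f' x + g' x)"
proof (rule acdI)
  show "(\<lambda>x. f' x + g' x) \<in> L2 \<Omega>" by (intro L2_add acdD(1)[OF assms(1)] acdD(1)[OF assms(2)])
  fix x assume x: "x \<in> {-a..a}"
  have "integral {-a..x} (\<lambda>x. f' x + g' x) = integral {-a..x} f' + integral {-a..x} g'"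
    by (intro integral_add L2_integrable_on acdD(1)[OF assms(1)] acdD(1)[OF assms(2)]) (use x in auto)
  then show "f x + g x = f (-a) + g (-a) + integral {-a..x} (\<lambda>x. f' x + g' x)"
    unfolding acdD(2)[OF assms(1) x] acdD(2)[OF assms(2) x] by (simp add: algebra_simps)
qed

lemma acd_cmult:
  assumes "acd f f'" shows "acd (\<lambda>x. c * f x) (\<lambda>x. c * f' x)"
proof (rule acdI)
  show "(\<lambda>x. c * f' x) \<in> L2 \<Omega>" by (intro L2_cmult acdD(1)[OF assms])
  fix x assume x: "x \<in> {-a..a}"
  show "c * f x = c * f (-a) + integral {-a..x} (\<lambda>x. c * f' x)"
    unfolding acdD(2)[OF assms x] by (simp add: distrib_left)
qed

lemma acd_cnj:
  assumes "acd f f'" shows "acd (\<lambda>x. cnj (f x)) (\<lambda>x. cnj (f' x))"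
proof (rule acdI)
  show "(\<lambda>x. cnj (f' x)) \<in> L2 \<Omega>" by (intro L2_cnj acdD(1)[OF assms])
  fix x assume x: "x \<in> {-a..a}"
  show "cnj (f x) = cnj (f (-a)) + integral {-a..x} (\<lambda>x. cnj (f' x))"
    unfolding acdD(2)[OF assms x] by (simp flip: integral_cnj)
qed

lemma acd_diff: "acd f f' \<Longrightarrow> acd g g' \<Longrightarrow> acd (\<lambda>x. f x - g x) (\<lambda>x. f' x - g' x)"
  using acd_add[OF _ acd_cmult[of g g' "-1"]] by simp

lemma acd_cong:
  assumes "acd f g" "\<And>x. x \<in> {-a..a} \<Longrightarrow> f' x = f x" "AE x in M. g x = g' x"
  shows "acd f' g'"
proof -
  have g: "g \<in> L2 \<Omega>" "g' \<in> L2 \<Omega>" using assms acdD(1) L2_cong_AE by blast+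
  have "integral {-a..x} g = integral {-a..x} g'" if "x \<in> {-a..a}" for x
    unfolding integral_as_indicator(2)[OF g(1) that, symmetric] integral_as_indicator(2)[OF g(2) that, symmetric]
    by (intro integral_cong_AE borel_measurable_scaleR L2_measurable g borel_measurable_indicator_M)
       (use assms(3) in \<open>auto elim!: eventually_mono\<close>)
  moreover have "-a \<in> {-a..a}" using a_pos by simp
  ultimately show ?thesis
    using acdD(2)[OF assms(1)] assms(2) by (intro acdI g) metis
qed

text \<open>The finite exceptional set is meant for the origin, where u log |u|^2 is continuous but
  has no classical derivative.\<close>

lemma acd_FTC:
  assumes "g \<in> L2 \<Omega>" "finite S" "continuous_on {-a..a} f"
    and "\<And>x. x \<in> \<Omega> - S \<Longrightarrow> (f has_vector_derivative g x) (at x)"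
  shows "acd f g"
  unfolding acd_def
proof (intro conjI ballI assms(1))
  fix x assume x: "x \<in> {-a..a}"
  have "(g has_integral (f x - f (-a))) {-a..x}"
  proof (rule fundamental_theorem_of_calculus_strong[of "insert (-a) (insert a S)"])
    show "continuous_on {-a..x} f" by (rule continuous_on_subset[OF assms(3)]) (use x in auto)
  qed (use assms x in auto)
  then show "f x = f (-a) + integral {-a..x} g" by (simp add: integral_unique)
qed

text \<open>Fubini on a triangle. Since k vanishes at the left end, k(x) is the integral of k' up to
  x; since it vanishes at both ends, k' has mean zero.\<close>

lemma acd_ibp:
  assumes f: "acd f f'" and k: "acd k k'" and k0: "k (-a) = 0" "k a = 0"
  shows "(\<integral>x. f' x * k x \<partial>M) + (\<integral>x. f x * k' x \<partial>M) = 0"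
proof -
  interpret P: pair_sigma_finite M M by (rule pair_sigma_finite.intro) unfold_locales
  note [measurable] = L2_measurable[OF acdD(1)[OF f]] L2_measurable[OF acdD(1)[OF k]]
  have [measurable]: "(\<lambda>x. x) \<in> borel_measurable M" using id_borel_measurable_lebesgue_on by (simp add: id_def)
  have if': "integrable M f'" and ik': "integrable M k'" using f k acdD(1) integrable_L2 by blast+
  define h where "h = (\<lambda>x s. f' x * k' s)"
  have hint: "integrable (M \<Otimes>\<^sub>M M) (\<lambda>(x, s). h x s)"
  proof (rule P.Fubini_integrable)
    show "(\<lambda>(x, s). h x s) \<in> borel_measurable (M \<Otimes>\<^sub>M M)" unfolding h_def by measurable
    show "integrable M (\<lambda>x. \<integral>s. norm (case (x, s) of (x, s) \<Rightarrow> h x s) \<partial>M)"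
      using if' by (simp add: h_def norm_mult)
    show "AE x in M. integrable M (\<lambda>s. case (x, s) of (x, s) \<Rightarrow> h x s)"
      using ik' by (simp add: h_def)
  qed
  have hind: "integrable (M \<Otimes>\<^sub>M M) (\<lambda>(x, s). indicat_real {..<s} x *\<^sub>R h x s)"
    by (rule Bochner_Integration.integrable_bound[OF hint])
       (auto simp: h_def indicator_def, measurable)
  have kx: "k x = integral {-a..x} k'" if "x \<in> {-a..a}" for x using acdD(2)[OF k that] k0 by simp
  have fx: "integral {-a..x} f' = f x - f (-a)" if "x \<in> {-a..a}" for x using acdD(2)[OF f that] by simp
  have K: "integral\<^sup>L M k' = 0" using acd_end[OF k] k0 by simp
  have "(\<integral>x. f' x * k x \<partial>M) = (\<integral>x. f' x * (\<integral>s. indicat_real {..x} s *\<^sub>R k' s \<partial>M) \<partial>M)"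
    using kx integral_as_indicator(1)[OF acdD(1)[OF k]]
    by (intro Bochner_Integration.integral_cong) auto
  also have "\<dots> = (\<integral>x. (\<integral>s. indicat_real {..x} s *\<^sub>R h x s \<partial>M) \<partial>M)"
    unfolding h_def by (simp flip: integral_mult_right_zero mult_scaleR_right)
  \<comment> \<open>Passing to the complement of s <= x; the full integral of \<open>h x\<close>
    over s drops out because k' has mean zero.\<close>
  also have "\<dots> = (\<integral>x. (\<integral>s. h x s - indicat_real {..<s} x *\<^sub>R h x s \<partial>M) \<partial>M)"
    by (intro Bochner_Integration.integral_cong) (auto simp: indicator_def)
  also have "\<dots> = (\<integral>x. 0 - (\<integral>s. indicat_real {..<s} x *\<^sub>R h x s \<partial>M) \<partial>M)"
  proof (intro Bochner_Integration.integral_cong refl)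
    fix x
    have 1: "integrable M (\<lambda>s. h x s)" using ik' by (simp add: h_def)
    have "integrable M (\<lambda>s. indicat_real {x<..} s *\<^sub>R h x s)"
      by (intro integrable_indicator_M 1) auto
    also have "(\<lambda>s. indicat_real {x<..} s *\<^sub>R h x s) = (\<lambda>s. indicat_real {..<s} x *\<^sub>R h x s)"
      by (auto simp: indicator_def)
    finally show "(\<integral>s. h x s - indicat_real {..<s} x *\<^sub>R h x s \<partial>M) = 0 - (\<integral>s. indicat_real {..<s} x *\<^sub>R h x s \<partial>M)"
      using 1 K by (simp add: h_def)
  qed
  also have "\<dots> = - (\<integral>x. (\<integral>s. indicat_real {..<s} x *\<^sub>R h x s \<partial>M) \<partial>M)" by simp
  also have "(\<integral>x. (\<integral>s. indicat_real {..<s} x *\<^sub>R h x s \<partial>M) \<partial>M)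
      = (\<integral>s. (\<integral>x. indicat_real {..<s} x *\<^sub>R h x s \<partial>M) \<partial>M)"
    by (rule P.Fubini_integral[symmetric]) (use hind in simp)
  also have "\<dots> = (\<integral>s. (\<integral>x. indicat_real {..<s} x *\<^sub>R f' x \<partial>M) * k' s \<partial>M)"
    unfolding h_def by (simp flip: integral_mult_left_zero mult_scaleR_left)
  also have "\<dots> = (\<integral>s. (f s - f (-a)) * k' s \<partial>M)"
    using fx integral_as_indicator(2)[OF acdD(1)[OF f]]
    by (intro Bochner_Integration.integral_cong) auto
  also have "\<dots> = (\<integral>s. f s * k' s \<partial>M)"
  proof -
    have "integrable M (\<lambda>s. (f s - f (-a)) * k' s + f (-a) * k' s)"
    proof -
      obtain B where B: "\<And>x. x \<in> {-a..a} \<Longrightarrow> cmod (f x) \<le> B"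
        using compact_imp_bounded[OF compact_continuous_image[OF acd_continuous[OF f] compact_Icc]]
        unfolding bounded_iff by blast
      have "integrable M (\<lambda>s. f s * k' s)"
      proof (rule Bochner_Integration.integrable_bound)
        show "integrable M (\<lambda>s. B * cmod (k' s))" using ik' by simp
        show "AE x in M. norm (f x * k' x) \<le> norm (B * cmod (k' x))"
          using B by (intro AE_M_I) (auto simp: norm_mult abs_mult intro!: mult_right_mono order_trans[OF _ abs_ge_self])
      qed (use L2_measurable[OF acd_L2[OF f]] in measurable)
      then show ?thesis by (simp add: algebra_simps)
    qed
    then have "integrable M (\<lambda>s. (f s - f (-a)) * k' s)"
      using ik' Bochner_Integration.integrable_diff[of M _ "\<lambda>s. f (-a) * k' s"] by fastforce
    then have "(\<integral>s. (f s - f (-a)) * k' s + f (-a) * k' s \<partial>M) = (\<integral>s. (f s - f (-a)) * k' s \<partial>M)"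
      using ik' K by simp
    then show ?thesis by (simp add: algebra_simps)
  qed
  finally show ?thesis by simp
qed

lemma acd_ibp_inner:
  assumes f: "acd f f'" and k: "acd k k'" and k0: "k (-a) = 0" "k a = 0"
  shows "emb f' \<bullet> emb k = - (emb f \<bullet> emb k')"
proof -
  have inner: "z \<bullet> w = Re (z * cnj w)" for z w :: complex by (simp add: inner_complex_def)
  have prod: "integrable M (\<lambda>x. p x * cnj (q x))" if p: "p \<in> L2 \<Omega>" and q: "q \<in> L2 \<Omega>" for p q
  proof (rule Bochner_Integration.integrable_bound)
    show "integrable M (\<lambda>x. (cmod (p x))\<^sup>2 + (cmod (q x))\<^sup>2)"
      using L2_sq_integrable[OF p] L2_sq_integrable[OF q] by simp
    show "(\<lambda>x. p x * cnj (q x)) \<in> borel_measurable M"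
      using L2_measurable[OF p] L2_measurable[OF L2_cnj[OF q]] by simp
    have "s * t \<le> s\<^sup>2 + t\<^sup>2" for s t :: real
      using abs_inner_le_squares[of s t] by simp
    then show "AE x in M. norm (p x * cnj (q x)) \<le> norm ((cmod (p x))\<^sup>2 + (cmod (q x))\<^sup>2)"
      by (simp add: norm_mult)
  qed
  have "(\<integral>x. f' x * cnj (k x) \<partial>M) + (\<integral>x. f x * cnj (k' x) \<partial>M) = 0"
    by (rule acd_ibp[OF f acd_cnj[OF k]]) (use k0 in auto)
  then have "Re (\<integral>x. f' x * cnj (k x) \<partial>M) + Re (\<integral>x. f x * cnj (k' x) \<partial>M) = 0"
    by (metis plus_complex.simps(1) zero_complex.simps(1))
  moreover have "emb f' \<bullet> emb k = Re (\<integral>x. f' x * cnj (k x) \<partial>M)"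
    unfolding inner_emb[OF acdD(1)[OF f] acd_L2[OF k]] inner
    by (rule integral_Re) (intro prod acdD(1)[OF f] acd_L2[OF k])
  moreover have "emb f \<bullet> emb k' = Re (\<integral>x. f x * cnj (k' x) \<partial>M)"
    unfolding inner_emb[OF acd_L2[OF f] acdD(1)[OF k]] inner
    by (rule integral_Re) (intro prod acdD(1)[OF k] acd_L2[OF f])
  ultimately show ?thesis by simp
qed

end

section \<open>Weak derivatives in one dimension\<close>

context symm_interval
begin

lemma test_fun_acd:
  assumes "test_fun \<Omega> \<psi>"
  shows "acd (\<lambda>x. c * complex_of_real (\<psi> x)) (\<lambda>x. c * complex_of_real (deriv \<psi> x))"
    and "\<psi> (-a) = 0" "\<psi> a = 0"
proof -
  have s: "smooth \<psi>" by (rule test_fun_smooth[OF assms])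
  show "acd (\<lambda>x. c * complex_of_real (\<psi> x)) (\<lambda>x. c * complex_of_real (deriv \<psi> x))"
  proof (rule acd_FTC[of _ "{}"])
    show "(\<lambda>x. c * complex_of_real (deriv \<psi> x)) \<in> L2 \<Omega>"
      by (intro continuous_L2 continuous_intros continuous_on_smooth smooth_deriv s)
    show "continuous_on {-a..a} (\<lambda>x. c * complex_of_real (\<psi> x))"
      by (intro continuous_intros continuous_on_smooth s)
    show "((\<lambda>x. c * complex_of_real (\<psi> x)) has_vector_derivative c * complex_of_real (deriv \<psi> x)) (at x)" for x
      using smooth_DERIV[OF s, of x]
      by (intro has_vector_derivative_mult_right has_vector_derivative_of_real)
        (simp add: has_real_derivative_iff_has_vector_derivative)
  qed simp
  obtain c d where "-a < c" "d < a" "\<And>x. x \<notin> {c..d} \<Longrightarrow> \<psi> x = 0"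
    using test_fun_support[OF assms] by blast
  then show "\<psi> (-a) = 0" "\<psi> a = 0" by auto
qed

lemma inner_emb_test:
  assumes f: "f \<in> L2 \<Omega>" and \<psi>: "continuous_on {-a..a} \<psi>"
  shows "emb f \<bullet> emb (\<lambda>x. c * complex_of_real (\<psi> x)) = Re (cnj c * (\<integral>x. \<psi> x *\<^sub>R f x \<partial>M))"
proof -
  obtain B where B: "\<And>x. x \<in> {-a..a} \<Longrightarrow> \<bar>\<psi> x\<bar> \<le> B"
    using compact_imp_bounded[OF compact_continuous_image[OF \<psi> compact_Icc]]
    unfolding bounded_iff real_norm_def by blast
  have \<psi>L: "(\<lambda>x. c * complex_of_real (\<psi> x)) \<in> L2 \<Omega>" by (intro continuous_L2 continuous_intros \<psi>)
  have "integrable M (\<lambda>x. \<psi> x *\<^sub>R f x)"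
  proof (rule Bochner_Integration.integrable_bound)
    show "integrable M (\<lambda>x. B * cmod (f x))" using integrable_L2[OF f] by simp
    have "\<psi> \<in> borel_measurable (lebesgue_on {-a..a})"
      using \<psi> by (rule continuous_imp_measurable_on_sets_lebesgue) simp
    then have "\<psi> \<in> borel_measurable M" by (rule measurable_restrict_mono) auto
    then show "(\<lambda>x. \<psi> x *\<^sub>R f x) \<in> borel_measurable M"
      using L2_measurable[OF f] by (intro borel_measurable_scaleR)
    show "AE x in M. norm (\<psi> x *\<^sub>R f x) \<le> norm (B * cmod (f x))"
    proof (rule AE_M_I)
      fix x assume "x \<in> \<Omega>"
      then have "\<bar>\<psi> x\<bar> \<le> B" by (intro B) auto
      then show "norm (\<psi> x *\<^sub>R f x) \<le> norm (B * cmod (f x))"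
        by (simp add: abs_mult mult_right_mono)
    qed
  qed
  then have i: "integrable M (\<lambda>x. cnj c * (\<psi> x *\<^sub>R f x))"
    by (intro Bochner_Integration.integrable_mult_right)
  have "emb f \<bullet> emb (\<lambda>x. c * complex_of_real (\<psi> x)) = (\<integral>x. Re (cnj c * (\<psi> x *\<^sub>R f x)) \<partial>M)"
    unfolding inner_emb[OF f \<psi>L]
    by (rule Bochner_Integration.integral_cong) (auto simp: inner_complex_def algebra_simps)
  also have "\<dots> = Re (\<integral>x. cnj c * (\<psi> x *\<^sub>R f x) \<partial>M)" by (rule integral_Re[OF i])
  also have "(\<integral>x. cnj c * (\<psi> x *\<^sub>R f x) \<partial>M) = cnj c * (\<integral>x. \<psi> x *\<^sub>R f x \<partial>M)"
    by (rule integral_mult_right_zero)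
  finally show ?thesis .
qed

lemma L2_loc_integrable: assumes "f \<in> L2 \<Omega>" shows "loc_integrable \<Omega> f"
  unfolding loc_integrable_def
proof (intro allI impI)
  fix K assume K: "compact K \<and> K \<subseteq> \<Omega>"
  have "set_integrable lebesgue \<Omega> f"
    using integrable_L2[OF assms] by (simp add: set_integrable_def integrable_restrict_space)
  then show "set_integrable lebesgue K f"
    by (rule set_integrable_subset) (use K lmeasurable_compact in auto)
qed

text \<open>The factor c, taken as 1 and as \<open>\<i>\<close>, lets the real inner product recover
  both parts of a complex identity. In this form the condition is closed in
  \<open>l2\<close>.\<close>

lemma weak_deriv_L2_iff:
  assumes f: "f \<in> L2 \<Omega>" and g: "g \<in> L2 \<Omega>"
  shows "has_weak_deriv \<Omega> 1 f g \<longleftrightarrow> (\<forall>\<psi> c. test_fun \<Omega> \<psi> \<longrightarrow>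
    emb f \<bullet> emb (\<lambda>x. c * complex_of_real (deriv \<psi> x)) = - (emb g \<bullet> emb (\<lambda>x. c * complex_of_real (\<psi> x))))"
proof -
  have cont: "continuous_on {-a..a} \<psi>" "continuous_on {-a..a} (deriv \<psi>)" if "test_fun \<Omega> \<psi>" for \<psi>
    using that continuous_on_smooth smooth_deriv test_fun_smooth by blast+
  have *: "z = - w \<longleftrightarrow> (\<forall>c. Re (cnj c * z) = - Re (cnj c * w))" for z w
  proof
    assume "\<forall>c. Re (cnj c * z) = - Re (cnj c * w)"
    from spec[OF this, of 1] spec[OF this, of \<i>] show "z = - w" by (simp add: complex_eq_iff)
  qed simp
  show ?thesis
    unfolding has_weak_deriv_def
    using L2_loc_integrable[OF f] L2_loc_integrable[OF g]
    by (auto simp: inner_emb_test f g cont *)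
qed

lemma has_weak_derivD:
  "has_weak_deriv \<Omega> k f g \<Longrightarrow> test_fun \<Omega> \<psi> \<Longrightarrow>
    (\<integral>x. (deriv ^^ k) \<psi> x *\<^sub>R f x \<partial>M) = (-1) ^ k * (\<integral>x. \<psi> x *\<^sub>R g x \<partial>M)"
  by (simp add: has_weak_deriv_def)

lemma acd_weak_deriv: assumes "acd f g" shows "has_weak_deriv \<Omega> 1 f g"
  unfolding weak_deriv_L2_iff[OF acd_L2[OF assms] acdD(1)[OF assms]]
  using acd_ibp_inner[OF assms test_fun_acd(1)] test_fun_acd(2,3) by fastforce

lemma has_weak_deriv_unique:
  assumes "has_weak_deriv \<Omega> k f g" "has_weak_deriv \<Omega> k f g'"
  shows "AE x in M. g x = g' x"
proof -
  have g: "loc_integrable \<Omega> g" "loc_integrable \<Omega> g'" using assms by (auto simp: has_weak_deriv_def)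
  have "AE x in M. g x - g' x = 0"
  proof (rule fundamental_lemma_variations)
    fix \<psi> assume \<psi>: "test_fun \<Omega> \<psi>"
    from has_weak_derivD[OF assms(1) \<psi>] has_weak_derivD[OF assms(2) \<psi>]
    have "(\<integral>x. \<psi> x *\<^sub>R g x \<partial>M) = (\<integral>x. \<psi> x *\<^sub>R g' x \<partial>M)" by simp
    then show "(\<integral>x. \<psi> x *\<^sub>R (g x - g' x) \<partial>M) = 0"
      using integrable_test_fun_scaleR[OF \<psi> g(1)] integrable_test_fun_scaleR[OF \<psi> g(2)]
      by (simp add: scaleR_diff_right)
  qed (auto intro: loc_integrable_diff g)
  then show ?thesis by simp
qed

lemma acd_primitive: "g \<in> L2 \<Omega> \<Longrightarrow> acd (\<lambda>x. c + integral {-a..x} g) g"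
  by (rule acdI) auto

text \<open>Subtracting a primitive of g leaves a function with zero weak derivative, which is
  constant almost everywhere.\<close>

lemma weak_deriv_acd:
  assumes f: "f \<in> L2 \<Omega>" and g: "g \<in> L2 \<Omega>" and w: "has_weak_deriv \<Omega> 1 f g"
  obtains F where "acd F g" "AE x in M. F x = f x"
proof -
  define G where "G = (\<lambda>x. 0 + integral {-a..x} g)"
  have G: "acd G g" unfolding G_def by (rule acd_primitive[OF g])
  note lf = L2_loc_integrable[OF f] and lG = L2_loc_integrable[OF acd_L2[OF G]]
  obtain c where c: "AE x in M. f x - G x = c"
  proof (rule du_Bois_Reymond)
    show "loc_integrable \<Omega> (\<lambda>x. f x - G x)" by (intro loc_integrable_diff lf lG)
    fix \<psi> assume \<psi>: "test_fun \<Omega> \<psi>"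
    have "(\<integral>x. deriv \<psi> x *\<^sub>R f x \<partial>M) = (\<integral>x. deriv \<psi> x *\<^sub>R G x \<partial>M)"
      using has_weak_derivD[OF w \<psi>] has_weak_derivD[OF acd_weak_deriv[OF G] \<psi>] by simp
    then show "(\<integral>x. deriv \<psi> x *\<^sub>R (f x - G x) \<partial>M) = 0"
      using integrable_test_fun_scaleR[OF test_fun_deriv[OF \<psi>] lf]
        integrable_test_fun_scaleR[OF test_fun_deriv[OF \<psi>] lG]
      by (simp add: scaleR_diff_right)
  qed (use a_pos in auto)
  show ?thesis
  proof (rule that)
    show "acd (\<lambda>x. c + integral {-a..x} g) g" by (rule acd_primitive[OF g])
    show "AE x in M. c + integral {-a..x} g = f x"
      using c by (rule AE_M_mono) (auto simp: G_def)
  qed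
qed

text \<open>Stated for elements of \<open>l2\<close> rather than of \<open>L2 \<Omega>\<close>, so that closedness is immediate.\<close>

definition weak_graph :: "(l2 \<times> l2) set" where
  "weak_graph = {(F, G). \<forall>\<psi> c. test_fun \<Omega> \<psi> \<longrightarrow>
    F \<bullet> emb (\<lambda>x. c * complex_of_real (deriv \<psi> x)) = - (G \<bullet> emb (\<lambda>x. c * complex_of_real (\<psi> x)))}"

lemma closed_weak_graph: "closed weak_graph"
proof -
  have "weak_graph = (\<Inter>\<psi>\<in>{\<psi>. test_fun \<Omega> \<psi>}. \<Inter>c. {z.
    fst z \<bullet> emb (\<lambda>x. c * complex_of_real (deriv \<psi> x)) = - (snd z \<bullet> emb (\<lambda>x. c * complex_of_real (\<psi> x)))})"
    by (auto simp: weak_graph_def)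
  also have "closed \<dots>"
    by (intro closed_INT ballI closed_Collect_eq continuous_intros)
  finally show ?thesis .
qed

lemma subspace_weak_graph: "subspace weak_graph"
  by (auto simp: subspace_def weak_graph_def zero_prod_def inner_add_left algebra_simps)

lemma acd_weak_graph: "acd f g \<Longrightarrow> (emb f, emb g) \<in> weak_graph"
  using acd_weak_deriv[of f g] weak_deriv_L2_iff[OF acd_L2[of f g] acdD(1)[of f g]]
  by (auto simp: weak_graph_def)

text \<open>Lower semicontinuity of the norm of the derivative under L2 convergence. It is the means
  by which derivatives are produced from difference quotients without any convergence of their
  derivatives.\<close>

lemma acd_limit:
  assumes f: "f \<in> L2 \<Omega>"
    and approx: "\<And>e. e > 0 \<Longrightarrow> \<exists>f' g'. acd f' g' \<and> norm (emb f' - emb f) < e \<and> norm (emb g') \<le> B"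
  obtains h g where "acd h g" "AE x in M. h x = f x" "norm (emb g) \<le> B"
proof -
  obtain G where G: "(emb f, G) \<in> weak_graph" "norm G \<le> B"
    using closed_graph_bounded_limit[OF closed_weak_graph subspace_weak_graph, of "emb f" B]
      approx acd_weak_graph by metis
  \<comment> \<open>G lives on the whole line. Restricting a representative to the interval does not
    increase the norm and leaves all pairings with embedded functions unchanged.\<close>
  obtain g where g: "sq_int g" "abs_l2 g = G" by (rule obtain_rep_l2)
  have "(\<lambda>x. indicat_real \<Omega> x *\<^sub>R g x) = cut g" by (auto simp: cut_def)
  have le: "(cmod (cut g x))\<^sup>2 \<le> (cmod (g x))\<^sup>2" for x by (auto simp: cut_def)
  have "cut g \<in> borel_measurable lebesgue"
    unfolding cut_def[abs_def] using g(1)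
    by (intro borel_measurable_if_I measurable_restrict_space1) (auto simp: sq_int_def)
  moreover from this have "integrable lebesgue (\<lambda>x. (cmod (cut g x))\<^sup>2)"
    by (intro Bochner_Integration.integrable_bound[OF sq_int_integrable[OF g(1)]]) (use le in auto)
  ultimately have gc: "sq_int (cut g)" by (simp add: sq_int_def)
  then have gL: "g \<in> L2 \<Omega>" by (simp add: L2_iff_cut)
  have "(norm (emb g))\<^sup>2 \<le> (norm G)\<^sup>2"
    unfolding emb_def g(2)[symmetric] norm_abs_l2[OF gc] norm_abs_l2[OF g(1)]
    by (intro integral_mono sq_int_integrable gc g(1) le)
  then have nG: "norm (emb g) \<le> norm G" by (rule power2_le_imp_le) simp
  have eq: "G \<bullet> emb p = emb g \<bullet> emb p" if "p \<in> L2 \<Omega>" for p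
  proof -
    have "G \<bullet> emb p = (\<integral>x. g x \<bullet> cut p x \<partial>lebesgue)"
      using that unfolding emb_def g(2)[symmetric] by (simp add: inner_abs_l2 g(1) L2_iff_cut)
    also have "(\<lambda>x. g x \<bullet> cut p x) = (\<lambda>x. cut g x \<bullet> cut p x)" by (auto simp: cut_def)
    also have "integral\<^sup>L lebesgue \<dots> = emb g \<bullet> emb p"
      using that unfolding emb_def by (simp add: inner_abs_l2 gc L2_iff_cut)
    finally show ?thesis .
  qed
  have "has_weak_deriv \<Omega> 1 f g"
    unfolding weak_deriv_L2_iff[OF f gL]
  proof (intro allI impI)
    fix \<psi> c assume \<psi>: "test_fun \<Omega> \<psi>"
    have "emb f \<bullet> emb (\<lambda>x. c * complex_of_real (deriv \<psi> x)) = - (G \<bullet> emb (\<lambda>x. c * complex_of_real (\<psi> x)))"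
      using G(1) \<psi> unfolding weak_graph_def by blast
    then show "emb f \<bullet> emb (\<lambda>x. c * complex_of_real (deriv \<psi> x)) = - (emb g \<bullet> emb (\<lambda>x. c * complex_of_real (\<psi> x)))"
      by (simp add: eq[OF acd_L2[OF test_fun_acd(1)[OF \<psi>]]])
  qed
  then obtain h where "acd h g" "AE x in M. h x = f x" using weak_deriv_acd[OF f gL] by blast
  then show ?thesis using that nG G(2) by force
qed

section \<open>Higher weak derivatives and Sobolev norms\<close>

lemma has_weak_deriv_Suc:
  assumes "has_weak_deriv \<Omega> k f g" "has_weak_deriv \<Omega> 1 g h"
  shows "has_weak_deriv \<Omega> (Suc k) f h"
  unfolding has_weak_deriv_def
proof (intro conjI allI impI)
  fix \<psi> assume \<psi>: "test_fun \<Omega> \<psi>"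
  have "(\<integral>x. (deriv ^^ Suc k) \<psi> x *\<^sub>R f x \<partial>M) = (\<integral>x. (deriv ^^ k) (deriv \<psi>) x *\<^sub>R f x \<partial>M)"
    by (simp add: funpow_swap1)
  also have "\<dots> = (-1) ^ k * (\<integral>x. deriv \<psi> x *\<^sub>R g x \<partial>M)"
    by (rule has_weak_derivD[OF assms(1) test_fun_deriv[OF \<psi>]])
  also have "\<dots> = (-1) ^ Suc k * (\<integral>x. \<psi> x *\<^sub>R h x \<partial>M)"
    using has_weak_derivD[OF assms(2) \<psi>] by simp
  finally show "(\<integral>x. (deriv ^^ Suc k) \<psi> x *\<^sub>R f x \<partial>M) = (-1) ^ Suc k * (\<integral>x. \<psi> x *\<^sub>R h x \<partial>M)" .
qed (use assms in \<open>auto simp: has_weak_deriv_def\<close>)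

text \<open>\<open>Hs\<close> supplies each weak derivative of f separately; this makes them
  successive derivatives of one another.\<close>

lemma has_weak_deriv_of_Suc:
  assumes "has_weak_deriv \<Omega> k f g" "has_weak_deriv \<Omega> (Suc k) f h"
  shows "has_weak_deriv \<Omega> 1 g h"
  unfolding has_weak_deriv_def
proof (intro conjI allI impI)
  fix \<psi> assume \<psi>: "test_fun \<Omega> \<psi>"
  have "(-1) ^ k * (\<integral>x. deriv \<psi> x *\<^sub>R g x \<partial>M) = (\<integral>x. (deriv ^^ k) (deriv \<psi>) x *\<^sub>R f x \<partial>M)"
    by (rule has_weak_derivD[OF assms(1) test_fun_deriv[OF \<psi>], symmetric])
  also have "\<dots> = (\<integral>x. (deriv ^^ Suc k) \<psi> x *\<^sub>R f x \<partial>M)" by (simp add: funpow_swap1)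
  also have "\<dots> = (-1) ^ Suc k * (\<integral>x. \<psi> x *\<^sub>R h x \<partial>M)"
    by (rule has_weak_derivD[OF assms(2) \<psi>])
  finally have "(-1) ^ k * (\<integral>x. deriv \<psi> x *\<^sub>R g x \<partial>M) = (-1) ^ k * (- (\<integral>x. \<psi> x *\<^sub>R h x \<partial>M))" by simp
  then have "(\<integral>x. deriv \<psi> x *\<^sub>R g x \<partial>M) = - (\<integral>x. \<psi> x *\<^sub>R h x \<partial>M)"
    by (simp only: mult_cancel_left power_not_zero neg_equal_0_iff_equal one_neq_zero not_False_eq_True) auto
  then show "(\<integral>x. (deriv ^^ 1) \<psi> x *\<^sub>R g x \<partial>M) = (-1) ^ 1 * (\<integral>x. \<psi> x *\<^sub>R h x \<partial>M)" by simp
qed (use assms in \<open>auto simp: has_weak_deriv_def\<close>)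

lemma has_weak_deriv_cong_left:
  assumes "has_weak_deriv \<Omega> k f g" "f \<in> L2 \<Omega>" "AE x in M. f x = f' x"
  shows "has_weak_deriv \<Omega> k f' g"
proof -
  have f': "f' \<in> L2 \<Omega>" using assms L2_cong_AE by blast
  have "(\<integral>x. p x *\<^sub>R f x \<partial>M) = (\<integral>x. p x *\<^sub>R f' x \<partial>M)" if "p \<in> borel_measurable M" for p :: "real \<Rightarrow> real"
    using assms(3) that by (intro integral_cong_AE borel_measurable_scaleR L2_measurable assms(2) f') (auto elim: eventually_mono)
  moreover have "(deriv ^^ k) \<psi> \<in> borel_measurable M" if "test_fun \<Omega> \<psi>" for \<psi>
  proof -
    have "smooth ((deriv ^^ k) \<psi>)"
      by (induction k) (use that test_fun_smooth smooth_deriv in auto)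
    then show ?thesis
      by (intro continuous_imp_measurable_on_sets_lebesgue continuous_on_smooth) auto
  qed
  ultimately show ?thesis
    using assms(1) L2_loc_integrable[OF f'] by (simp add: has_weak_deriv_def)
qed

lemma has_weak_deriv_0: "f \<in> L2 \<Omega> \<Longrightarrow> has_weak_deriv \<Omega> 0 f f"
  by (simp add: has_weak_deriv_def L2_loc_integrable)

lemma has_weak_deriv_cong_right:
  assumes "has_weak_deriv \<Omega> k f g" "g \<in> L2 \<Omega>" "AE x in M. g x = g' x"
  shows "has_weak_deriv \<Omega> k f g'"
proof -
  have g': "g' \<in> L2 \<Omega>" using assms L2_cong_AE by blast
  have "(\<integral>x. \<psi> x *\<^sub>R g x \<partial>M) = (\<integral>x. \<psi> x *\<^sub>R g' x \<partial>M)" if "test_fun \<Omega> \<psi>" for \<psi>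
    using assms(3) that
    by (intro integral_cong_AE borel_measurable_scaleR L2_measurable assms(2) g'
        continuous_imp_measurable_on_sets_lebesgue continuous_on_smooth test_fun_smooth) (auto elim: eventually_mono)
  then show ?thesis
    using assms(1) L2_loc_integrable[OF g'] by (simp add: has_weak_deriv_def)
qed

lemma AE_wderiv: "has_weak_deriv \<Omega> k f g \<Longrightarrow> AE x in M. wderiv \<Omega> k f x = g x"
  unfolding wderiv_def
  by (rule has_weak_deriv_unique[of k f]) (rule someI[of "has_weak_deriv \<Omega> k f"])

lemma L2_norm_wderiv:
  assumes "has_weak_deriv \<Omega> k f g" "g \<in> L2 \<Omega>"
  shows "L2_norm \<Omega> (wderiv \<Omega> k f) = norm (emb g)"
proof -
  have ae: "AE x in M. g x = wderiv \<Omega> k f x" using AE_wderiv[OF assms(1)] by (auto elim: eventually_mono)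
  have "wderiv \<Omega> k f \<in> L2 \<Omega>" by (rule L2_cong_AE[OF assms(2) ae])
  then show ?thesis using emb_cong_AE[OF assms(2) ae] by (simp add: norm_emb)
qed

lemma weak_derivs_of_acd:
  assumes "acd U W" "AE x in M. U x = f x"
  shows "f \<in> L2 \<Omega>" "has_weak_deriv \<Omega> 0 f U" "has_weak_deriv \<Omega> 1 f W"
    and "acd W Q \<Longrightarrow> has_weak_deriv \<Omega> 2 f Q"
    and "acd W Q \<Longrightarrow> acd Q P \<Longrightarrow> has_weak_deriv \<Omega> 3 f P"
proof -
  have U: "U \<in> L2 \<Omega>" by (rule acd_L2[OF assms(1)])
  show "f \<in> L2 \<Omega>" by (rule L2_cong_AE[OF U assms(2)])
  show "has_weak_deriv \<Omega> 0 f U" by (rule has_weak_deriv_cong_left[OF has_weak_deriv_0[OF U] U assms(2)])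
  show 1: "has_weak_deriv \<Omega> 1 f W" by (rule has_weak_deriv_cong_left[OF acd_weak_deriv[OF assms(1)] U assms(2)])
  show 2: "has_weak_deriv \<Omega> 2 f Q" if "acd W Q"
    using has_weak_deriv_Suc[OF 1 acd_weak_deriv[OF that]] by (simp add: numeral_2_eq_2)
  show "has_weak_deriv \<Omega> 3 f P" if "acd W Q" "acd Q P"
    using has_weak_deriv_Suc[OF 2[OF that(1)] acd_weak_deriv[OF that(2)]] by (simp add: numeral_3_eq_3 numeral_2_eq_2)
qed

lemma Hs_2_iff: "f \<in> Hs \<Omega> 2 \<longleftrightarrow> (\<exists>U W Q. acd U W \<and> acd W Q \<and> (AE x in M. U x = f x))"
proof
  assume "f \<in> Hs \<Omega> 2"
  then have f: "f \<in> L2 \<Omega>" and ex: "\<And>j. j \<le> 2 \<Longrightarrow> \<exists>g\<in>L2 \<Omega>. has_weak_deriv \<Omega> j f g" by (auto simp: Hs_def)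
  obtain g1 where g1: "g1 \<in> L2 \<Omega>" "has_weak_deriv \<Omega> 1 f g1" using ex[of 1] by auto
  obtain g2 where g2: "g2 \<in> L2 \<Omega>" "has_weak_deriv \<Omega> 2 f g2" using ex[of 2] by auto
  have "has_weak_deriv \<Omega> 1 g1 g2"
    by (rule has_weak_deriv_of_Suc[OF g1(2)]) (use g2(2) in \<open>simp add: numeral_2_eq_2\<close>)
  \<comment> \<open>The representatives are chosen from the top down: first W, absolutely continuous
    with derivative \<open>g2\<close>, then U as a primitive of this very W.\<close>
  then obtain W where W: "acd W g2" "AE x in M. W x = g1 x" using weak_deriv_acd[OF g1(1) g2(1)] by blast
  have "has_weak_deriv \<Omega> 1 f W"
    by (rule has_weak_deriv_cong_right[OF g1(2,1)]) (use W(2) in \<open>auto elim: eventually_mono\<close>)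
  then obtain U where "acd U W" "AE x in M. U x = f x" using weak_deriv_acd[OF f acd_L2[OF W(1)]] by blast
  then show "\<exists>U W Q. acd U W \<and> acd W Q \<and> (AE x in M. U x = f x)" using W by blast
next
  assume "\<exists>U W Q. acd U W \<and> acd W Q \<and> (AE x in M. U x = f x)"
  then obtain U W Q where *: "acd U W" "acd W Q" "AE x in M. U x = f x" by blast
  note w = weak_derivs_of_acd[OF *(1,3)]
  have "\<exists>g\<in>L2 \<Omega>. has_weak_deriv \<Omega> j f g" if "j \<le> 2" for j
  proof -
    have "j = 0 \<or> j = 1 \<or> j = 2" using that by auto
    then show ?thesis using w(2,3) w(4)[OF *(2)] acd_L2 acdD(1) * by blast
  qed
  then show "f \<in> Hs \<Omega> 2" using w(1) by (simp add: Hs_def)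
qed

lemma Hs_3_iff: "f \<in> Hs \<Omega> 3 \<longleftrightarrow> (\<exists>U W Q P. acd U W \<and> acd W Q \<and> acd Q P \<and> (AE x in M. U x = f x))"
proof
  assume f3: "f \<in> Hs \<Omega> 3"
  then have "f \<in> Hs \<Omega> 2" by (auto simp: Hs_def)
  then obtain U W Q where *: "acd U W" "acd W Q" "AE x in M. U x = f x" by (auto simp: Hs_2_iff)
  note w = weak_derivs_of_acd[OF *(1,3)]
  obtain g3 where g3: "g3 \<in> L2 \<Omega>" "has_weak_deriv \<Omega> 3 f g3" using f3 by (auto simp: Hs_def)
  have "has_weak_deriv \<Omega> 1 Q g3"
    by (rule has_weak_deriv_of_Suc[OF w(4)[OF *(2)]]) (use g3(2) in \<open>simp add: numeral_3_eq_3 numeral_2_eq_2\<close>)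
  then obtain Q' where Q': "acd Q' g3" "AE x in M. Q' x = Q x" using weak_deriv_acd[OF acdD(1)[OF *(2)] g3(1)] by blast
  \<comment> \<open>The derivative in \<open>acd\<close> matters only up to null sets, so the
    absolutely continuous representative may replace Q.\<close>
  have "acd W Q'" by (rule acd_cong[OF *(2)]) (use Q'(2) in \<open>auto elim: eventually_mono\<close>)
  then show "\<exists>U W Q P. acd U W \<and> acd W Q \<and> acd Q P \<and> (AE x in M. U x = f x)" using * Q'(1) by blast
next
  assume "\<exists>U W Q P. acd U W \<and> acd W Q \<and> acd Q P \<and> (AE x in M. U x = f x)"
  then obtain U W Q P where *: "acd U W" "acd W Q" "AE x in M. U x = f x" "acd Q P" by blast
  note w = weak_derivs_of_acd[OF *(1,3)]
  have "\<exists>g\<in>L2 \<Omega>. has_weak_deriv \<Omega> j f g" if "j \<le> 3" for j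
  proof -
    have "j = 0 \<or> j = 1 \<or> j = 2 \<or> j = 3" using that by auto
    then show ?thesis using w(2,3) w(4)[OF *(2)] w(5)[OF *(2,4)] acd_L2 acdD(1) * by blast
  qed
  then show "f \<in> Hs \<Omega> 3" using w(1) by (simp add: Hs_def)
qed

lemma Hs_norm_2:
  assumes "acd U W" "acd W Q" "AE x in M. U x = f x"
  shows "(Hs_norm \<Omega> 2 f)\<^sup>2 = (norm (emb U))\<^sup>2 + (norm (emb W))\<^sup>2 + (norm (emb Q))\<^sup>2"
proof -
  note w = weak_derivs_of_acd[OF assms(1,3)]
  have "Hs_norm \<Omega> 2 f = sqrt ((L2_norm \<Omega> (wderiv \<Omega> 0 f))\<^sup>2 + (L2_norm \<Omega> (wderiv \<Omega> 1 f))\<^sup>2 + (L2_norm \<Omega> (wderiv \<Omega> 2 f))\<^sup>2)"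
    unfolding Hs_norm_def by (simp add: numeral_2_eq_2)
  then show ?thesis
    using L2_norm_wderiv[OF w(2) acd_L2[OF assms(1)]] L2_norm_wderiv[OF w(3) acd_L2[OF assms(2)]]
      L2_norm_wderiv[OF w(4)[OF assms(2)] acdD(1)[OF assms(2)]] by simp
qed

lemma Hs_norm_3:
  assumes "acd U W" "acd W Q" "acd Q P" "AE x in M. U x = f x"
  shows "(Hs_norm \<Omega> 3 f)\<^sup>2 = (norm (emb U))\<^sup>2 + (norm (emb W))\<^sup>2 + (norm (emb Q))\<^sup>2 + (norm (emb P))\<^sup>2"
proof -
  note w = weak_derivs_of_acd[OF assms(1,4)]
  have "Hs_norm \<Omega> 3 f = sqrt ((L2_norm \<Omega> (wderiv \<Omega> 0 f))\<^sup>2 + (L2_norm \<Omega> (wderiv \<Omega> 1 f))\<^sup>2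
     + (L2_norm \<Omega> (wderiv \<Omega> 2 f))\<^sup>2 + (L2_norm \<Omega> (wderiv \<Omega> 3 f))\<^sup>2)"
    unfolding Hs_norm_def by (simp add: numeral_2_eq_2 numeral_3_eq_3)
  then show ?thesis
    using L2_norm_wderiv[OF w(2) acd_L2[OF assms(1)]] L2_norm_wderiv[OF w(3) acd_L2[OF assms(2)]]
      L2_norm_wderiv[OF w(4)[OF assms(2)] acdD(1)[OF assms(2)]]
      L2_norm_wderiv[OF w(5)[OF assms(2,3)] acdD(1)[OF assms(3)]] by simp
qed

section \<open>Continuous representatives and time derivatives\<close>

lemma AE_zero_continuous:
  assumes h: "continuous_on {-a..a} (h :: real \<Rightarrow> complex)" and ae: "AE x in M. h x = 0" and x: "x \<in> {-a..a}"
  shows "h x = 0"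
proof -
  have h\<Omega>: "continuous_on \<Omega> h" by (rule continuous_on_subset[OF h]) auto
  have "open (\<Omega> \<inter> h -` (- {0}))" by (rule continuous_open_preimage[OF h\<Omega>]) auto
  also have "\<Omega> \<inter> h -` (- {0}) = {x \<in> \<Omega>. h x \<noteq> 0}" by auto
  finally have op: "open {x \<in> \<Omega>. h x \<noteq> 0}" .
  have "{x \<in> \<Omega>. h x \<noteq> 0} \<in> null_sets lebesgue"
  proof -
    have "AE x in lebesgue. x \<notin> {x \<in> \<Omega>. h x \<noteq> 0}" using ae unfolding AE_M_iff by (auto elim: eventually_mono)
    moreover have "{x \<in> \<Omega>. h x \<noteq> 0} \<in> sets lebesgue" using op by simp
    ultimately show ?thesis using AE_iff_null_sets by blast
  qed
  then have "negligible {x \<in> \<Omega>. h x \<noteq> 0}" by (simp add: negligible_iff_null_sets)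
  then have "{x \<in> \<Omega>. h x \<noteq> 0} = {}" using open_not_negligible[OF op] by blast
  then have z: "\<And>x. x \<in> \<Omega> \<Longrightarrow> h x = 0" by auto
  have cl: "closure \<Omega> = {-a..a}" using a_pos by simp
  show ?thesis
    by (rule continuous_constant_on_closure[of \<Omega> h]) (use h z x cl in auto)
qed

text \<open>For the uniqueness behind \<open>THE\<close>: continuous functions equal almost
  everywhere agree up to the boundary, and the value 0 elsewhere fixes the rest.\<close>

lemma cont_rep_eq:
  assumes F: "continuous_on {-a..a} F" and ae: "AE x in M. F x = f x" and x: "x \<in> {-a..a}"
  shows "cont_rep \<Omega> f x = F x"
proof -
  have cl: "closure \<Omega> = {-a..a}" using a_pos by simp
  define h where "h = (\<lambda>x. if x \<in> {-a..a} then F x else 0)"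
  have "cont_rep \<Omega> f = h"
    unfolding cont_rep_def cl
  proof (rule the_equality, intro conjI allI impI)
    show "continuous_on {-a..a} h" by (rule continuous_on_eq[OF F]) (simp add: h_def)
    show "AE x in M. h x = f x" using ae by (rule AE_M_mono) (auto simp: h_def)
    show "\<And>x. x \<notin> {-a..a} \<Longrightarrow> h x = 0" by (auto simp: h_def)
    fix k assume k: "continuous_on {-a..a} k \<and> (AE x in M. k x = f x) \<and> (\<forall>x. x \<notin> {-a..a} \<longrightarrow> k x = 0)"
    have "AE x in M. k x - F x = 0" using ae k by (auto elim: eventually_elim2)
    then have "k x - F x = 0" if "x \<in> {-a..a}" for x
      using AE_zero_continuous[of "\<lambda>x. k x - F x"] k F that continuous_on_diff by blast
    then show "k = h" using k by (auto simp: h_def fun_eq_iff)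
  qed
  then show ?thesis using x by (simp add: h_def)
qed

lemma dx_eq:
  assumes "acd U W" "acd W Q" "AE x in M. U x = f x" "x \<in> {-a..a}"
  shows "dx \<Omega> f x = W x"
  unfolding dx_def
proof (rule cont_rep_eq[OF acd_continuous[OF assms(2)] _ assms(4)])
  show "AE x in M. W x = wderiv \<Omega> 1 f x"
    using AE_wderiv[OF weak_derivs_of_acd(3)[OF assms(1,3)]] by (auto elim: eventually_mono)
qed

lemma has_vector_derivative_iff_quotient:
  "(f has_vector_derivative f') (at t) \<longleftrightarrow> ((\<lambda>s. norm ((f s - f t) /\<^sub>R (s - t) - f')) \<longlongrightarrow> 0) (at t)"
  for f :: "real \<Rightarrow> 'a::real_normed_vector"
proof -
  have "\<forall>\<^sub>F s in at t. norm ((f s - f t) /\<^sub>R (s - t) - f') = norm (f s - f t - (s - t) *\<^sub>R f') / norm (s - t)"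
    unfolding eventually_at_filter
  proof (intro always_eventually allI impI)
    fix s assume "s \<noteq> t"
    then have "(f s - f t) /\<^sub>R (s - t) - f' = (f s - f t - (s - t) *\<^sub>R f') /\<^sub>R (s - t)"
      by (simp add: scaleR_diff_right)
    then show "norm ((f s - f t) /\<^sub>R (s - t) - f') = norm (f s - f t - (s - t) *\<^sub>R f') / norm (s - t)"
      by (simp add: divide_inverse_commute)
  qed
  from tendsto_cong[OF this] show ?thesis
    by (simp add: has_vector_derivative_def has_derivative_iff_norm bounded_linear_scaleR_left)
qed

text \<open>Replaces quotients of functions by differentiability of a curve in \<open>l2\<close>,
  where the product and chain rules are available.\<close>

lemma has_L2_time_deriv_iff:
  assumes "\<And>s. U s \<in> L2 \<Omega>" "\<And>s. AE x in M. U s x = u s x" "v \<in> L2 \<Omega>"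
  shows "has_L2_time_deriv \<Omega> u t v \<longleftrightarrow> ((\<lambda>s. emb (U s)) has_vector_derivative emb v) (at t)"
proof -
  have "L2_norm \<Omega> (\<lambda>x. (u s x - u t x) / complex_of_real (s - t) - v x) = norm ((emb (U s) - emb (U t)) /\<^sub>R (s - t) - emb v)" for s
  proof -
    have L: "(\<lambda>x. inverse (s - t) *\<^sub>R (U s x - U t x) - v x) \<in> L2 \<Omega>"
      by (intro L2_diff L2_scaleR assms)
    have "AE x in M. inverse (s - t) *\<^sub>R (U s x - U t x) - v x = (u s x - u t x) / complex_of_real (s - t) - v x"
      using assms(2)[of s] assms(2)[of t]
      by eventually_elim (simp add: scaleR_conv_of_real divide_inverse mult.commute)
    from emb_cong_AE[OF L this] L2_cong_AE[OF L this]
    have "L2_norm \<Omega> (\<lambda>x. (u s x - u t x) / complex_of_real (s - t) - v x) = norm (emb (\<lambda>x. inverse (s - t) *\<^sub>R (U s x - U t x) - v x))"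
      by (simp add: norm_emb)
    also have "\<dots> = norm ((emb (U s) - emb (U t)) /\<^sub>R (s - t) - emb v)"
      by (simp add: emb_diff emb_scaleR L2_diff L2_scaleR assms)
    finally show ?thesis .
  qed
  then show ?thesis
    unfolding has_L2_time_deriv_def has_vector_derivative_iff_quotient using assms(3) by simp
qed

end

section \<open>Gronwall's inequality and the logarithmic nonlinearity\<close>

text \<open>Gronwall for sqrt p, so that a source C enters linearly. Since sqrt p need not be
  differentiable where p vanishes, p is shifted by a small \<open>\<eta>\<close>.\<close>

lemma gronwall_sqrt:
  fixes p p' :: "real \<Rightarrow> real"
  assumes "t0 \<le> t1" and L: "0 \<le> L" and C: "0 \<le> C"
    and p: "\<And>t. t \<in> {t0..t1} \<Longrightarrow> 0 \<le> p t"
    and der: "\<And>t. t \<in> {t0..t1} \<Longrightarrow> (p has_real_derivative p' t) (at t)"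
    and bound: "\<And>t. t \<in> {t0..t1} \<Longrightarrow> p' t \<le> 2 * L * p t + 2 * C * sqrt (p t)"
  shows "sqrt (p t1) \<le> exp (L * (t1 - t0)) * (sqrt (p t0) + C * (t1 - t0))"
proof (rule field_le_epsilon)
  fix e :: real assume "e > 0"
  define E where "E = exp (L * (t1 - t0))"
  have E: "E > 0" by (simp add: E_def)
  \<comment> \<open>Chosen with sqrt \<open>\<eta>\<close> = e / E, so that the error is exactly e
    after multiplication by the growth factor E.\<close>
  define \<eta> where "\<eta> = (e / E)\<^sup>2"
  have \<eta>: "\<eta> > 0" "sqrt \<eta> = e / E" using \<open>e > 0\<close> E by (auto simp: \<eta>_def)
  \<comment> \<open>The integrating factor removes the growth term and the linear term absorbs the
    source, so that q is nonincreasing.\<close>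
  define q where "q = (\<lambda>t. sqrt (p t + \<eta>) * exp (- (L * (t - t0))) - C * (t - t0))"
  have "q t1 \<le> q t0"
  proof (rule DERIV_nonpos_imp_nonincreasing[OF \<open>t0 \<le> t1\<close>])
    fix t assume t: "t0 \<le> t" "t \<le> t1"
    define s where "s = sqrt (p t + \<eta>)"
    define x where "x = exp (- (L * (t - t0)))"
    have s: "s > 0" "s\<^sup>2 = p t + \<eta>" using p[of t] t \<eta> by (auto simp: s_def add_nonneg_pos)
    have x: "0 < x" "x \<le> 1" using L t by (auto simp: x_def)
    have dp: "((\<lambda>t. p t + \<eta>) has_real_derivative p' t) (at t)"
      using DERIV_add[OF der[of t] DERIV_const[of \<eta>]] t by simp
    have "((\<lambda>t. sqrt (p t + \<eta>)) has_real_derivative (inverse s / 2) * p' t) (at t)"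
      unfolding s_def by (rule DERIV_chain2[OF DERIV_real_sqrt dp]) (use s in \<open>simp add: s_def\<close>)
    moreover have "((\<lambda>t. exp (- (L * (t - t0)))) has_real_derivative x * (- L)) (at t)"
      unfolding x_def by (auto intro!: derivative_eq_intros)
    ultimately have "((\<lambda>t. sqrt (p t + \<eta>) * exp (- (L * (t - t0)))) has_real_derivative
        (inverse s / 2) * p' t * x + x * (- L) * s) (at t)"
      unfolding s_def x_def by (rule DERIV_mult)
    moreover have "((\<lambda>t. C * (t - t0)) has_real_derivative C) (at t)"
      by (auto intro!: derivative_eq_intros)
    ultimately have "(q has_real_derivative (inverse s / 2) * p' t * x + x * (- L) * s - C) (at t)"
      unfolding q_def by (rule DERIV_diff)
    then have der_q: "(q has_real_derivative (p' t * (inverse s / 2)) * x - s * (L * x) - C) (at t)"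
      by (rule DERIV_cong) (simp add: algebra_simps)
    have "sqrt (p t) \<le> s" using \<eta> by (simp add: s_def)
    then have "2 * C * sqrt (p t) \<le> 2 * C * s" using C by (intro mult_left_mono) auto
    moreover have "2 * L * p t \<le> 2 * L * s\<^sup>2" using L \<eta> s(2) by (intro mult_left_mono) auto
    ultimately have "p' t \<le> 2 * L * s\<^sup>2 + 2 * C * s" using bound[of t] t by simp
    then have "p' t * (inverse s / 2) \<le> (2 * L * s\<^sup>2 + 2 * C * s) * (inverse s / 2)"
      using s by (intro mult_right_mono) auto
    also have "\<dots> = L * s + C" using s(1) by (simp add: field_simps power2_eq_square)
    finally have "p' t * (inverse s / 2) * x \<le> (L * s + C) * x" using x by (intro mult_right_mono) auto
    moreover have "C * x \<le> C" using x C by (simp add: mult_left_le)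
    ultimately have "(p' t * (inverse s / 2)) * x - s * (L * x) - C \<le> 0" by (simp add: algebra_simps)
    then show "\<exists>y. (q has_real_derivative y) (at t) \<and> y \<le> 0" using der_q by blast
  qed
  then have "sqrt (p t1 + \<eta>) * inverse E \<le> sqrt (p t0 + \<eta>) + C * (t1 - t0)"
    by (simp add: q_def E_def exp_minus)
  then have "sqrt (p t1 + \<eta>) \<le> E * (sqrt (p t0 + \<eta>) + C * (t1 - t0))"
    using E by (simp add: field_simps)
  also have "\<dots> \<le> E * (sqrt (p t0) + sqrt \<eta> + C * (t1 - t0))"
    using E p[of t0] \<eta> \<open>t0 \<le> t1\<close> sqrt_add_le_add_sqrt[of "p t0" \<eta>] by (intro mult_left_mono) auto
  also have "\<dots> = E * (sqrt (p t0) + C * (t1 - t0)) + e"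
    using E by (simp add: \<eta>(2) field_simps)
  finally have "sqrt (p t1 + \<eta>) \<le> E * (sqrt (p t0) + C * (t1 - t0)) + e" .
  moreover have "sqrt (p t1) \<le> sqrt (p t1 + \<eta>)" using \<eta> by simp
  ultimately have "sqrt (p t1) \<le> E * (sqrt (p t0) + C * (t1 - t0)) + e" by linarith
  then show "sqrt (p t1) \<le> exp (L * (t1 - t0)) * (sqrt (p t0) + C * (t1 - t0)) + e"
    unfolding E_def .
qed

text \<open>Time reversal gives the estimate backwards as well; a two-sided bound is what later
  yields continuity of a norm in time.\<close>

lemma gronwall_sqrt_abs:
  fixes p p' :: "real \<Rightarrow> real"
  assumes L: "0 \<le> L" and C: "0 \<le> C" and t: "t0 \<in> I" "t1 \<in> I" and I: "is_interval I"
    and p: "\<And>t. t \<in> I \<Longrightarrow> 0 \<le> p t"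
    and der: "\<And>t. t \<in> I \<Longrightarrow> (p has_real_derivative p' t) (at t)"
    and bound: "\<And>t. t \<in> I \<Longrightarrow> \<bar>p' t\<bar> \<le> 2 * L * p t + 2 * C * sqrt (p t)"
  shows "sqrt (p t1) \<le> exp (L * \<bar>t1 - t0\<bar>) * (sqrt (p t0) + C * \<bar>t1 - t0\<bar>)"
proof (cases "t0 \<le> t1")
  case True
  have sub: "s \<in> I" if "s \<in> {t0..t1}" for s
    using mem_is_interval_1_I[OF I t, of s] that by simp
  have "sqrt (p t1) \<le> exp (L * (t1 - t0)) * (sqrt (p t0) + C * (t1 - t0))"
  proof (rule gronwall_sqrt[OF True L C])
    fix s assume "s \<in> {t0..t1}"
    then have s: "s \<in> I" by (rule sub)
    show "0 \<le> p s" "(p has_real_derivative p' s) (at s)" using p der s by auto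
    show "p' s \<le> 2 * L * p s + 2 * C * sqrt (p s)" using bound[OF s] by linarith
  qed
  then show ?thesis using True by simp
next
  case False
  have sub: "- s \<in> I" if "s \<in> {-t0..-t1}" for s
    using mem_is_interval_1_I[OF I t(2,1), of "- s"] that by simp
  have "sqrt (p (- (- t1))) \<le> exp (L * (- t1 - (- t0))) * (sqrt (p (- (- t0))) + C * (- t1 - (- t0)))"
  proof (rule gronwall_sqrt[where p = "\<lambda>s. p (- s)" and p' = "\<lambda>s. - p' (- s)", OF _ L C])
    fix s assume s: "s \<in> {-t0..-t1}"
    show "0 \<le> p (- s)" using p sub s by blast
    show "((\<lambda>s. p (- s)) has_real_derivative - p' (- s)) (at s)"
      using DERIV_chain2[OF der[OF sub[OF s]] DERIV_minus[OF DERIV_ident]] by simp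
    show "- p' (- s) \<le> 2 * L * p (- s) + 2 * C * sqrt (p (- s))"
      using bound[OF sub[OF s]] by linarith
  qed (use False in auto)
  then show ?thesis using False by simp
qed

section \<open>The nonlinearity z log |z|^2 and its derivative\<close>

lemma zlog_scaleR: "zlog z = ln ((cmod z)\<^sup>2) *\<^sub>R z"
  by (simp add: zlog_def scaleR_conv_of_real mult.commute)

lemma zlog_minus: "zlog (- z) = - zlog z"
  by (simp add: zlog_def)

lemma zlog_zero: "zlog 0 = 0"
  by (simp add: zlog_def)

text \<open>Im(z cnj w) equals Im((z - w) cnj w) and so carries a factor |w|, which cancels the
  1/|w| in ln(|z| / |w|) <= |z - w| / |w|.\<close>

lemma Im_mult_cnj_ln_le:
  fixes z w :: complex
  assumes "w \<noteq> 0" "cmod w \<le> cmod z"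
  shows "\<bar>ln ((cmod z)\<^sup>2) - ln ((cmod w)\<^sup>2)\<bar> * \<bar>Im (z * cnj w)\<bar> \<le> 2 * (cmod (z - w))\<^sup>2"
proof -
  have pos: "0 < cmod w" "0 < cmod z" using assms by auto
  have "ln (cmod z / cmod w) \<le> cmod z / cmod w - 1" using pos by (intro ln_le_minus_one) auto
  also have "\<dots> = (cmod z - cmod w) / cmod w" using pos by (simp add: field_simps)
  also have "\<dots> \<le> cmod (z - w) / cmod w"
    using norm_triangle_ineq2[of z w] pos by (intro divide_right_mono) auto
  finally have 1: "ln (cmod z) - ln (cmod w) \<le> cmod (z - w) / cmod w" using pos by (simp add: ln_div)
  have 2: "0 \<le> ln (cmod z) - ln (cmod w)" using pos assms by simp
  have "Im (z * cnj w) = Im ((z - w) * cnj w)" by (simp add: algebra_simps)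
  then have 3: "\<bar>Im (z * cnj w)\<bar> \<le> cmod (z - w) * cmod w"
    using abs_Im_le_cmod[of "(z - w) * cnj w"] by (simp add: norm_mult)
  have "\<bar>ln ((cmod z)\<^sup>2) - ln ((cmod w)\<^sup>2)\<bar> = 2 * (ln (cmod z) - ln (cmod w))"
    using 2 pos by (simp add: ln_realpow)
  then have "\<bar>ln ((cmod z)\<^sup>2) - ln ((cmod w)\<^sup>2)\<bar> * \<bar>Im (z * cnj w)\<bar>
      \<le> (2 * (cmod (z - w) / cmod w)) * (cmod (z - w) * cmod w)"
    using 1 2 3 pos by (intro mult_mono) auto
  also have "\<dots> = 2 * (cmod (z - w))\<^sup>2" using pos by (simp add: power2_eq_square)
  finally show ?thesis .
qed

text \<open>The inequality of Cazenave and Haraux, which makes the \<open>L\<^sup>2\<close> flow Lipschitz although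
  \<^const>\<open>zlog\<close> is not.\<close>

lemma zlog_monotone:
  "\<bar>(\<i> * (zlog z - zlog w)) \<bullet> (z - w)\<bar> \<le> 2 * (cmod (z - w))\<^sup>2"
proof -
  have "(\<i> * (zlog z - zlog w)) \<bullet> (z - w) = (ln ((cmod z)\<^sup>2) - ln ((cmod w)\<^sup>2)) * Im (z * cnj w)"
  proof -
    have "(\<i> * (z * complex_of_real s - w * complex_of_real t)) \<bullet> (z - w) = (s - t) * Im (z * cnj w)" for s t
      by (simp add: inner_complex_def algebra_simps)
    then show ?thesis by (simp only: zlog_def)
  qed
  then have eq: "\<bar>(\<i> * (zlog z - zlog w)) \<bullet> (z - w)\<bar> = \<bar>ln ((cmod z)\<^sup>2) - ln ((cmod w)\<^sup>2)\<bar> * \<bar>Im (z * cnj w)\<bar>"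
    by (simp add: abs_mult)
  \<comment> \<open>If z or w is 0, the factor Im(z cnj w) vanishes, whatever value
    \<open>ln\<close> takes at 0.\<close>
  consider "z = 0 \<or> w = 0" | "w \<noteq> 0" "cmod w \<le> cmod z" | "z \<noteq> 0" "cmod z \<le> cmod w" by linarith
  then show ?thesis
  proof cases
    case 1 then show ?thesis unfolding eq by auto
  next
    case 2 then show ?thesis unfolding eq by (rule Im_mult_cnj_ln_le)
  next
    case 3
    have "Im (w * cnj z) = - Im (z * cnj w)" by (simp add: algebra_simps)
    then have "\<bar>Im (z * cnj w)\<bar> = \<bar>Im (w * cnj z)\<bar>" by linarith
    then show ?thesis
      using Im_mult_cnj_ln_le[OF 3]
      unfolding eq abs_minus_commute[of "ln ((cmod z)\<^sup>2)"] norm_minus_commute[of z w] by (simp only:)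
  qed
qed

lemma isCont_zlog: "isCont zlog z"
proof (cases "z = 0")
  case True
  have "((\<lambda>r::real. r * ln (r\<^sup>2)) \<longlongrightarrow> 0) (at_right 0)" by real_asymp
  then have "((\<lambda>w. cmod w * ln ((cmod w)\<^sup>2)) \<longlongrightarrow> 0) (at 0)"
    by (rule filterlim_compose) (auto simp: filterlim_at eventually_at_filter intro!: tendsto_norm_zero)
  then have "((\<lambda>w. norm (cmod w * ln ((cmod w)\<^sup>2))) \<longlongrightarrow> 0) (at 0)" by (rule tendsto_norm_zero)
  moreover have "(\<lambda>w. norm (cmod w * ln ((cmod w)\<^sup>2))) = (\<lambda>w. norm (zlog w))"
    by (auto simp: zlog_def norm_mult abs_mult)
  ultimately have "(zlog \<longlongrightarrow> 0) (at 0)" by (simp add: tendsto_norm_zero_iff)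
  then show ?thesis using True by (simp add: isCont_def zlog_zero)
next
  case False
  then show ?thesis unfolding zlog_def[abs_def] by (intro continuous_intros) auto
qed

text \<open>The derivative of \<^const>\<open>zlog\<close> at \<open>v \<noteq> 0\<close> in direction \<open>w\<close>.\<close>

definition dzlog :: "complex \<Rightarrow> complex \<Rightarrow> complex" where
  "dzlog v w = ln ((cmod v)\<^sup>2) *\<^sub>R w + (2 * (sgn v \<bullet> w)) *\<^sub>R sgn v"

lemma zlog_has_vector_derivative:
  assumes "(U has_vector_derivative w) (at x)" "U x \<noteq> 0"
  shows "((\<lambda>x. zlog (U x)) has_vector_derivative dzlog (U x) w) (at x)"
proof -
  have "((\<lambda>x. U x \<bullet> U x) has_vector_derivative (2 * (U x \<bullet> w))) (at x)"
    using bounded_bilinear.has_vector_derivative[OF bounded_bilinear_inner assms(1) assms(1)] by (simp add: inner_commute)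
  then have 1: "((\<lambda>x. U x \<bullet> U x) has_real_derivative (2 * (U x \<bullet> w))) (at x)"
    by (simp add: has_real_derivative_iff_has_vector_derivative)
  have "((\<lambda>x. ln (U x \<bullet> U x)) has_real_derivative (2 * (U x \<bullet> w)) / (U x \<bullet> U x)) (at x)"
    by (rule DERIV_cong[OF DERIV_chain2[OF DERIV_ln 1]]) (use assms(2) in \<open>auto simp: field_simps\<close>)
  then have "((\<lambda>x. ln (U x \<bullet> U x) *\<^sub>R U x) has_vector_derivative
      ln (U x \<bullet> U x) *\<^sub>R w + ((2 * (U x \<bullet> w)) / (U x \<bullet> U x)) *\<^sub>R U x) (at x)"
    by (rule has_vector_derivative_scaleR[OF _ assms(1)])
  moreover have "((2 * (U x \<bullet> w)) / (U x \<bullet> U x)) *\<^sub>R U x = (2 * (sgn (U x) \<bullet> w)) *\<^sub>R sgn (U x)"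
    by (simp add: sgn_div_norm power2_norm_eq_inner[symmetric] power2_eq_square divide_inverse mult_ac)
  ultimately show ?thesis
    by (simp add: zlog_scaleR[abs_def] dzlog_def power2_norm_eq_inner)
qed

text \<open>For U = x V this splits off the singularity at the origin as a real multiple of w. The
  directional part is invariant because the sign of x enters twice.\<close>

lemma dzlog_scaleR:
  assumes "x \<noteq> 0" "v \<noteq> 0" shows "dzlog (x *\<^sub>R v) w = ln (x\<^sup>2) *\<^sub>R w + dzlog v w"
proof -
  have "ln ((cmod (x *\<^sub>R v))\<^sup>2) = ln (x\<^sup>2) + ln ((cmod v)\<^sup>2)"
    using assms by (simp add: power_mult_distrib ln_mult)
  moreover have "sgn x * sgn x = 1" using assms(1) by (simp add: sgn_real_def)
  then have "(2 * (sgn (x *\<^sub>R v) \<bullet> w)) *\<^sub>R sgn (x *\<^sub>R v) = (2 * (sgn v \<bullet> w)) *\<^sub>R sgn v"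
    by (simp add: sgn_scaleR mult.assoc mult.left_commute)
  ultimately show ?thesis by (simp add: dzlog_def scaleR_add_left)
qed

lemma norm_sgn_diff_le:
  fixes v w :: "'a :: real_normed_vector"
  assumes "0 < d" "d \<le> norm v" "d \<le> norm w"
  shows "norm (sgn v - sgn w) \<le> 2 / d * norm (v - w)"
proof -
  have pos: "0 < norm v" "0 < norm w" using assms by linarith+
  have "sgn v - sgn w = (v - w) /\<^sub>R norm v + (inverse (norm v) - inverse (norm w)) *\<^sub>R w"
    by (simp add: sgn_div_norm algebra_simps)
  then have "norm (sgn v - sgn w) \<le> norm ((v - w) /\<^sub>R norm v) + norm ((inverse (norm v) - inverse (norm w)) *\<^sub>R w)"
    by (simp only: norm_triangle_ineq)
  also have "norm ((inverse (norm v) - inverse (norm w)) *\<^sub>R w) = \<bar>norm w - norm v\<bar> / norm v"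
  proof -
    have "inverse (norm v) - inverse (norm w) = (norm w - norm v) / (norm v * norm w)"
      using pos by (simp add: field_simps)
    then show ?thesis using pos by (simp add: abs_mult abs_divide)
  qed
  also have "\<dots> \<le> norm (v - w) / norm v"
    using norm_triangle_ineq3[of w v] pos by (intro divide_right_mono) (auto simp: norm_minus_commute)
  also have "norm ((v - w) /\<^sub>R norm v) = norm (v - w) / norm v" by (simp add: divide_inverse_commute)
  finally have "norm (sgn v - sgn w) \<le> 2 * (norm (v - w) / norm v)" by simp
  also have "\<dots> \<le> 2 * (norm (v - w) / d)" using assms pos by (intro mult_left_mono divide_left_mono) auto
  finally show ?thesis by simp
qed

lemma ln_diff_le:
  fixes s t d :: real
  assumes "0 < d" "d \<le> s" "d \<le> t" shows "\<bar>ln s - ln t\<bar> \<le> \<bar>s - t\<bar> / d"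
proof -
  have *: "ln s - ln t \<le> \<bar>s - t\<bar> / d" if "d \<le> s" "d \<le> t" for s t
  proof -
    have "ln s - ln t = ln (s / t)" using that assms by (simp add: ln_div)
    also have "\<dots> \<le> s / t - 1" using that assms by (intro ln_le_minus_one) auto
    also have "\<dots> = (s - t) / t" using that assms by (simp add: field_simps)
    also have "\<dots> \<le> \<bar>s - t\<bar> / t" using that assms by (intro divide_right_mono) auto
    also have "\<dots> \<le> \<bar>s - t\<bar> / d" using that assms by (intro divide_left_mono) auto
    finally show ?thesis .
  qed
  show ?thesis using *[of s t] *[of t s] assms by (auto simp: abs_le_iff abs_minus_commute)
qed

text \<open>The lower bound d makes the logarithm and \<open>sgn\<close> Lipschitz; the upper bound
  controls the coefficients they multiply. The difference is telescoped into five terms, each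
  changing one factor.\<close>

lemma dzlog_lipschitz:
  assumes d: "0 < d"
  obtains K where "0 \<le> K"
    "\<And>v1 v2 w1 w2. \<lbrakk>d \<le> cmod v1; d \<le> cmod v2; cmod v1 \<le> B; cmod v2 \<le> B; cmod w1 \<le> B; cmod w2 \<le> B\<rbrakk> \<Longrightarrow>
      cmod (dzlog v1 w1 - dzlog v2 w2) \<le> K * (cmod (v1 - v2) + cmod (w1 - w2))"
proof -
  \<comment> \<open>Bounds |ln |v|^2| for d <= |v| <= B.\<close>
  define \<Lambda> where "\<Lambda> = 2 * (\<bar>ln d\<bar> + \<bar>ln B\<bar>)"
  \<comment> \<open>The five terms add up to (\<open>\<Lambda>\<close> + 2) |w1 - w2| and (2 + 4 +
    4) B/d |v1 - v2|. Absolute values keep K nonnegative for every B.\<close>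
  define K where "K = \<Lambda> + 2 * \<bar>B\<bar> / d + 8 * \<bar>B\<bar> / d + 2"
  have K0: "0 \<le> K" using d by (simp add: K_def \<Lambda>_def)
  show ?thesis
  proof (rule that[OF K0])
    fix v1 v2 w1 w2
    assume *: "d \<le> cmod v1" "d \<le> cmod v2" "cmod v1 \<le> B" "cmod v2 \<le> B" "cmod w1 \<le> B" "cmod w2 \<le> B"
    have B: "0 < B" using * d by linarith
    define D E where "D = cmod (v1 - v2)" and "E = cmod (w1 - w2)"
    have DE: "0 \<le> D" "0 \<le> E" by (auto simp: D_def E_def)
    have ln2: "ln ((cmod v)\<^sup>2) = 2 * ln (cmod v)" if "d \<le> cmod v" for v
      using that d by (simp add: ln_realpow)
    have ln1: "\<bar>ln ((cmod v1)\<^sup>2)\<bar> \<le> \<Lambda>"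
    proof -
      have "0 < cmod v1" using * d by linarith
      then have "ln d \<le> ln (cmod v1)" "ln (cmod v1) \<le> ln B" using * d B by auto
      then have "\<bar>ln (cmod v1)\<bar> \<le> \<bar>ln d\<bar> + \<bar>ln B\<bar>" by linarith
      then show ?thesis unfolding ln2[OF *(1)] \<Lambda>_def by (simp add: abs_mult)
    qed
    have lnd: "\<bar>ln ((cmod v1)\<^sup>2) - ln ((cmod v2)\<^sup>2)\<bar> \<le> 2 * D / d"
    proof -
      have "\<bar>ln (cmod v1) - ln (cmod v2)\<bar> \<le> \<bar>cmod v1 - cmod v2\<bar> / d" by (rule ln_diff_le[OF d *(1,2)])
      also have "\<dots> \<le> D / d" unfolding D_def using d norm_triangle_ineq3 by (intro divide_right_mono) auto
      finally have "2 * \<bar>ln (cmod v1) - ln (cmod v2)\<bar> \<le> 2 * (D / d)" by simp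
      then show ?thesis unfolding ln2[OF *(1)] ln2[OF *(2)] by (simp add: abs_if split: if_splits)
    qed
    have sg: "cmod (sgn v1 - sgn v2) \<le> 2 / d * D" unfolding D_def by (rule norm_sgn_diff_le[OF d *(1,2)])
    have sg1: "cmod (sgn v) \<le> 1" for v :: complex by (simp add: norm_sgn)
    have "dzlog v1 w1 - dzlog v2 w2 =
        ln ((cmod v1)\<^sup>2) *\<^sub>R (w1 - w2) + (ln ((cmod v1)\<^sup>2) - ln ((cmod v2)\<^sup>2)) *\<^sub>R w2
        + (2 * (sgn v1 \<bullet> w1)) *\<^sub>R (sgn v1 - sgn v2) + (2 * ((sgn v1 - sgn v2) \<bullet> w1)) *\<^sub>R sgn v2
        + (2 * (sgn v2 \<bullet> (w1 - w2))) *\<^sub>R sgn v2"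
      unfolding dzlog_def by (simp add: algebra_simps)
    then have "cmod (dzlog v1 w1 - dzlog v2 w2) \<le>
        cmod (ln ((cmod v1)\<^sup>2) *\<^sub>R (w1 - w2)) + cmod ((ln ((cmod v1)\<^sup>2) - ln ((cmod v2)\<^sup>2)) *\<^sub>R w2)
        + cmod ((2 * (sgn v1 \<bullet> w1)) *\<^sub>R (sgn v1 - sgn v2)) + cmod ((2 * ((sgn v1 - sgn v2) \<bullet> w1)) *\<^sub>R sgn v2)
        + cmod ((2 * (sgn v2 \<bullet> (w1 - w2))) *\<^sub>R sgn v2)"
      by (simp only: norm_triangle_le add_mono norm_triangle_ineq order_refl)
    also have "\<dots> \<le> \<Lambda> * E + (2 * D / d) * B + (2 * B) * (2 / d * D) + (2 * (2 / d * D * B)) * 1 + (2 * E) * 1"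
    proof (intro add_mono)
      show "cmod (ln ((cmod v1)\<^sup>2) *\<^sub>R (w1 - w2)) \<le> \<Lambda> * E"
        using ln1 DE by (simp add: E_def mult_right_mono)
      show "cmod ((ln ((cmod v1)\<^sup>2) - ln ((cmod v2)\<^sup>2)) *\<^sub>R w2) \<le> (2 * D / d) * B"
        unfolding norm_scaleR using lnd *(6) DE d by (intro mult_mono) auto
      have 1: "\<bar>sgn v1 \<bullet> w1\<bar> \<le> B"
        using Cauchy_Schwarz_ineq2[of "sgn v1" w1] mult_mono[OF sg1[of v1] *(5)] by simp
      show "cmod ((2 * (sgn v1 \<bullet> w1)) *\<^sub>R (sgn v1 - sgn v2)) \<le> (2 * B) * (2 / d * D)"
        unfolding norm_scaleR using 1 sg by (intro mult_mono) (auto simp: abs_mult)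
      have 2: "\<bar>(sgn v1 - sgn v2) \<bullet> w1\<bar> \<le> 2 / d * D * B"
        by (rule order_trans[OF Cauchy_Schwarz_ineq2 mult_mono[OF sg *(5)]]) (use DE d in auto)
      show "cmod ((2 * ((sgn v1 - sgn v2) \<bullet> w1)) *\<^sub>R sgn v2) \<le> (2 * (2 / d * D * B)) * 1"
        unfolding norm_scaleR using 2 sg1 by (intro mult_mono) (auto simp: abs_mult)
      have 3: "\<bar>sgn v2 \<bullet> (w1 - w2)\<bar> \<le> E"
        using Cauchy_Schwarz_ineq2[of "sgn v2" "w1 - w2"] mult_right_mono[OF sg1[of v2] DE(2)] by (simp add: E_def)
      show "cmod ((2 * (sgn v2 \<bullet> (w1 - w2))) *\<^sub>R sgn v2) \<le> (2 * E) * 1"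
        unfolding norm_scaleR using 3 sg1 by (intro mult_mono) (auto simp: abs_mult)
    qed
    also have "\<dots> = (\<Lambda> + 2) * E + (10 * B / d) * D" using d by (simp add: field_simps)
    also have "\<dots> \<le> K * E + K * D"
      using DE B d by (intro add_mono mult_right_mono) (auto simp: K_def \<Lambda>_def field_simps)
    finally show "cmod (dzlog v1 w1 - dzlog v2 w2) \<le> K * (cmod (v1 - v2) + cmod (w1 - w2))"
      by (simp add: D_def E_def algebra_simps)
  qed
qed

lemma continuous_on_dzlog:
  assumes "continuous_on S v" "continuous_on S w" "\<And>x. x \<in> S \<Longrightarrow> v x \<noteq> 0"
  shows "continuous_on S (\<lambda>x. dzlog (v x) (w x))"
  unfolding dzlog_def sgn_div_norm using assms by (intro continuous_intros) auto

section \<open>Averages, Hardy's inequality and energy identities\<close>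

context symm_interval
begin

section \<open>Averages along segments and Hardy's inequality\<close>

lemma scale_mem: "x \<in> {-a..a} \<Longrightarrow> \<sigma> \<in> {0..1} \<Longrightarrow> \<sigma> * x \<in> {-a..a}"
proof -
  assume "x \<in> {-a..a}" "\<sigma> \<in> {0..1}"
  then have "\<bar>\<sigma> * x\<bar> \<le> 1 * a" unfolding abs_mult by (intro mult_mono) auto
  then show ?thesis by auto
qed

lemma continuous_on_scaled:
  assumes "continuous_on {-a..a} f" "x \<in> {-a..a}"
  shows "continuous_on {0..1} (\<lambda>\<sigma>. f (\<sigma> * x))"
  by (rule continuous_on_compose2[OF assms(1)]) (use scale_mem[OF assms(2)] in \<open>auto intro!: continuous_intros\<close>)

lemma avg_eq_integral:
  assumes "continuous_on {-a..a} f" "x \<in> {-a..a}"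
  shows "avg f x = integral {0..1} (\<lambda>\<sigma>. f (\<sigma> * x))"
  unfolding avg_def
  by (rule lebesgue_integral_eq_integral[OF continuous_imp_integrable_real[OF continuous_on_scaled[OF assms]]]) simp

lemma continuous_on_avg:
  assumes f: "continuous_on {-a..a} f" shows "continuous_on {-a..a} (avg f)"
proof (rule continuous_on_eq)
  show "continuous_on {-a..a} (\<lambda>x. integral (cbox 0 1) (\<lambda>\<sigma>. f (\<sigma> * x)))"
  proof (rule integral_continuous_on_param)
    show "continuous_on ({-a..a} \<times> cbox 0 1) (\<lambda>(x, \<sigma>). f (\<sigma> * x))"
      unfolding case_prod_beta
      by (rule continuous_on_compose2[OF f]) (use scale_mem in \<open>auto intro!: continuous_intros\<close>)
  qed
qed (simp add: avg_eq_integral[OF f])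

lemma avg_bound:
  assumes f: "continuous_on {-a..a} f" and B: "\<And>x. x \<in> {-a..a} \<Longrightarrow> cmod (f x) \<le> B" and x: "x \<in> {-a..a}"
  shows "cmod (avg f x) \<le> B"
proof -
  have "norm (integral {0..1} (\<lambda>\<sigma>. f (\<sigma> * x))) \<le> B * (1 - 0)"
    by (rule integral_bound[OF _ continuous_on_scaled[OF f x]]) (use B scale_mem[OF x] in auto)
  then show ?thesis by (simp add: avg_eq_integral[OF f x])
qed

lemma avg_diff:
  assumes "continuous_on {-a..a} f" "continuous_on {-a..a} g" "x \<in> {-a..a}"
  shows "avg (\<lambda>x. f x - g x) x = avg f x - avg g x"
  using assms
  by (simp add: avg_eq_integral continuous_on_diff integral_diff integrable_continuous_real continuous_on_scaled)

lemma acd_has_vector_derivative: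
  assumes "acd U f" "continuous_on {-a..a} f" "x \<in> {-a..a}"
  shows "(U has_vector_derivative f x) (at x within {-a..a})"
proof -
  have "((\<lambda>y. U (-a) + integral {-a..y} f) has_vector_derivative 0 + f x) (at x within {-a..a})"
    by (intro has_vector_derivative_add has_vector_derivative_const integral_has_vector_derivative assms)
  then show ?thesis
    using has_vector_derivative_transform[OF assms(3) acdD(2)[OF assms(1)]] by simp
qed

text \<open>The fundamental theorem along the segment from 0 to x factors out the zero of U at the
  origin.\<close>

lemma acd_eq_avg:
  assumes U: "acd U f" and f: "continuous_on {-a..a} f" and U0: "U 0 = 0" and x: "x \<in> {-a..a}"
  shows "U x = x *\<^sub>R avg f x"
proof -
  have "((\<lambda>\<sigma>. x *\<^sub>R f (\<sigma> * x)) has_integral (U (1 * x) - U (0 * x))) {0..1}"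
  proof (rule fundamental_theorem_of_calculus)
    fix \<sigma> :: real assume \<sigma>: "\<sigma> \<in> {0..1}"
    have 1: "((\<lambda>\<sigma>. \<sigma> * x) has_vector_derivative x) (at \<sigma> within {0..1})"
      by (auto intro!: derivative_eq_intros)
    have "(U has_vector_derivative f (\<sigma> * x)) (at (\<sigma> * x) within (\<lambda>\<sigma>. \<sigma> * x) ` {0..1})"
      by (rule has_vector_derivative_within_subset[OF acd_has_vector_derivative[OF U f scale_mem[OF x \<sigma>]]])
         (use scale_mem[OF x] in auto)
    from vector_diff_chain_within[OF 1 this]
    show "((\<lambda>\<sigma>. U (\<sigma> * x)) has_vector_derivative x *\<^sub>R f (\<sigma> * x)) (at \<sigma> within {0..1})"
      by (simp add: o_def)
  qed simp
  then have "integral {0..1} (\<lambda>\<sigma>. x *\<^sub>R f (\<sigma> * x)) = U (1 * x) - U (0 * x)" by (rule integral_unique)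
  then show ?thesis by (simp add: avg_eq_integral[OF f x] U0)
qed

lemma acd_has_vector_derivative_at:
  assumes "acd U f" "continuous_on {-a..a} f" "x \<in> \<Omega>"
  shows "(U has_vector_derivative f x) (at x)"
proof -
  have "at x within {-a..a} = at x" using assms(3) by (intro at_within_interior) (simp add: interior_atLeastAtMost_real)
  then show ?thesis using acd_has_vector_derivative[OF assms(1,2), of x] assms(3) by simp
qed

text \<open>With y = U/x, the function x |y|^2 = |U|^2 / x has derivative 2 Re(y cnj f) - |y|^2 and
  nonnegative boundary contributions. Integrating gives |y|^2 <= 2 (y, f) in L2, and Cauchy-Schwarz
  the constant 2.\<close>

lemma hardy:
  assumes f: "continuous_on {-a..a} f"
  shows "norm (emb (avg f)) \<le> 2 * norm (emb f)"
proof -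
  define U where "U = (\<lambda>x. - integral {-a..0} f + integral {-a..x} f)"
  define y where "y = avg f"
  have U: "acd U f" unfolding U_def by (rule acd_primitive[OF continuous_L2[OF f]])
  have Uy: "U x = x *\<^sub>R y x" if "x \<in> {-a..a}" for x
    unfolding y_def by (rule acd_eq_avg[OF U f _ that]) (simp add: U_def)
  have y: "continuous_on {-a..a} y" unfolding y_def by (rule continuous_on_avg[OF f])
  have "((\<lambda>x. 2 * (y x \<bullet> f x) - y x \<bullet> y x) has_integral (a * (y a \<bullet> y a) - (-a) * (y (-a) \<bullet> y (-a)))) {-a..a}"
  proof (rule fundamental_theorem_of_calculus_strong[of "{0, -a, a}"])
    show "continuous_on {-a..a} (\<lambda>x. x * (y x \<bullet> y x))" by (intro continuous_intros y)
    fix x assume "x \<in> {-a..a} - {0, -a, a}"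
    then have x: "x \<in> \<Omega> - {0}" by auto
    have dU: "(U has_vector_derivative f x) (at x)" by (rule acd_has_vector_derivative_at[OF U f]) (use x in simp)
    have "((\<lambda>x. U x \<bullet> U x) has_vector_derivative 2 * (U x \<bullet> f x)) (at x)"
      using bounded_bilinear.has_vector_derivative[OF bounded_bilinear_inner dU dU] by (simp add: inner_commute)
    then have "((\<lambda>x. U x \<bullet> U x) has_real_derivative 2 * (U x \<bullet> f x)) (at x)"
      by (simp add: has_real_derivative_iff_has_vector_derivative)
    from DERIV_divide[OF this DERIV_ident]
    have "((\<lambda>x. (U x \<bullet> U x) / x) has_real_derivative (2 * (U x \<bullet> f x) * x - (U x \<bullet> U x) * 1) / (x * x)) (at x)"
      using x by simp
    moreover have "(2 * (U x \<bullet> f x) * x - (U x \<bullet> U x) * 1) / (x * x) = 2 * (y x \<bullet> f x) - y x \<bullet> y x"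
      using x Uy[of x] by (simp add: field_simps)
    ultimately have "((\<lambda>x. (U x \<bullet> U x) / x) has_real_derivative 2 * (y x \<bullet> f x) - y x \<bullet> y x) (at x)" by simp
    then have "((\<lambda>x. x * (y x \<bullet> y x)) has_real_derivative 2 * (y x \<bullet> f x) - y x \<bullet> y x) (at x)"
    proof (rule has_field_derivative_transform_within_open[where S = "\<Omega> - {0}"])
      show "open (\<Omega> - {0})" by (intro open_Diff) auto
      show "(U x \<bullet> U x) / x = x * (y x \<bullet> y x)" if "x \<in> \<Omega> - {0}" for x
        using that Uy[of x] by simp
    qed (use x in simp)
    then show "((\<lambda>x. x * (y x \<bullet> y x)) has_vector_derivative 2 * (y x \<bullet> f x) - y x \<bullet> y x) (at x)"
      by (simp add: has_real_derivative_iff_has_vector_derivative)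
  qed (use a_pos in auto)
  then have 1: "((\<lambda>x. 2 * (y x \<bullet> f x) - y x \<bullet> y x) has_integral (a * (y a \<bullet> y a) + a * (y (-a) \<bullet> y (-a)))) \<Omega>"
    by (simp add: has_integral_Icc_iff_Ioo)
  note L2 = continuous_L2[OF f] continuous_L2[OF y]
  have i: "integrable M (\<lambda>x. 2 * (y x \<bullet> f x) - y x \<bullet> y x)"
    by (intro Bochner_Integration.integrable_diff integrable_mult_right integrable_inner L2)
  have "(\<integral>x. 2 * (y x \<bullet> f x) - y x \<bullet> y x \<partial>M) = a * (y a \<bullet> y a) + a * (y (-a) \<bullet> y (-a))"
    by (rule has_integral_unique[OF has_integral_integral_lebesgue_on[OF i] 1]) simp
  moreover have "(\<integral>x. 2 * (y x \<bullet> f x) - y x \<bullet> y x \<partial>M) = 2 * (emb y \<bullet> emb f) - emb y \<bullet> emb y"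
    by (simp add: inner_emb L2 integrable_inner)
  moreover have "0 \<le> a * (y a \<bullet> y a) + a * (y (-a) \<bullet> y (-a))" using a_pos by simp
  ultimately have "(norm (emb y))\<^sup>2 \<le> 2 * (emb y \<bullet> emb f)" by (simp add: power2_norm_eq_inner)
  also have "\<dots> \<le> 2 * (norm (emb y) * norm (emb f))" using norm_cauchy_schwarz by (intro mult_left_mono) auto
  finally have "norm (emb y) * norm (emb y) \<le> norm (emb y) * (2 * norm (emb f))" by (simp add: power2_eq_square algebra_simps)
  then have "norm (emb y) \<le> 2 * norm (emb f)" by (cases "norm (emb y) = 0") (auto simp: mult_le_cancel_left)
  then show ?thesis by (simp add: y_def)
qed

section \<open>The singular weight ln x^2\<close>

lemma ln_square_L2: "(\<lambda>x. complex_of_real (ln (x\<^sup>2))) \<in> L2 \<Omega>"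
proof -
  \<comment> \<open>An explicit primitive of (ln x^2)^2, which extends continuously through
    0.\<close>
  define \<Phi> where "\<Phi> = (\<lambda>x::real. x * (ln (x\<^sup>2))\<^sup>2 - 4 * (x * ln (x\<^sup>2)) + 8 * x)"
  have der: "(\<Phi> has_real_derivative (ln (x\<^sup>2))\<^sup>2) (at x)" if "x \<noteq> 0" for x
  proof -
    have pos: "0 < x * x" using that not_real_square_gt_zero by blast
    have l: "((\<lambda>x. ln (x\<^sup>2)) has_real_derivative 2 / x) (at x)"
      using that pos by (auto intro!: derivative_eq_intros simp: field_simps power2_eq_square)
    show ?thesis unfolding \<Phi>_def
      using that pos by (auto intro!: derivative_eq_intros l simp: field_simps power2_eq_square)
  qed
  have cont: "continuous_on {-a..a} \<Phi>"
  proof (intro continuous_at_imp_continuous_on ballI)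
    fix x :: real
    show "isCont \<Phi> x"
    proof (cases "x = 0")
      case True
      have "(\<Phi> \<longlongrightarrow> 0) (at_right 0)" "(\<Phi> \<longlongrightarrow> 0) (at_left 0)" unfolding \<Phi>_def by real_asymp+
      then have "(\<Phi> \<longlongrightarrow> 0) (at 0)" by (simp add: filterlim_at_split)
      then show ?thesis using True by (simp add: isCont_def \<Phi>_def)
    next
      case False then show ?thesis using der DERIV_isCont by blast
    qed
  qed
  have "((\<lambda>x. (ln (x\<^sup>2))\<^sup>2) has_integral (\<Phi> a - \<Phi> (-a))) {-a..a}"
    by (rule fundamental_theorem_of_calculus_strong[of "{0}"])
       (use a_pos der cont in \<open>auto simp: has_real_derivative_iff_has_vector_derivative\<close>)
  then have "(\<lambda>x::real. (ln (x\<^sup>2))\<^sup>2) absolutely_integrable_on {-a..a}"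
    by (intro nonnegative_absolutely_integrable_1) (auto simp: integrable_on_def)
  then have "set_integrable lebesgue \<Omega> (\<lambda>x::real. (ln (x\<^sup>2))\<^sup>2)"
    by (rule set_integrable_subset) auto
  then have "integrable M (\<lambda>x. (ln (x\<^sup>2))\<^sup>2)"
    by (simp add: set_integrable_def integrable_restrict_space)
  moreover have "(\<lambda>x. complex_of_real (ln (x\<^sup>2))) \<in> borel_measurable M"
  proof -
    have "(\<lambda>x::real. x) \<in> borel_measurable M" using id_borel_measurable_lebesgue_on by (simp add: id_def)
    then show ?thesis by measurable
  qed
  ultimately show ?thesis by (simp add: L2_def)
qed

definition Ln :: real where "Ln = norm (emb (\<lambda>x. complex_of_real (ln (x\<^sup>2))))"

text \<open>The weight is only in L2, so a uniform bound on f is needed; an L2 bound would not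
  do.\<close>

lemma ln_mult_L2:
  assumes f: "continuous_on {-a..a} f" and B: "\<And>x. x \<in> {-a..a} \<Longrightarrow> cmod (f x) \<le> B"
  shows "(\<lambda>x. ln (x\<^sup>2) *\<^sub>R f x) \<in> L2 \<Omega>" "norm (emb (\<lambda>x. ln (x\<^sup>2) *\<^sub>R f x)) \<le> B * Ln"
proof -
  have b: "AE x in M. cmod (ln (x\<^sup>2) *\<^sub>R f x) \<le> B * cmod (complex_of_real (ln (x\<^sup>2)))"
  proof (rule AE_M_I)
    fix x assume "x \<in> \<Omega>"
    then have "cmod (f x) \<le> B" by (intro B) auto
    then have "\<bar>ln (x\<^sup>2)\<bar> * cmod (f x) \<le> \<bar>ln (x\<^sup>2)\<bar> * B" by (rule mult_left_mono) simp
    then show "cmod (ln (x\<^sup>2) *\<^sub>R f x) \<le> B * cmod (complex_of_real (ln (x\<^sup>2)))" by (simp add: mult.commute)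
  qed
  have m: "(\<lambda>x. ln (x\<^sup>2) *\<^sub>R f x) \<in> borel_measurable M"
  proof -
    have "(\<lambda>x::real. x) \<in> borel_measurable M" using id_borel_measurable_lebesgue_on by (simp add: id_def)
    then show ?thesis using L2_measurable[OF continuous_L2[OF f]] by measurable
  qed
  show L: "(\<lambda>x. ln (x\<^sup>2) *\<^sub>R f x) \<in> L2 \<Omega>" by (rule L2_bound[OF ln_square_L2 m b])
  have "0 \<le> B" using order_trans[OF norm_ge_zero B[of 0]] a_pos by simp
  then show "norm (emb (\<lambda>x. ln (x\<^sup>2) *\<^sub>R f x)) \<le> B * Ln"
    unfolding Ln_def by (intro norm_emb_mono ln_square_L2 L b)
qed

text \<open>The class of profiles on which \<open>u \<mapsto> u log \<bar>u\<bar>\<^sup>2\<close> gains regularity: \<open>U\<close> vanishes exactly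
  at \<open>0\<close>, to first order.\<close>

definition adm :: "real \<Rightarrow> real \<Rightarrow> (real \<Rightarrow> complex) \<Rightarrow> (real \<Rightarrow> complex) \<Rightarrow> bool" where
  "adm d B U W \<longleftrightarrow> acd U W \<and> continuous_on {-a..a} W \<and> U 0 = 0 \<and>
     (\<forall>x\<in>{-a..a}. d \<le> cmod (avg W x) \<and> cmod (W x) \<le> B)"

lemma adm_dzlog:
  assumes "adm d B U W" "0 < d" "x \<in> \<Omega>" "x \<noteq> 0"
  shows "dzlog (U x) (W x) = ln (x\<^sup>2) *\<^sub>R W x + dzlog (avg W x) (W x)"
proof -
  have x: "x \<in> {-a..a}" using assms(3) by auto
  then have "avg W x \<noteq> 0" using assms(1,2) unfolding adm_def by force
  moreover have "U x = x *\<^sub>R avg W x" using assms(1) x by (intro acd_eq_avg) (auto simp: adm_def)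
  ultimately show ?thesis using dzlog_scaleR[OF assms(4)] by simp
qed

lemma adm_AE_dzlog:
  assumes "adm d B U W" "0 < d"
  shows "AE x in M. ln (x\<^sup>2) *\<^sub>R W x + dzlog (avg W x) (W x) = dzlog (U x) (W x)"
  using AE_M_nonzero by (rule AE_M_mono) (simp add: adm_dzlog[OF assms])

lemma adm_continuous_dzlog:
  assumes "adm d B U W" "0 < d" shows "continuous_on {-a..a} (\<lambda>x. dzlog (avg W x) (W x))"
proof (rule continuous_on_dzlog)
  show "continuous_on {-a..a} W" using assms by (simp add: adm_def)
  then show "continuous_on {-a..a} (avg W)" by (rule continuous_on_avg)
  show "\<And>x. x \<in> {-a..a} \<Longrightarrow> avg W x \<noteq> 0" using assms unfolding adm_def by force
qed

text \<open>The candidate derivative is in L2 because W is bounded and the average of W stays away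
  from 0. At the origin continuity suffices.\<close>

lemma acd_zlog:
  assumes "adm d B U W" "0 < d"
  shows "acd (\<lambda>x. zlog (U x)) (\<lambda>x. dzlog (U x) (W x))"
proof -
  have U: "acd U W" "continuous_on {-a..a} W" and B: "\<And>x. x \<in> {-a..a} \<Longrightarrow> cmod (W x) \<le> B"
    using assms by (auto simp: adm_def)
  have "(\<lambda>x. ln (x\<^sup>2) *\<^sub>R W x + dzlog (avg W x) (W x)) \<in> L2 \<Omega>"
    by (intro L2_add ln_mult_L2[OF U(2) B] continuous_L2 adm_continuous_dzlog[OF assms])
  then have L2: "(\<lambda>x. dzlog (U x) (W x)) \<in> L2 \<Omega>" by (rule L2_cong_AE) (rule adm_AE_dzlog[OF assms])
  show ?thesis
  proof (rule acd_FTC[OF L2, of "{0}"])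
    have "continuous_on UNIV zlog" by (intro continuous_at_imp_continuous_on ballI isCont_zlog)
    then show "continuous_on {-a..a} (\<lambda>x. zlog (U x))"
      by (rule continuous_on_compose2[OF _ acd_continuous[OF U(1)]]) simp
    fix x assume x: "x \<in> \<Omega> - {0}"
    then have x': "x \<in> {-a..a}" by auto
    have "U x = x *\<^sub>R avg W x" using assms(1) x' by (intro acd_eq_avg) (auto simp: adm_def)
    moreover have "avg W x \<noteq> 0" using assms x' unfolding adm_def by force
    ultimately have "U x \<noteq> 0" using x by simp
    then show "((\<lambda>x. zlog (U x)) has_vector_derivative dzlog (U x) (W x)) (at x)"
      using x by (intro zlog_has_vector_derivative acd_has_vector_derivative_at[OF U]) auto
  qed simp
qed

lemma i_inner_self: "(\<i> * z) \<bullet> z = 0"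
  by (simp add: inner_complex_def)

text \<open>Two uses of one splitting. Paired with the difference itself after multiplication by
  \<open>\<i>\<close>, the singular part vanishes and an L2 bound remains. For the norm it does not
  vanish and costs a uniform bound e.\<close>

lemma dzlog_diff_estimate:
  assumes d: "0 < d"
  obtains K where "0 \<le> K"
    and "\<And>U1 W1 U2 W2. adm d B U1 W1 \<Longrightarrow> adm d B U2 W2 \<Longrightarrow>
      \<bar>emb (\<lambda>x. \<i> * (dzlog (U1 x) (W1 x) - dzlog (U2 x) (W2 x))) \<bullet> emb (\<lambda>x. W1 x - W2 x)\<bar>
        \<le> K * (norm (emb (\<lambda>x. W1 x - W2 x)))\<^sup>2"
    and "\<And>U1 W1 U2 W2 e. adm d B U1 W1 \<Longrightarrow> adm d B U2 W2 \<Longrightarrow>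
      (\<And>x. x \<in> {-a..a} \<Longrightarrow> cmod (W1 x - W2 x) \<le> e) \<Longrightarrow>
      norm (emb (\<lambda>x. dzlog (U1 x) (W1 x) - dzlog (U2 x) (W2 x))) \<le> e * Ln + K * norm (emb (\<lambda>x. W1 x - W2 x))"
proof -
  obtain K where K: "0 \<le> K" "\<And>v1 v2 w1 w2. \<lbrakk>d \<le> cmod v1; d \<le> cmod v2; cmod v1 \<le> B; cmod v2 \<le> B; cmod w1 \<le> B; cmod w2 \<le> B\<rbrakk> \<Longrightarrow>
      cmod (dzlog v1 w1 - dzlog v2 w2) \<le> K * (cmod (v1 - v2) + cmod (w1 - w2))"
    using dzlog_lipschitz[OF d] by blast
  \<comment> \<open>The factor 3 is 2 from Hardy's inequality for the averages plus 1 for W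
    itself.\<close>
  have main: "norm (emb (\<lambda>x. dzlog (avg W1 x) (W1 x) - dzlog (avg W2 x) (W2 x))) \<le> 3 * K * norm (emb (\<lambda>x. W1 x - W2 x))"
      and L: "(\<lambda>x. ln (x\<^sup>2) *\<^sub>R (W1 x - W2 x)) \<in> L2 \<Omega>"
        "(\<lambda>x. dzlog (avg W1 x) (W1 x) - dzlog (avg W2 x) (W2 x)) \<in> L2 \<Omega>"
        "AE x in M. ln (x\<^sup>2) *\<^sub>R (W1 x - W2 x) + (dzlog (avg W1 x) (W1 x) - dzlog (avg W2 x) (W2 x))
           = dzlog (U1 x) (W1 x) - dzlog (U2 x) (W2 x)"
      and W: "continuous_on {-a..a} (\<lambda>x. W1 x - W2 x)"
    if A: "adm d B U1 W1" "adm d B U2 W2" for U1 W1 U2 W2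
  proof -
    have c: "continuous_on {-a..a} W1" "continuous_on {-a..a} W2"
      and B: "\<And>x. x \<in> {-a..a} \<Longrightarrow> cmod (W1 x) \<le> B" "\<And>x. x \<in> {-a..a} \<Longrightarrow> cmod (W2 x) \<le> B"
      and V: "\<And>x. x \<in> {-a..a} \<Longrightarrow> d \<le> cmod (avg W1 x)" "\<And>x. x \<in> {-a..a} \<Longrightarrow> d \<le> cmod (avg W2 x)"
      using A by (auto simp: adm_def)
    show W: "continuous_on {-a..a} (\<lambda>x. W1 x - W2 x)" by (intro continuous_intros c)
    have "cmod (W1 x - W2 x) \<le> B + B" if "x \<in> {-a..a}" for x
      using norm_triangle_ineq4[of "W1 x" "W2 x"] B(1)[OF that] B(2)[OF that] by linarith
    then show "(\<lambda>x. ln (x\<^sup>2) *\<^sub>R (W1 x - W2 x)) \<in> L2 \<Omega>" by (rule ln_mult_L2[OF W])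
    show Ld: "(\<lambda>x. dzlog (avg W1 x) (W1 x) - dzlog (avg W2 x) (W2 x)) \<in> L2 \<Omega>"
      by (intro L2_diff continuous_L2 adm_continuous_dzlog A d)
         (use A d in \<open>auto intro: adm_continuous_dzlog\<close>)
    show "AE x in M. ln (x\<^sup>2) *\<^sub>R (W1 x - W2 x) + (dzlog (avg W1 x) (W1 x) - dzlog (avg W2 x) (W2 x))
           = dzlog (U1 x) (W1 x) - dzlog (U2 x) (W2 x)"
      using adm_AE_dzlog[OF A(1) d] adm_AE_dzlog[OF A(2) d]
      by eventually_elim (simp add: algebra_simps)
    define n where "n = (\<lambda>x. complex_of_real (cmod (avg (\<lambda>x. W1 x - W2 x) x)) + complex_of_real (cmod (W1 x - W2 x)))"
    have cn: "continuous_on {-a..a} (\<lambda>x. complex_of_real (cmod (avg (\<lambda>x. W1 x - W2 x) x)))"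
      "continuous_on {-a..a} (\<lambda>x. complex_of_real (cmod (W1 x - W2 x)))"
      by (intro continuous_intros continuous_on_avg W c)+
    have nL: "n \<in> L2 \<Omega>" unfolding n_def by (intro L2_add continuous_L2 cn)
    have "norm (emb n) \<le> norm (emb (\<lambda>x. complex_of_real (cmod (avg (\<lambda>x. W1 x - W2 x) x)))) + norm (emb (\<lambda>x. complex_of_real (cmod (W1 x - W2 x))))"
      unfolding n_def emb_add[OF continuous_L2[OF cn(1)] continuous_L2[OF cn(2)]] by (rule norm_triangle_ineq)
    also have "\<dots> \<le> 1 * norm (emb (avg (\<lambda>x. W1 x - W2 x))) + 1 * norm (emb (\<lambda>x. W1 x - W2 x))"
      by (intro add_mono norm_emb_mono continuous_L2 cn W continuous_on_avg) auto
    also have "\<dots> \<le> 3 * norm (emb (\<lambda>x. W1 x - W2 x))" using hardy[OF W] by simp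
    finally have nn: "norm (emb n) \<le> 3 * norm (emb (\<lambda>x. W1 x - W2 x))" .
    have "norm (emb (\<lambda>x. dzlog (avg W1 x) (W1 x) - dzlog (avg W2 x) (W2 x))) \<le> K * norm (emb n)"
    proof (rule norm_emb_mono[OF nL Ld K(1)], rule AE_M_I)
      fix x assume "x \<in> \<Omega>"
      then have x: "x \<in> {-a..a}" by auto
      have "cmod (dzlog (avg W1 x) (W1 x) - dzlog (avg W2 x) (W2 x)) \<le> K * (cmod (avg W1 x - avg W2 x) + cmod (W1 x - W2 x))"
        by (intro K(2) V B x avg_bound c)
      also have "\<dots> = K * cmod (n x)"
      proof -
        have "cmod (n x) = cmod (avg (\<lambda>x. W1 x - W2 x) x) + cmod (W1 x - W2 x)"
          unfolding n_def of_real_add[symmetric] norm_of_real by simp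
        then show ?thesis by (simp add: avg_diff[OF c x])
      qed
      finally show "cmod (dzlog (avg W1 x) (W1 x) - dzlog (avg W2 x) (W2 x)) \<le> K * cmod (n x)" .
    qed
    also have "\<dots> \<le> K * (3 * norm (emb (\<lambda>x. W1 x - W2 x)))" by (rule mult_left_mono[OF nn K(1)])
    finally show "norm (emb (\<lambda>x. dzlog (avg W1 x) (W1 x) - dzlog (avg W2 x) (W2 x))) \<le> 3 * K * norm (emb (\<lambda>x. W1 x - W2 x))"
      by (simp add: mult_ac)
  qed
  show ?thesis
  proof (rule that[of "3 * K"])
    show "0 \<le> 3 * K" using K by simp
  next
    fix U1 W1 U2 W2 assume A: "adm d B U1 W1" "adm d B U2 W2"
    let ?w = "\<lambda>x. W1 x - W2 x" and ?g = "\<lambda>x. dzlog (avg W1 x) (W1 x) - dzlog (avg W2 x) (W2 x)"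
    have wL: "?w \<in> L2 \<Omega>" by (rule continuous_L2[OF W[OF A]])
    have "AE x in M. \<i> * (ln (x\<^sup>2) *\<^sub>R ?w x) + \<i> * ?g x = \<i> * (dzlog (U1 x) (W1 x) - dzlog (U2 x) (W2 x))"
      using L(3)[OF A] by eventually_elim (metis distrib_left)
    then have "emb (\<lambda>x. \<i> * (dzlog (U1 x) (W1 x) - dzlog (U2 x) (W2 x))) = emb (\<lambda>x. \<i> * (ln (x\<^sup>2) *\<^sub>R ?w x) + \<i> * ?g x)"
      by (intro emb_cong_AE[symmetric] L2_add L2_cmult L[OF A])
    also have "\<dots> = emb (\<lambda>x. \<i> * (ln (x\<^sup>2) *\<^sub>R ?w x)) + emb (\<lambda>x. \<i> * ?g x)"
      by (intro emb_add L2_cmult L[OF A])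
    finally have "emb (\<lambda>x. \<i> * (dzlog (U1 x) (W1 x) - dzlog (U2 x) (W2 x))) \<bullet> emb ?w
        = emb (\<lambda>x. \<i> * (ln (x\<^sup>2) *\<^sub>R ?w x)) \<bullet> emb ?w + emb (\<lambda>x. \<i> * ?g x) \<bullet> emb ?w"
      by (simp add: inner_add_left)
    \<comment> \<open>The weight ln x^2 is real, so the integrand is a real multiple of Re(i |w|^2)
      = 0 at every point.\<close>
    also have "emb (\<lambda>x. \<i> * (ln (x\<^sup>2) *\<^sub>R ?w x)) \<bullet> emb ?w = 0"
    proof -
      have "(\<i> * (ln (x\<^sup>2) *\<^sub>R ?w x)) \<bullet> ?w x = 0" for x
        unfolding mult_scaleR_right inner_scaleR_left i_inner_self by simp
      then show ?thesis by (simp only: inner_emb[OF L2_cmult[OF L(1)[OF A]] wL] Bochner_Integration.integral_zero)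
    qed
    finally have "\<bar>emb (\<lambda>x. \<i> * (dzlog (U1 x) (W1 x) - dzlog (U2 x) (W2 x))) \<bullet> emb ?w\<bar> = \<bar>emb (\<lambda>x. \<i> * ?g x) \<bullet> emb ?w\<bar>"
      by simp
    also have "\<dots> \<le> norm (emb (\<lambda>x. \<i> * ?g x)) * norm (emb ?w)" by (rule Cauchy_Schwarz_ineq2)
    also have "norm (emb (\<lambda>x. \<i> * ?g x)) = norm (emb ?g)" by (simp add: norm_emb_cmult[OF L(2)[OF A]])
    also have "norm (emb ?g) * norm (emb ?w) \<le> (3 * K * norm (emb ?w)) * norm (emb ?w)"
      by (rule mult_right_mono[OF main[OF A]]) simp
    finally show "\<bar>emb (\<lambda>x. \<i> * (dzlog (U1 x) (W1 x) - dzlog (U2 x) (W2 x))) \<bullet> emb ?w\<bar> \<le> 3 * K * (norm (emb ?w))\<^sup>2"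
      by (simp add: power2_eq_square mult_ac)
  next
    fix U1 W1 U2 W2 e assume A: "adm d B U1 W1" "adm d B U2 W2"
      and e: "\<And>x. x \<in> {-a..a} \<Longrightarrow> cmod (W1 x - W2 x) \<le> e"
    let ?w = "\<lambda>x. W1 x - W2 x" and ?g = "\<lambda>x. dzlog (avg W1 x) (W1 x) - dzlog (avg W2 x) (W2 x)"
    have "emb (\<lambda>x. dzlog (U1 x) (W1 x) - dzlog (U2 x) (W2 x)) = emb (\<lambda>x. ln (x\<^sup>2) *\<^sub>R ?w x + ?g x)"
      by (rule emb_cong_AE[symmetric, OF L2_add[OF L(1,2)[OF A]] L(3)[OF A]])
    also have "\<dots> = emb (\<lambda>x. ln (x\<^sup>2) *\<^sub>R ?w x) + emb ?g" by (rule emb_add[OF L(1,2)[OF A]])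
    finally have "norm (emb (\<lambda>x. dzlog (U1 x) (W1 x) - dzlog (U2 x) (W2 x))) \<le> norm (emb (\<lambda>x. ln (x\<^sup>2) *\<^sub>R ?w x)) + norm (emb ?g)"
      by (simp only: norm_triangle_ineq)
    also have "\<dots> \<le> e * Ln + 3 * K * norm (emb ?w)"
      by (intro add_mono ln_mult_L2(2)[OF W[OF A] e] main[OF A])
    finally show "norm (emb (\<lambda>x. dzlog (U1 x) (W1 x) - dzlog (U2 x) (W2 x))) \<le> e * Ln + 3 * K * norm (emb ?w)" .
  qed
qed

section \<open>The energy method\<close>

lemma vector_derivative_quotient_tendsto:
  "(f has_vector_derivative f') (at t) \<Longrightarrow> ((\<lambda>s. (f s - f t) /\<^sub>R (s - t)) \<longlongrightarrow> f') (at t)"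
  for f :: "real \<Rightarrow> 'a::real_normed_vector"
  unfolding has_vector_derivative_iff_quotient tendsto_norm_zero_iff by (rule LIM_zero_cancel)

text \<open>\<open>Zx\<close> is not known to be differentiable in time. The difference of the
  energies factors as (Zx s - Zx t, Zx s + Zx t), and integration by parts turns this into an
  expression that needs only the time derivative of Z and continuity of \<open>Zxx\<close> in
  L2.\<close>

lemma energy_has_derivative:
  assumes Z: "\<And>s. acd (Z s) (Zx s)" and Zx: "\<And>s. acd (Zx s) (Zxx s)"
    and bc: "\<And>s. Zx s (-a) = 0" "\<And>s. Zx s a = 0"
    and der: "((\<lambda>s. emb (Z s)) has_vector_derivative emb zt) (at t)"
    and cont: "isCont (\<lambda>s. emb (Zxx s)) t"
  shows "((\<lambda>s. (norm (emb (Zx s)))\<^sup>2) has_real_derivative (- 2 * (emb zt \<bullet> emb (Zxx t)))) (at t)"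
proof -
  have id: "(norm (emb (Zx s)))\<^sup>2 - (norm (emb (Zx t)))\<^sup>2 = - ((emb (Z s) - emb (Z t)) \<bullet> (emb (Zxx s) + emb (Zxx t)))" for s
  proof -
    have "emb (\<lambda>x. Zx s x - Zx t x) \<bullet> emb (\<lambda>x. Zx s x + Zx t x) = - (emb (\<lambda>x. Z s x - Z t x) \<bullet> emb (\<lambda>x. Zxx s x + Zxx t x))"
      by (rule acd_ibp_inner) (auto intro!: acd_diff acd_add Z Zx simp: bc)
    then have "(emb (Zx s) - emb (Zx t)) \<bullet> (emb (Zx s) + emb (Zx t)) = - ((emb (Z s) - emb (Z t)) \<bullet> (emb (Zxx s) + emb (Zxx t)))"
      by (simp only: emb_add emb_diff acd_L2[OF Z] acd_L2[OF Zx] acdD(1)[OF Zx])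
    moreover have "(emb (Zx s) - emb (Zx t)) \<bullet> (emb (Zx s) + emb (Zx t)) = (norm (emb (Zx s)))\<^sup>2 - (norm (emb (Zx t)))\<^sup>2"
      by (simp add: power2_norm_eq_inner inner_diff_left inner_diff_right inner_add_right inner_commute)
    ultimately show ?thesis by simp
  qed
  have "((\<lambda>s. - (((emb (Z s) - emb (Z t)) /\<^sub>R (s - t)) \<bullet> (emb (Zxx s) + emb (Zxx t)))) \<longlongrightarrow> - (emb zt \<bullet> (emb (Zxx t) + emb (Zxx t)))) (at t)"
    by (intro tendsto_intros vector_derivative_quotient_tendsto der) (use cont in \<open>simp add: isCont_def\<close>)
  moreover have "(\<lambda>s. - (((emb (Z s) - emb (Z t)) /\<^sub>R (s - t)) \<bullet> (emb (Zxx s) + emb (Zxx t))))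
      = (\<lambda>s. ((norm (emb (Zx s)))\<^sup>2 - (norm (emb (Zx t)))\<^sup>2) / (s - t))"
    unfolding id by (auto simp: divide_inverse mult.commute)
  ultimately show ?thesis
    by (simp add: has_field_derivative_iff inner_add_right)
qed

text \<open>Solving for zt gives i Zxx - i R. The first term is orthogonal to Zxx, and in the second
  a derivative is moved onto R; boundary terms vanish through Zx, so R is free at the ends.\<close>

lemma energy_identity:
  assumes zt: "zt \<in> L2 \<Omega>" and Zx: "acd Zx Zxx" and bc: "Zx (-a) = 0" "Zx a = 0" and R: "acd R Rx"
    and eq: "AE x in M. \<i> * zt x + Zxx x = R x"
  shows "- 2 * (emb zt \<bullet> emb Zxx) = - 2 * (emb (\<lambda>x. \<i> * Rx x) \<bullet> emb Zx)"
proof -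
  note Q = acdD(1)[OF Zx] and RL = acd_L2[OF R]
  have "AE x in M. \<i> * Zxx x - \<i> * R x = zt x"
    using eq
  proof eventually_elim
    fix x assume "\<i> * zt x + Zxx x = R x"
    then have "\<i> * Zxx x - \<i> * R x = \<i> * (Zxx x - (\<i> * zt x + Zxx x))" by (simp add: algebra_simps)
    also have "\<dots> = zt x" by (simp add: algebra_simps flip: mult.assoc)
    finally show "\<i> * Zxx x - \<i> * R x = zt x" .
  qed
  from emb_cong_AE[OF L2_diff[OF L2_cmult[OF Q] L2_cmult[OF RL]] this]
  have "emb zt = emb (\<lambda>x. \<i> * Zxx x) - emb (\<lambda>x. \<i> * R x)" by (simp add: emb_diff L2_cmult Q RL)
  moreover have "emb (\<lambda>x. \<i> * Zxx x) \<bullet> emb Zxx = 0"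
    by (simp only: inner_emb[OF L2_cmult[OF Q] Q] i_inner_self Bochner_Integration.integral_zero)
  moreover have "emb (\<lambda>x. \<i> * Rx x) \<bullet> emb Zx = - (emb (\<lambda>x. \<i> * R x) \<bullet> emb Zxx)"
    by (rule acd_ibp_inner[OF acd_cmult[OF R] Zx bc])
  ultimately show ?thesis by (simp add: inner_diff_left)
qed

end

section \<open>Oddness of the flow\<close>

lemma measurable_uminus_lebesgue: "(uminus :: real \<Rightarrow> real) \<in> lebesgue \<rightarrow>\<^sub>M lebesgue"
proof -
  have "(*\<^sub>R) (-1) = (uminus :: real \<Rightarrow> real)" by (auto simp: fun_eq_iff)
  then show ?thesis using lebesgue_measurable_scaling[of "-1 :: real", where 'a=real] by simp
qed

lemma distr_uminus_lebesgue: "distr lebesgue lebesgue uminus = (lebesgue :: real measure)"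
  using lebesgue_real_affine[of "-1" 0] by (simp add: density_1)

lemma AE_lebesgue_uminus:
  assumes "AE x in lebesgue. P (x :: real)" shows "AE x in lebesgue. P (- x)"
proof -
  have "AE x in distr lebesgue lebesgue uminus. P x" unfolding distr_uminus_lebesgue by (rule assms)
  then show ?thesis by (rule AE_distrD[OF measurable_uminus_lebesgue])
qed

context symm_interval
begin

lemma AE_M_uminus: assumes "AE x in M. P x" shows "AE x in M. P (- x)"
proof -
  have "AE x in lebesgue. - x \<in> \<Omega> \<longrightarrow> P (- x)"
    using assms unfolding AE_M_iff by (rule AE_lebesgue_uminus)
  then have "AE x in lebesgue. x \<in> \<Omega> \<longrightarrow> P (- x)" by (rule eventually_mono) simp
  then show ?thesis unfolding AE_M_iff .
qed

lemma L2_uminus: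
  assumes "f \<in> L2 \<Omega>"
  shows "(\<lambda>x. f (- x)) \<in> L2 \<Omega>" "norm (emb (\<lambda>x. f (- x))) = norm (emb f)"
proof -
  have f: "sq_int (cut f)" using assms by (simp add: L2_iff_cut)
  have eq: "cut (\<lambda>x. f (- x)) = (\<lambda>x. cut f (- x))" by (auto simp: cut_def)
  have m: "(\<lambda>x. cut f (- x)) \<in> borel_measurable lebesgue"
    using measurable_compose[OF measurable_uminus_lebesgue sq_int_measurable[OF f]] .
  have fm: "(\<lambda>x. (cmod (cut f x))\<^sup>2) \<in> borel_measurable lebesgue"
    using sq_int_integrable[OF f] by (rule borel_measurable_integrable)
  have "integrable (distr lebesgue lebesgue uminus) (\<lambda>x. (cmod (cut f x))\<^sup>2)"
    using sq_int_integrable[OF f] by (simp add: distr_uminus_lebesgue)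
  then have "integrable lebesgue (\<lambda>x. (cmod (cut f (- x)))\<^sup>2)"
    by (rule integrable_distr[OF measurable_uminus_lebesgue])
  then have f': "sq_int (\<lambda>x. cut f (- x))" using m by (simp add: sq_int_def)
  then show L: "(\<lambda>x. f (- x)) \<in> L2 \<Omega>" by (simp add: L2_iff_cut eq)
  have "(norm (emb (\<lambda>x. f (- x))))\<^sup>2 = (\<integral>x. (cmod (cut f (- x)))\<^sup>2 \<partial>lebesgue)"
    unfolding emb_def eq by (rule norm_abs_l2[OF f'])
  also have "\<dots> = (\<integral>x. (cmod (cut f x))\<^sup>2 \<partial>distr lebesgue lebesgue uminus)"
    by (rule integral_distr[OF measurable_uminus_lebesgue fm, symmetric])
  also have "\<dots> = (norm (emb f))\<^sup>2" unfolding distr_uminus_lebesgue emb_def by (rule norm_abs_l2[OF f, symmetric])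
  finally show "norm (emb (\<lambda>x. f (- x))) = norm (emb f)" by (rule power2_eq_imp_eq) auto
qed

lemma acd_uminus:
  assumes "acd f g" shows "acd (\<lambda>x. f (- x)) (\<lambda>x. - g (- x))"
proof (rule acdI)
  note g = acdD(1)[OF assms]
  show "(\<lambda>x. - g (- x)) \<in> L2 \<Omega>" using L2_cmult[OF L2_uminus(1)[OF g], of "-1"] by simp
  fix x assume x: "x \<in> {-a..a}"
  then have mx: "- x \<in> {-a..a}" and am: "a \<in> {-a..a}" by auto
  have "integral {-a..x} (\<lambda>x. g (- x)) = integral {-x..a} g"
    using Henstock_Kurzweil_Integration.integral_reflect_real[of a "-x" g] by simp
  moreover have "integral {-a..-x} g + integral {-x..a} g = integral {-a..a} g"
    by (rule Henstock_Kurzweil_Integration.integral_combine) (use x L2_integrable_on[OF g] in auto)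
  ultimately show "f (- x) = f (- (- a)) + integral {-a..x} (\<lambda>x. - g (- x))"
    unfolding acdD(2)[OF assms mx] using acdD(2)[OF assms am] by (simp add: algebra_simps)
qed

lemma has_vector_derivative_emb_uminus:
  assumes U: "\<And>s. U s \<in> L2 \<Omega>" and v: "v \<in> L2 \<Omega>"
    and der: "((\<lambda>s. emb (U s)) has_vector_derivative emb v) (at t)"
  shows "((\<lambda>s. emb (\<lambda>x. U s (- x))) has_vector_derivative emb (\<lambda>x. v (- x))) (at t)"
proof -
  have "norm ((emb (\<lambda>x. U s (- x)) - emb (\<lambda>x. U t (- x))) /\<^sub>R (s - t) - emb (\<lambda>x. v (- x)))
      = norm ((emb (U s) - emb (U t)) /\<^sub>R (s - t) - emb v)" for s
  proof -
    define f where "f = (\<lambda>x. inverse (s - t) *\<^sub>R (U s x - U t x) - v x)"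
    have f: "f \<in> L2 \<Omega>" unfolding f_def by (intro L2_diff L2_scaleR U v)
    have "emb (\<lambda>x. f (- x)) = (emb (\<lambda>x. U s (- x)) - emb (\<lambda>x. U t (- x))) /\<^sub>R (s - t) - emb (\<lambda>x. v (- x))"
      unfolding f_def by (simp add: emb_diff emb_scaleR L2_diff L2_scaleR L2_uminus U v)
    moreover have "emb f = (emb (U s) - emb (U t)) /\<^sub>R (s - t) - emb v"
      unfolding f_def by (simp add: emb_diff emb_scaleR L2_diff L2_scaleR U v)
    ultimately show ?thesis using L2_uminus(2)[OF f] by metis
  qed
  then show ?thesis using der unfolding has_vector_derivative_iff_quotient by simp
qed

end

text \<open>A solution in terms of fixed representatives: U and W are the continuous versions of u
  and its x-derivative, Q and v represent the second x-derivative and the time derivative.\<close>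

locale log_nls_flow = symm_interval +
  fixes l :: real and U W Q v :: "real \<Rightarrow> real \<Rightarrow> complex"
  assumes UW: "acd (U t) (W t)" and WQ: "acd (W t) (Q t)"
    and W_bc: "W t (-a) = 0" "W t a = 0"
    and Q_cont: "isCont (\<lambda>s. emb (Q s)) t"
    and v_L2: "v t \<in> L2 \<Omega>"
    and U_der: "((\<lambda>s. emb (U s)) has_vector_derivative emb (v t)) (at t)"
    and eqn: "AE x in M. \<i> * v t x + Q t x = complex_of_real l * zlog (U t x)"
    and U0_odd: "x \<in> {-a..a} \<Longrightarrow> U 0 (- x) = - U 0 x"
begin

lemma W_cont: "continuous_on {-a..a} (W t)" by (rule acd_continuous[OF WQ])

text \<open>As \<open>zlog\<close> is odd, -U(t, -x) solves the same problem, so u below is a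
  difference of two solutions. The inequality for \<open>zlog\<close> and Gronwall from initial
  value 0 give u = 0.\<close>

lemma U_odd:
  assumes "x \<in> {-a..a}" shows "U t (- x) = - U t x"
proof -
  define u where "u = (\<lambda>t x. U t x + U t (- x))"
  define w where "w = (\<lambda>t x. W t x + - W t (- x))"
  define q where "q = (\<lambda>t x. Q t x + Q t (- x))"
  define z where "z = (\<lambda>t x. v t x + v t (- x))"
  have u: "acd (u t) (w t)" for t unfolding u_def w_def by (intro acd_add UW acd_uminus)
  have w: "acd (w t) (q t)" for t
    using acd_add[OF WQ acd_cmult[OF acd_uminus[OF WQ], of "-1"], of t t] unfolding w_def q_def by simp
  have w_bc: "w t (-a) = 0" "w t a = 0" for t by (auto simp: w_def W_bc)
  have zL: "z t \<in> L2 \<Omega>" for t unfolding z_def by (intro L2_add L2_uminus v_L2)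
  note uL = acd_L2[OF u] and qL = acdD(1)[OF w]
  have du: "((\<lambda>s. emb (u s)) has_vector_derivative emb (z t)) (at t)" for t
    unfolding u_def z_def emb_add[OF acd_L2[OF UW] L2_uminus(1)[OF acd_L2[OF UW]]] emb_add[OF v_L2 L2_uminus(1)[OF v_L2]]
    by (intro has_vector_derivative_add U_der has_vector_derivative_emb_uminus acd_L2[OF UW] v_L2)
  define p where "p = (\<lambda>t. (norm (emb (u t)))\<^sup>2)"
  have dp: "(p has_real_derivative 2 * (emb (u t) \<bullet> emb (z t))) (at t)" for t
    using bounded_bilinear.has_vector_derivative[OF bounded_bilinear_inner du du, of t]
    by (simp add: p_def power2_norm_eq_inner has_real_derivative_iff_has_vector_derivative inner_commute)
  \<comment> \<open>There is no source, hence the coefficient 0; the 2 |l| is the constant of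
    \<open>zlog_monotone\<close> times |l|.\<close>
  have est: "\<bar>2 * (emb (u t) \<bullet> emb (z t))\<bar> \<le> 2 * (2 * \<bar>l\<bar>) * p t + 2 * 0 * sqrt (p t)" for t
  proof -
    define g where "g = (\<lambda>x. zlog (U t x) - zlog (- U t (- x)))"
    have ae: "AE x in M. z t x - \<i> * q t x = - (complex_of_real l * (\<i> * g x))"
      using eqn[of t] AE_M_uminus[OF eqn[of t]]
    proof eventually_elim
      fix x assume e: "\<i> * v t x + Q t x = complex_of_real l * zlog (U t x)"
        "\<i> * v t (- x) + Q t (- x) = complex_of_real l * zlog (U t (- x))"
      have "complex_of_real l * g x = \<i> * z t x + q t x"
        unfolding g_def z_def q_def zlog_minus using e by (simp add: algebra_simps)
      then have "- (complex_of_real l * (\<i> * g x)) = - (\<i> * (\<i> * z t x + q t x))"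
        by (metis mult.left_commute)
      then show "z t x - \<i> * q t x = - (complex_of_real l * (\<i> * g x))"
        by (simp add: distrib_left)
    qed
    \<comment> \<open>By the Neumann condition u is orthogonal to i q, so the dispersive term can be
      subtracted freely from z.\<close>
    have "emb (w t) \<bullet> emb (\<lambda>x. \<i> * w t x) = - (emb (u t) \<bullet> emb (\<lambda>x. \<i> * q t x))"
      by (rule acd_ibp_inner[OF u acd_cmult[OF w]]) (simp_all add: w_bc)
    moreover have "emb (w t) \<bullet> emb (\<lambda>x. \<i> * w t x) = 0"
      unfolding inner_emb[OF acd_L2[OF w] L2_cmult[OF acd_L2[OF w]]] inner_commute[of "w t _"] i_inner_self by simp
    ultimately have "emb (u t) \<bullet> emb (z t) = emb (u t) \<bullet> emb (\<lambda>x. z t x - \<i> * q t x)"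
      by (simp add: emb_diff zL L2_cmult qL inner_diff_right)
    also have "\<dots> = (\<integral>x. u t x \<bullet> (z t x - \<i> * q t x) \<partial>M)"
      by (intro inner_emb uL L2_diff zL L2_cmult qL)
    finally have "\<bar>emb (u t) \<bullet> emb (z t)\<bar> = \<bar>\<integral>x. u t x \<bullet> (z t x - \<i> * q t x) \<partial>M\<bar>" by simp
    also have "\<dots> \<le> (\<integral>x. \<bar>u t x \<bullet> (z t x - \<i> * q t x)\<bar> \<partial>M)"
      using integral_norm_bound[of M "\<lambda>x. u t x \<bullet> (z t x - \<i> * q t x)"] by simp
    also have "\<dots> \<le> (\<integral>x. 2 * \<bar>l\<bar> * (cmod (u t x))\<^sup>2 \<partial>M)"
    proof (rule integral_mono_AE)
      show "integrable M (\<lambda>x. \<bar>u t x \<bullet> (z t x - \<i> * q t x)\<bar>)"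
        by (intro integrable_abs integrable_inner uL L2_diff zL L2_cmult qL)
      show "integrable M (\<lambda>x. 2 * \<bar>l\<bar> * (cmod (u t x))\<^sup>2)"
        using L2_sq_integrable[OF uL] by simp
      show "AE x in M. \<bar>u t x \<bullet> (z t x - \<i> * q t x)\<bar> \<le> 2 * \<bar>l\<bar> * (cmod (u t x))\<^sup>2"
        using ae
      proof eventually_elim
        fix x assume e: "z t x - \<i> * q t x = - (complex_of_real l * (\<i> * g x))"
        have ux: "u t x = U t x - (- U t (- x))" by (simp add: u_def)
        have "u t x \<bullet> (z t x - \<i> * q t x) = - (l * ((\<i> * g x) \<bullet> u t x))"
          unfolding e scaleR_conv_of_real[symmetric] by (simp add: inner_commute)
        then have "\<bar>u t x \<bullet> (z t x - \<i> * q t x)\<bar> = \<bar>l\<bar> * \<bar>(\<i> * g x) \<bullet> u t x\<bar>" by (simp add: abs_mult)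
        also have "\<dots> \<le> \<bar>l\<bar> * (2 * (cmod (u t x))\<^sup>2)"
          unfolding g_def ux by (intro mult_left_mono zlog_monotone) simp
        finally show "\<bar>u t x \<bullet> (z t x - \<i> * q t x)\<bar> \<le> 2 * \<bar>l\<bar> * (cmod (u t x))\<^sup>2" by simp
      qed
    qed
    also have "\<dots> = 2 * \<bar>l\<bar> * p t" unfolding p_def norm_emb_sq[OF uL] by simp
    finally show ?thesis by (simp add: abs_mult)
  qed
  have p0: "p 0 = 0"
  proof -
    have "emb (u 0) = emb (\<lambda>_. 0)"
      by (rule emb_cong_AE[OF uL], rule AE_M_I) (simp add: u_def U0_odd)
    then show ?thesis by (simp add: p_def norm_emb L2_zero L2_norm_def)
  qed
  have "sqrt (p t) \<le> exp (2 * \<bar>l\<bar> * \<bar>t - 0\<bar>) * (sqrt (p 0) + 0 * \<bar>t - 0\<bar>)"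
    by (rule gronwall_sqrt_abs[where I = UNIV, OF _ _ _ _ _ _ dp est]) (auto simp: p_def)
  then have "sqrt (p t) \<le> 0" by (simp add: p0)
  then have "emb (u t) = 0" by (simp add: p_def)
  then have "(\<integral>x. (cmod (u t x))\<^sup>2 \<partial>M) = 0" using norm_emb_sq[OF uL, of t] by simp
  then have "AE x in M. u t x = 0"
    using integral_nonneg_eq_0_iff_AE[OF L2_sq_integrable[OF uL]] by simp
  then have "u t x = 0" by (rule AE_zero_continuous[OF acd_continuous[OF u] _ assms])
  then show ?thesis by (simp add: u_def add_eq_0_iff)
qed

lemma U_zero: "U t 0 = 0"
  using U_odd[of 0 t] a_pos by (simp add: eq_neg_iff_add_eq_0)

text \<open>The Neumann condition provides the common zero at -a, so L2 closeness of the second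
  derivatives makes W uniformly close.\<close>

lemma W_diff_bound:
  assumes "x \<in> {-a..a}" shows "cmod (W s x - W t x) \<le> sqrt (2 * a) * norm (emb (Q s) - emb (Q t))"
proof -
  have "cmod ((W s x - W t x) - (W s (-a) - W t (-a))) \<le> sqrt (2 * a) * norm (emb (\<lambda>x. Q s x - Q t x))"
    by (rule acd_diff_bound[OF acd_diff[OF WQ WQ] assms]) (use a_pos in auto)
  then show ?thesis by (simp add: W_bc emb_diff acdD(1)[OF WQ])
qed

lemma Q_tendsto: "((\<lambda>s. norm (emb (Q s) - emb (Q t))) \<longlongrightarrow> 0) (at t)"
  using Q_cont[of t] unfolding isCont_def by (intro tendsto_norm_zero LIM_zero)

lemma emb_W_diff_bound: "norm (emb (W s) - emb (W t)) \<le> (sqrt (2 * a) * norm (emb (\<lambda>_. 1))) * norm (emb (Q s) - emb (Q t))"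
proof -
  have "norm (emb (\<lambda>x. W s x - W t x)) \<le> (sqrt (2 * a) * norm (emb (Q s) - emb (Q t))) * norm (emb (\<lambda>_. 1))"
  proof (rule norm_emb_mono)
    show "AE x in M. cmod (W s x - W t x) \<le> sqrt (2 * a) * norm (emb (Q s) - emb (Q t)) * cmod 1"
      using W_diff_bound by (intro AE_M_I) auto
  qed (use a_pos in \<open>auto intro!: L2_const L2_diff acd_L2[OF WQ]\<close>)
  then show ?thesis by (simp add: emb_diff acd_L2[OF WQ] mult_ac)
qed

end

section \<open>Persistence of regularity while the average of the derivative does not vanish\<close>

context symm_interval
begin

lemma emb_zero: "emb (\<lambda>_. 0) = 0"
  using emb_diff[OF L2_zero L2_zero] by simp

lemma acd_deriv_unique:
  assumes "acd f g" "acd f' g'" "AE x in M. f x = f' x"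
  shows "emb g = emb g'"
proof -
  have "has_weak_deriv \<Omega> 1 f' g"
    by (rule has_weak_deriv_cong_left[OF acd_weak_deriv[OF assms(1)] acd_L2[OF assms(1)] assms(3)])
  from has_weak_deriv_unique[OF this acd_weak_deriv[OF assms(2)]]
  show ?thesis by (rule emb_cong_AE[OF acdD(1)[OF assms(1)]])
qed

end

text \<open>\<open>Q0\<close> and \<open>P0\<close> encode the H3 regularity of the initial value.
  The lower bound is assumed on a closed window, while results hold on its interior, because
  difference quotients in time need room on both sides.\<close>

locale nondegenerate_flow = log_nls_flow +
  fixes S d :: real and Q0 P0 :: "real \<Rightarrow> complex"
  assumes S: "0 < S" and d: "0 < d"
    and V_ge: "\<And>t x. t \<in> {-S..S} \<Longrightarrow> x \<in> {-a..a} \<Longrightarrow> d \<le> cmod (avg (W t) x)"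
    and Q0P0: "acd Q0 P0" and Q0: "AE x in M. Q0 x = Q 0 x"
begin

definition F :: "real \<Rightarrow> real \<Rightarrow> complex" where "F t x = dzlog (U t x) (W t x)"

text \<open>A relation rather than a function: the x-derivative of v(t) is unique in L2, but its
  existence for t other than 0 is still to be shown.\<close>

definition vx :: "real \<Rightarrow> (real \<Rightarrow> complex) \<Rightarrow> bool" where
  "vx t g \<longleftrightarrow> (\<exists>v'. acd v' g \<and> (AE x in M. v' x = v t x))"

lemma vx_L2: "vx t g \<Longrightarrow> g \<in> L2 \<Omega>"
  using acdD(1) by (auto simp: vx_def)

lemma vx_unique: assumes "vx t g" "vx t g'" shows "emb g = emb g'"
proof -
  obtain f f' where "acd f g" "acd f' g'" and ae: "AE x in M. f x = v t x" "AE x in M. f' x = v t x"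
    using assms unfolding vx_def by blast
  moreover have "AE x in M. f x = f' x" using ae by eventually_elim simp
  ultimately show ?thesis by (intro acd_deriv_unique)
qed

lemma W_bounded: "\<exists>B. \<forall>t\<in>{-S..S}. \<forall>x\<in>{-a..a}. cmod (W t x) \<le> B"
proof -
  have "continuous_on {-S..S} (\<lambda>t. emb (Q t))"
    by (intro continuous_at_imp_continuous_on ballI Q_cont)
  then have "bounded ((\<lambda>t. emb (Q t)) ` {-S..S})"
    by (rule compact_imp_bounded[OF compact_continuous_image[OF _ compact_Icc]])
  then obtain B where B: "\<And>t. t \<in> {-S..S} \<Longrightarrow> norm (emb (Q t)) \<le> B"
    unfolding bounded_iff by blast
  have "cmod (W t x) \<le> sqrt (2 * a) * B" if "t \<in> {-S..S}" "x \<in> {-a..a}" for t x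
  proof -
    have "cmod (W t x - W t (-a)) \<le> sqrt (2 * a) * norm (emb (Q t))"
      by (rule acd_diff_bound[OF WQ that(2)]) (use a_pos in auto)
    also have "\<dots> \<le> sqrt (2 * a) * B" using B[OF that(1)] a_pos by (intro mult_left_mono) auto
    finally show ?thesis by (simp add: W_bc)
  qed
  then show ?thesis by blast
qed

definition B :: real where "B = (SOME B. \<forall>t\<in>{-S..S}. \<forall>x\<in>{-a..a}. cmod (W t x) \<le> B)"

lemma W_le: "t \<in> {-S..S} \<Longrightarrow> x \<in> {-a..a} \<Longrightarrow> cmod (W t x) \<le> B"
  using someI_ex[OF W_bounded] unfolding B_def by blast

lemma adm_UW: "t \<in> {-S..S} \<Longrightarrow> adm d B (U t) (W t)"
  unfolding adm_def using UW W_cont U_zero V_ge W_le by blast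

lemma zlog_acd: "t \<in> {-S..S} \<Longrightarrow> acd (\<lambda>x. zlog (U t x)) (F t)"
  unfolding F_def by (rule acd_zlog[OF adm_UW d])

lemma F_L2: "t \<in> {-S..S} \<Longrightarrow> F t \<in> L2 \<Omega>"
  by (rule acdD(1)[OF zlog_acd])

text \<open>Both estimates in one predicate, so that a single constant can be fixed for the whole
  locale.\<close>

definition dzlog_lip :: "real \<Rightarrow> bool" where
  "dzlog_lip K \<longleftrightarrow> 0 \<le> K \<and>
    (\<forall>U1 W1 U2 W2. adm d B U1 W1 \<longrightarrow> adm d B U2 W2 \<longrightarrow>
      \<bar>emb (\<lambda>x. \<i> * (dzlog (U1 x) (W1 x) - dzlog (U2 x) (W2 x))) \<bullet> emb (\<lambda>x. W1 x - W2 x)\<bar>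
        \<le> K * (norm (emb (\<lambda>x. W1 x - W2 x)))\<^sup>2) \<and>
    (\<forall>U1 W1 U2 W2 e. adm d B U1 W1 \<longrightarrow> adm d B U2 W2 \<longrightarrow>
      (\<forall>x\<in>{-a..a}. cmod (W1 x - W2 x) \<le> e) \<longrightarrow>
      norm (emb (\<lambda>x. dzlog (U1 x) (W1 x) - dzlog (U2 x) (W2 x))) \<le> e * Ln + K * norm (emb (\<lambda>x. W1 x - W2 x)))"

definition K :: real where "K = (SOME K. dzlog_lip K)"

lemma dzlog_lip_K: "dzlog_lip K"
proof -
  obtain K' where K': "0 \<le> K'" and 1: "\<And>U1 W1 U2 W2. adm d B U1 W1 \<Longrightarrow> adm d B U2 W2 \<Longrightarrow>
      \<bar>emb (\<lambda>x. \<i> * (dzlog (U1 x) (W1 x) - dzlog (U2 x) (W2 x))) \<bullet> emb (\<lambda>x. W1 x - W2 x)\<bar>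
        \<le> K' * (norm (emb (\<lambda>x. W1 x - W2 x)))\<^sup>2"
    and 2: "\<And>U1 W1 U2 W2 e. adm d B U1 W1 \<Longrightarrow> adm d B U2 W2 \<Longrightarrow>
      (\<And>x. x \<in> {-a..a} \<Longrightarrow> cmod (W1 x - W2 x) \<le> e) \<Longrightarrow>
      norm (emb (\<lambda>x. dzlog (U1 x) (W1 x) - dzlog (U2 x) (W2 x))) \<le> e * Ln + K' * norm (emb (\<lambda>x. W1 x - W2 x))"
    using dzlog_diff_estimate[OF d, of B] by blast
  have "dzlog_lip K'"
    unfolding dzlog_lip_def
  proof (intro conjI allI impI)
    fix U1 W1 U2 W2 e
    assume A: "adm d B U1 W1" "adm d B U2 W2" and "\<forall>x\<in>{-a..a}. cmod (W1 x - W2 x) \<le> e"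
    then show "norm (emb (\<lambda>x. dzlog (U1 x) (W1 x) - dzlog (U2 x) (W2 x))) \<le> e * Ln + K' * norm (emb (\<lambda>x. W1 x - W2 x))"
      by (intro 2[OF A]) simp
  qed (rule K', rule 1)
  then show ?thesis unfolding K_def by (rule someI)
qed

lemma K_nonneg: "0 \<le> K" using dzlog_lip_K by (simp add: dzlog_lip_def)

lemma F_diff_inner:
  assumes "s \<in> {-S..S}" "t \<in> {-S..S}"
  shows "\<bar>emb (\<lambda>x. \<i> * (F s x - F t x)) \<bullet> emb (\<lambda>x. W s x - W t x)\<bar> \<le> K * (norm (emb (\<lambda>x. W s x - W t x)))\<^sup>2"
  using dzlog_lip_K adm_UW[OF assms(1)] adm_UW[OF assms(2)] unfolding dzlog_lip_def F_def by simp

lemma F_diff_norm: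
  assumes "s \<in> {-S..S}" "t \<in> {-S..S}"
  shows "norm (emb (F s) - emb (F t)) \<le> (sqrt (2 * a) * norm (emb (Q s) - emb (Q t))) * Ln + K * norm (emb (W s) - emb (W t))"
proof -
  have "\<forall>x\<in>{-a..a}. cmod (W s x - W t x) \<le> sqrt (2 * a) * norm (emb (Q s) - emb (Q t))"
    using W_diff_bound by blast
  then have "norm (emb (\<lambda>x. F s x - F t x)) \<le> (sqrt (2 * a) * norm (emb (Q s) - emb (Q t))) * Ln + K * norm (emb (\<lambda>x. W s x - W t x))"
    using dzlog_lip_K adm_UW[OF assms(1)] adm_UW[OF assms(2)] unfolding dzlog_lip_def F_def by simp
  then show ?thesis
    unfolding emb_diff[OF F_L2[OF assms(1)] F_L2[OF assms(2)]] emb_diff[OF acd_L2[OF WQ] acd_L2[OF WQ]] .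
qed

text \<open>The common core of the two comparisons in time; C measures the source, and the rate |l|
  K does not depend on which functions are compared.\<close>

lemma energy_gronwall:
  assumes I: "is_interval I" "t0 \<in> I" "t1 \<in> I" and C: "0 \<le> C"
    and Z: "\<And>s. acd (Z s) (Zx s)" and Zx: "\<And>s. acd (Zx s) (Zxx s)"
    and bc: "\<And>s. Zx s (-a) = 0" "\<And>s. Zx s a = 0"
    and zt: "\<And>t. t \<in> I \<Longrightarrow> zt t \<in> L2 \<Omega>"
    and der: "\<And>t. t \<in> I \<Longrightarrow> ((\<lambda>s. emb (Z s)) has_vector_derivative emb (zt t)) (at t)"
    and cont: "\<And>t. isCont (\<lambda>s. emb (Zxx s)) t"
    and R: "\<And>t. t \<in> I \<Longrightarrow> acd (R t) (Rx t)"
    and eq: "\<And>t. t \<in> I \<Longrightarrow> AE x in M. \<i> * zt t x + Zxx t x = R t x"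
    and bound: "\<And>t. t \<in> I \<Longrightarrow> \<bar>emb (\<lambda>x. \<i> * Rx t x) \<bullet> emb (Zx t)\<bar> \<le> (\<bar>l\<bar> * K) * (norm (emb (Zx t)))\<^sup>2 + C * norm (emb (Zx t))"
  shows "norm (emb (Zx t1)) \<le> exp (\<bar>l\<bar> * K * \<bar>t1 - t0\<bar>) * (norm (emb (Zx t0)) + C * \<bar>t1 - t0\<bar>)"
proof -
  define p where "p = (\<lambda>t. (norm (emb (Zx t)))\<^sup>2)"
  have dp: "(p has_real_derivative - 2 * (emb (zt t) \<bullet> emb (Zxx t))) (at t)" if "t \<in> I" for t
    unfolding p_def by (rule energy_has_derivative[OF Z Zx bc der[OF that] cont])
  have dp_le: "\<bar>- 2 * (emb (zt t) \<bullet> emb (Zxx t))\<bar> \<le> 2 * (\<bar>l\<bar> * K) * p t + 2 * C * sqrt (p t)" if "t \<in> I" for t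
  proof -
    have "- 2 * (emb (zt t) \<bullet> emb (Zxx t)) = - 2 * (emb (\<lambda>x. \<i> * Rx t x) \<bullet> emb (Zx t))"
      by (rule energy_identity[OF zt[OF that] Zx bc R[OF that] eq[OF that]])
    then show ?thesis using bound[OF that] by (simp add: p_def abs_mult)
  qed
  have "sqrt (p t1) \<le> exp (\<bar>l\<bar> * K * \<bar>t1 - t0\<bar>) * (sqrt (p t0) + C * \<bar>t1 - t0\<bar>)"
    by (rule gronwall_sqrt_abs[OF _ C I(2,3,1) _ dp dp_le]) (auto simp: p_def K_nonneg)
  then show ?thesis by (simp add: p_def)
qed

lemma W_lipschitz_at:
  assumes t0: "t0 \<in> {-S..S}" and t: "t \<in> {-S..S}" and g: "vx t0 g"
  shows "norm (emb (W t) - emb (W t0)) \<le> exp (\<bar>l\<bar> * K * \<bar>t - t0\<bar>) * (norm (emb g) * \<bar>t - t0\<bar>)"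
proof -
  obtain v' where v': "acd v' g" "AE x in M. v' x = v t0 x" using g by (auto simp: vx_def)
  define Rx where "Rx = (\<lambda>t x. complex_of_real l * (F t x - F t0 x) + \<i> * g x)"
  have Wd: "(\<lambda>x. W s x - W t0 x) \<in> L2 \<Omega>" for s by (intro L2_diff acd_L2[OF WQ])
  have "norm (emb (\<lambda>x. W t x - W t0 x)) \<le> exp (\<bar>l\<bar> * K * \<bar>t - t0\<bar>) * (norm (emb (\<lambda>x. W t0 x - W t0 x)) + norm (emb g) * \<bar>t - t0\<bar>)"
  proof (rule energy_gronwall[where I = "{-S..S}" and Z = "\<lambda>s x. U s x - U t0 x" and Zxx = "\<lambda>s x. Q s x - Q t0 x"
        and zt = v and R = "\<lambda>t x. complex_of_real l * (zlog (U t x) - zlog (U t0 x)) + \<i> * v' x" and Rx = Rx])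
    show "acd (\<lambda>x. U s x - U t0 x) (\<lambda>x. W s x - W t0 x)" for s by (rule acd_diff[OF UW UW])
    show "acd (\<lambda>x. W s x - W t0 x) (\<lambda>x. Q s x - Q t0 x)" for s by (rule acd_diff[OF WQ WQ])
    show "((\<lambda>s. emb (\<lambda>x. U s x - U t0 x)) has_vector_derivative emb (v t)) (at t)" for t
      unfolding emb_diff[OF acd_L2[OF UW] acd_L2[OF UW]]
      using has_vector_derivative_diff[OF U_der has_vector_derivative_const] by simp
    show "isCont (\<lambda>s. emb (\<lambda>x. Q s x - Q t0 x)) t" for t
      unfolding emb_diff[OF acdD(1)[OF WQ] acdD(1)[OF WQ]] by (intro continuous_intros Q_cont)
    show "acd (\<lambda>x. complex_of_real l * (zlog (U t x) - zlog (U t0 x)) + \<i> * v' x) (Rx t)" if "t \<in> {-S..S}" for t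
      unfolding Rx_def by (intro acd_add acd_cmult acd_diff zlog_acd that t0 v')
    show "AE x in M. \<i> * v t x + (Q t x - Q t0 x) = complex_of_real l * (zlog (U t x) - zlog (U t0 x)) + \<i> * v' x" for t
      using eqn[of t] eqn[of t0] v'(2) by eventually_elim (simp add: algebra_simps)
    show "\<bar>emb (\<lambda>x. \<i> * Rx t x) \<bullet> emb (\<lambda>x. W t x - W t0 x)\<bar>
      \<le> (\<bar>l\<bar> * K) * (norm (emb (\<lambda>x. W t x - W t0 x)))\<^sup>2 + norm (emb g) * norm (emb (\<lambda>x. W t x - W t0 x))"
      if t: "t \<in> {-S..S}" for t
    proof -
      have Fd: "(\<lambda>x. \<i> * (F t x - F t0 x)) \<in> L2 \<Omega>" by (intro L2_cmult L2_diff F_L2 t t0)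
      have "(\<lambda>x. \<i> * Rx t x) = (\<lambda>x. l *\<^sub>R (\<i> * (F t x - F t0 x)) + (-1) *\<^sub>R g x)"
        by (auto simp: Rx_def scaleR_conv_of_real distrib_left)
      then have "emb (\<lambda>x. \<i> * Rx t x) = l *\<^sub>R emb (\<lambda>x. \<i> * (F t x - F t0 x)) + (-1) *\<^sub>R emb g"
        by (simp only: emb_add emb_scaleR L2_scaleR Fd vx_L2[OF g])
      then have eq: "emb (\<lambda>x. \<i> * Rx t x) \<bullet> emb (\<lambda>x. W t x - W t0 x) =
          l * (emb (\<lambda>x. \<i> * (F t x - F t0 x)) \<bullet> emb (\<lambda>x. W t x - W t0 x)) - emb g \<bullet> emb (\<lambda>x. W t x - W t0 x)"
        by (simp add: inner_diff_left)
      have "\<bar>emb (\<lambda>x. \<i> * Rx t x) \<bullet> emb (\<lambda>x. W t x - W t0 x)\<bar> \<le>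
          \<bar>l\<bar> * \<bar>emb (\<lambda>x. \<i> * (F t x - F t0 x)) \<bullet> emb (\<lambda>x. W t x - W t0 x)\<bar> + \<bar>emb g \<bullet> emb (\<lambda>x. W t x - W t0 x)\<bar>"
        unfolding eq abs_mult[symmetric] by (rule abs_triangle_ineq4)
      also have "\<dots> \<le> \<bar>l\<bar> * (K * (norm (emb (\<lambda>x. W t x - W t0 x)))\<^sup>2) + norm (emb g) * norm (emb (\<lambda>x. W t x - W t0 x))"
        by (intro add_mono mult_left_mono F_diff_inner t t0 Cauchy_Schwarz_ineq2) simp
      finally show ?thesis by (simp add: mult.assoc)
    qed
  qed (use t t0 in \<open>auto simp: W_bc v_L2 is_interval_cc\<close>)
  moreover have "emb (\<lambda>x. W t0 x - W t0 x) = 0" by (simp add: emb_zero)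
  ultimately show ?thesis by (simp add: emb_diff acd_L2[OF WQ])
qed

text \<open>The equation is autonomous, so u(t + h) and u(t) solve it without any source and
  increments only grow exponentially, uniformly in h.\<close>

lemma W_shift_gronwall:
  assumes t0: "t0 \<in> {-S..S}" "t0 + h \<in> {-S..S}" and t: "t \<in> {-S..S}" "t + h \<in> {-S..S}"
  shows "norm (emb (W (t + h)) - emb (W t)) \<le> exp (\<bar>l\<bar> * K * \<bar>t - t0\<bar>) * norm (emb (W (t0 + h)) - emb (W t0))"
proof -
  \<comment> \<open>The times t for which both t and t + h lie in the window.\<close>
  define I where "I = {-S..S} \<inter> {-S - h..S - h}"
  have I: "is_interval I" unfolding I_def by (intro is_interval_Int is_interval_cc)
  have Imem: "s \<in> I \<longleftrightarrow> s \<in> {-S..S} \<and> s + h \<in> {-S..S}" for s by (auto simp: I_def)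
  define Rx where "Rx = (\<lambda>t x. complex_of_real l * (F (t + h) x - F t x))"
  have "norm (emb (\<lambda>x. W (t + h) x - W t x)) \<le> exp (\<bar>l\<bar> * K * \<bar>t - t0\<bar>) * (norm (emb (\<lambda>x. W (t0 + h) x - W t0 x)) + 0 * \<bar>t - t0\<bar>)"
  proof (rule energy_gronwall[where I = I and Z = "\<lambda>s x. U (s + h) x - U s x" and Zxx = "\<lambda>s x. Q (s + h) x - Q s x"
        and zt = "\<lambda>t x. v (t + h) x - v t x" and R = "\<lambda>t x. complex_of_real l * (zlog (U (t + h) x) - zlog (U t x))" and Rx = Rx])
    show "acd (\<lambda>x. U (s + h) x - U s x) (\<lambda>x. W (s + h) x - W s x)" for s by (rule acd_diff[OF UW UW])
    show "acd (\<lambda>x. W (s + h) x - W s x) (\<lambda>x. Q (s + h) x - Q s x)" for s by (rule acd_diff[OF WQ WQ])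
    show "(\<lambda>x. v (t + h) x - v t x) \<in> L2 \<Omega>" for t by (intro L2_diff v_L2)
    show "((\<lambda>s. emb (\<lambda>x. U (s + h) x - U s x)) has_vector_derivative emb (\<lambda>x. v (t + h) x - v t x)) (at t)" for t
    proof -
      have "((\<lambda>s. s + h) has_vector_derivative 1) (at t)" by (auto intro!: derivative_eq_intros)
      from vector_diff_chain_at[OF this U_der]
      have "((\<lambda>s. emb (U (s + h))) has_vector_derivative emb (v (t + h))) (at t)" by (simp add: o_def)
      from has_vector_derivative_diff[OF this U_der]
      show ?thesis by (simp add: emb_diff acd_L2[OF UW] v_L2)
    qed
    show "isCont (\<lambda>s. emb (\<lambda>x. Q (s + h) x - Q s x)) t" for t
    proof -
      have "isCont (\<lambda>s. emb (Q (s + h))) t"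
        by (rule isCont_o2[where g = "\<lambda>s. emb (Q s)"]) (auto intro!: continuous_intros Q_cont)
      then show ?thesis
        unfolding emb_diff[OF acdD(1)[OF WQ] acdD(1)[OF WQ]] by (intro continuous_diff Q_cont)
    qed
    show "acd (\<lambda>x. complex_of_real l * (zlog (U (t + h) x) - zlog (U t x))) (Rx t)" if "t \<in> I" for t
      unfolding Rx_def by (intro acd_cmult acd_diff zlog_acd) (use that in \<open>auto simp: Imem\<close>)
    show "AE x in M. \<i> * (v (t + h) x - v t x) + (Q (t + h) x - Q t x) = complex_of_real l * (zlog (U (t + h) x) - zlog (U t x))" for t
      using eqn[of "t + h"] eqn[of t] by eventually_elim (simp add: algebra_simps)
    show "\<bar>emb (\<lambda>x. \<i> * Rx t x) \<bullet> emb (\<lambda>x. W (t + h) x - W t x)\<bar>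
      \<le> (\<bar>l\<bar> * K) * (norm (emb (\<lambda>x. W (t + h) x - W t x)))\<^sup>2 + 0 * norm (emb (\<lambda>x. W (t + h) x - W t x))"
      if "t \<in> I" for t
    proof -
      have t: "t + h \<in> {-S..S}" "t \<in> {-S..S}" using that by (auto simp: Imem)
      have Fd: "(\<lambda>x. \<i> * (F (t + h) x - F t x)) \<in> L2 \<Omega>" by (intro L2_cmult L2_diff F_L2 t)
      have "(\<lambda>x. \<i> * Rx t x) = (\<lambda>x. l *\<^sub>R (\<i> * (F (t + h) x - F t x)))"
        by (auto simp: Rx_def scaleR_conv_of_real)
      then have "emb (\<lambda>x. \<i> * Rx t x) = l *\<^sub>R emb (\<lambda>x. \<i> * (F (t + h) x - F t x))"
        by (simp only: emb_scaleR Fd)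
      then have "\<bar>emb (\<lambda>x. \<i> * Rx t x) \<bullet> emb (\<lambda>x. W (t + h) x - W t x)\<bar>
          = \<bar>l\<bar> * \<bar>emb (\<lambda>x. \<i> * (F (t + h) x - F t x)) \<bullet> emb (\<lambda>x. W (t + h) x - W t x)\<bar>"
        by (simp add: abs_mult)
      also have "\<dots> \<le> \<bar>l\<bar> * (K * (norm (emb (\<lambda>x. W (t + h) x - W t x)))\<^sup>2)"
        by (intro mult_left_mono F_diff_inner t) simp
      finally show ?thesis by (simp add: mult.assoc)
    qed
  qed (use t t0 I in \<open>auto simp: W_bc Imem\<close>)
  then show ?thesis by (simp add: emb_diff acd_L2[OF WQ])
qed

lemma eventually_interior: "t \<in> {-S<..<S} \<Longrightarrow> \<forall>\<^sub>F h in at 0. t + h \<in> {-S..S}"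
proof -
  assume t: "t \<in> {-S<..<S}"
  have "((\<lambda>h. t + h) \<longlongrightarrow> t + 0) (at 0)" by (intro tendsto_intros)
  from topological_tendstoD[OF this, of "{-S<..<S}"] t
  show ?thesis by (auto elim!: eventually_mono)
qed

text \<open>The quotients of U at t converge to v(t) in L2. Their x-derivatives are carried back to
  t0 by the shift estimate and bounded there by g, so \<open>acd_limit\<close> yields a derivative
  of v(t).\<close>

lemma vx_transport:
  assumes t0: "t0 \<in> {-S<..<S}" and t: "t \<in> {-S<..<S}" and g: "vx t0 g" and \<eta>: "0 < \<eta>"
  obtains g' where "vx t g'" "norm (emb g') \<le> exp (\<bar>l\<bar> * K * \<bar>t - t0\<bar>) * exp \<eta> * norm (emb g)"
proof -
  define c where "c = exp (\<bar>l\<bar> * K * \<bar>t - t0\<bar>)"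
  have t0': "t0 \<in> {-S..S}" and t': "t \<in> {-S..S}" using t0 t by auto
  have quot: "((\<lambda>h. norm ((emb (U (t + h)) - emb (U t)) /\<^sub>R h - emb (v t))) \<longlongrightarrow> 0) (at 0)"
  proof -
    have "((\<lambda>s. norm ((emb (U s) - emb (U t)) /\<^sub>R (s - t) - emb (v t))) \<longlongrightarrow> 0) (at t)"
      using U_der[of t] by (simp only: has_vector_derivative_iff_quotient)
    then show ?thesis by (subst (asm) LIM_offset_zero_iff) simp_all
  qed
  obtain f' g' where fg: "acd f' g'" "AE x in M. f' x = v t x" "norm (emb g') \<le> c * exp \<eta> * norm (emb g)"
  proof (rule acd_limit[OF v_L2, of t "c * exp \<eta> * norm (emb g)"])
    fix e :: real assume "e > 0"
    have "\<forall>\<^sub>F h in at 0. norm ((emb (U (t + h)) - emb (U t)) /\<^sub>R h - emb (v t)) < e"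
      using order_tendstoD(2)[OF quot \<open>e > 0\<close>] .
    moreover have "\<forall>\<^sub>F h in at 0. \<bar>l\<bar> * K * \<bar>h\<bar> < \<eta>"
    proof -
      have "((\<lambda>h. \<bar>l\<bar> * K * \<bar>h\<bar>) \<longlongrightarrow> \<bar>l\<bar> * K * \<bar>0\<bar>) (at 0)" by (intro tendsto_intros)
      then show ?thesis using order_tendstoD(2)[of _ "0" "at 0" \<eta>] \<eta> by simp
    qed
    moreover have "\<forall>\<^sub>F h :: real in at 0. h \<noteq> 0" by (simp add: eventually_at_filter)
    ultimately have "\<forall>\<^sub>F h in at 0. norm ((emb (U (t + h)) - emb (U t)) /\<^sub>R h - emb (v t)) < e
        \<and> \<bar>l\<bar> * K * \<bar>h\<bar> < \<eta> \<and> h \<noteq> 0 \<and> t + h \<in> {-S..S} \<and> t0 + h \<in> {-S..S}"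
      using eventually_interior[OF t] eventually_interior[OF t0] by eventually_elim simp
    then obtain h where h: "norm ((emb (U (t + h)) - emb (U t)) /\<^sub>R h - emb (v t)) < e"
        "\<bar>l\<bar> * K * \<bar>h\<bar> < \<eta>" "h \<noteq> 0" "t + h \<in> {-S..S}" "t0 + h \<in> {-S..S}"
      using eventually_happens'[OF at_neq_bot] by blast
    define f' where "f' = (\<lambda>x. complex_of_real (inverse h) * (U (t + h) x - U t x))"
    define g' where "g' = (\<lambda>x. complex_of_real (inverse h) * (W (t + h) x - W t x))"
    have fg: "acd f' g'" unfolding f'_def g'_def by (intro acd_cmult acd_diff UW)
    have ef: "emb f' = (emb (U (t + h)) - emb (U t)) /\<^sub>R h"
      unfolding f'_def scaleR_conv_of_real[symmetric] by (simp only: emb_scaleR emb_diff L2_diff acd_L2[OF UW])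
    have eg: "emb g' = (emb (W (t + h)) - emb (W t)) /\<^sub>R h"
      unfolding g'_def scaleR_conv_of_real[symmetric] by (simp only: emb_scaleR emb_diff L2_diff acd_L2[OF WQ])
    have "norm (emb (W (t + h)) - emb (W t)) \<le> c * norm (emb (W (t0 + h)) - emb (W t0))"
      unfolding c_def by (rule W_shift_gronwall[OF t0' h(5) t' h(4)])
    also have "\<dots> \<le> c * (exp (\<bar>l\<bar> * K * \<bar>h\<bar>) * (norm (emb g) * \<bar>h\<bar>))"
      using W_lipschitz_at[OF t0' h(5) g] by (intro mult_left_mono) (auto simp: c_def)
    \<comment> \<open>A bound independent of h is required; for small h the loss exp(|l| K |h|) is
      absorbed by exp \<open>\<eta>\<close>.\<close>
    also have "\<dots> \<le> c * (exp \<eta> * (norm (emb g) * \<bar>h\<bar>))"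
      using h(2) by (intro mult_left_mono mult_right_mono) (auto simp: c_def)
    finally have "norm (emb (W (t + h)) - emb (W t)) / \<bar>h\<bar> \<le> c * (exp \<eta> * (norm (emb g) * \<bar>h\<bar>)) / \<bar>h\<bar>"
      by (rule divide_right_mono) simp
    moreover have "norm (emb g') = norm (emb (W (t + h)) - emb (W t)) / \<bar>h\<bar>"
      unfolding eg norm_scaleR by (simp add: divide_inverse_commute)
    ultimately have "norm (emb g') \<le> c * exp \<eta> * norm (emb g)"
      using h(3) by (simp add: mult.assoc)
    then show "\<exists>f' g'. acd f' g' \<and> norm (emb f' - emb (v t)) < e \<and> norm (emb g') \<le> c * exp \<eta> * norm (emb g)"
      using fg h(1) unfolding ef[symmetric] by blast
  qed blast
  then show ?thesis using that unfolding vx_def c_def by blast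
qed

text \<open>The equation at time 0 writes v as -i (l zlog(U) - Q), and here both terms are
  absolutely continuous, the second by the H3 regularity of the datum.\<close>

lemma vx_0: "\<exists>g. vx 0 g"
proof -
  have 0: "0 \<in> {-S..S}" using S by simp
  have "acd (\<lambda>x. - \<i> * (complex_of_real l * zlog (U 0 x) - Q0 x)) (\<lambda>x. - \<i> * (complex_of_real l * F 0 x - P0 x))"
    by (intro acd_cmult acd_diff zlog_acd 0 Q0P0)
  moreover have "AE x in M. - \<i> * (complex_of_real l * zlog (U 0 x) - Q0 x) = v 0 x"
    using eqn[of 0] Q0
  proof eventually_elim
    fix x assume "\<i> * v 0 x + Q 0 x = complex_of_real l * zlog (U 0 x)" "Q0 x = Q 0 x"
    then have "complex_of_real l * zlog (U 0 x) - Q0 x = \<i> * v 0 x" by (simp add: algebra_simps)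
    then show "- \<i> * (complex_of_real l * zlog (U 0 x) - Q0 x) = v 0 x" by simp
  qed
  ultimately show ?thesis unfolding vx_def by blast
qed

section \<open>Strong continuity of the mixed derivative\<close>

definition v_x :: "real \<Rightarrow> real \<Rightarrow> complex" where "v_x t = (SOME g. vx t g)"

lemma vx_v_x: assumes "t \<in> {-S<..<S}" shows "vx t (v_x t)"
proof -
  obtain g where "vx 0 g" using vx_0 by blast
  then have "\<exists>g. vx t g" using vx_transport[of 0 t g 1] S assms by auto
  then show ?thesis unfolding v_x_def by (rule someI_ex)
qed

text \<open>By uniqueness the left side does not depend on \<open>\<eta>\<close>, so the loss exp
  \<open>\<eta>\<close> is removed by letting \<open>\<eta>\<close> tend to 0.\<close>

lemma v_x_growth:
  assumes "t0 \<in> {-S<..<S}" "t \<in> {-S<..<S}"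
  shows "norm (emb (v_x t)) \<le> exp (\<bar>l\<bar> * K * \<bar>t - t0\<bar>) * norm (emb (v_x t0))"
proof -
  define A where "A = exp (\<bar>l\<bar> * K * \<bar>t - t0\<bar>) * norm (emb (v_x t0))"
  have "norm (emb (v_x t)) \<le> A * exp \<eta>" if \<eta>: "0 < \<eta>" for \<eta>
  proof -
    obtain g' where "vx t g'" "norm (emb g') \<le> exp (\<bar>l\<bar> * K * \<bar>t - t0\<bar>) * exp \<eta> * norm (emb (v_x t0))"
      using vx_transport[OF assms vx_v_x[OF assms(1)] \<eta>] by blast
    then show ?thesis using vx_unique[OF _ vx_v_x[OF assms(2)]] by (simp add: A_def mult_ac)
  qed
  then have "\<forall>\<^sub>F \<eta> in at_right 0. norm (emb (v_x t)) \<le> A * exp \<eta>"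
    by (intro eventually_at_right_less[THEN eventually_mono])
  moreover have "((\<lambda>\<eta>. A * exp \<eta>) \<longlongrightarrow> A * exp 0) (at_right 0)" by (intro tendsto_intros)
  ultimately have "norm (emb (v_x t)) \<le> A * exp 0"
    by (intro tendsto_lowerbound[of _ _ "at_right 0"]) auto
  then show ?thesis by (simp add: A_def)
qed

text \<open>The growth estimate from t to s bounds the norm from above, the one from s to t from
  below.\<close>

lemma norm_v_x_tendsto:
  assumes t: "t \<in> {-S<..<S}" shows "((\<lambda>s. norm (emb (v_x s))) \<longlongrightarrow> norm (emb (v_x t))) (at t)"
proof (rule tendsto_sandwich)
  have ev: "\<forall>\<^sub>F s in at t. s \<in> {-S<..<S}" by (rule eventually_at_in_open') (use t in auto)
  show "\<forall>\<^sub>F s in at t. norm (emb (v_x s)) \<le> exp (\<bar>l\<bar> * K * \<bar>s - t\<bar>) * norm (emb (v_x t))"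
    using ev by (rule eventually_mono) (rule v_x_growth[OF t])
  show "\<forall>\<^sub>F s in at t. norm (emb (v_x t)) / exp (\<bar>l\<bar> * K * \<bar>t - s\<bar>) \<le> norm (emb (v_x s))"
    using ev by (rule eventually_mono) (use v_x_growth[OF _ t] in \<open>simp add: divide_le_eq mult.commute\<close>)
  have "((\<lambda>s. exp (\<bar>l\<bar> * K * \<bar>s - t\<bar>) * norm (emb (v_x t))) \<longlongrightarrow> exp (\<bar>l\<bar> * K * \<bar>t - t\<bar>) * norm (emb (v_x t))) (at t)"
    by (intro tendsto_intros)
  then show "((\<lambda>s. exp (\<bar>l\<bar> * K * \<bar>s - t\<bar>) * norm (emb (v_x t))) \<longlongrightarrow> norm (emb (v_x t))) (at t)" by simp
  have "((\<lambda>s. norm (emb (v_x t)) / exp (\<bar>l\<bar> * K * \<bar>t - s\<bar>)) \<longlongrightarrow> norm (emb (v_x t)) / exp (\<bar>l\<bar> * K * \<bar>t - t\<bar>)) (at t)"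
    by (intro tendsto_intros) auto
  then show "((\<lambda>s. norm (emb (v_x t)) / exp (\<bar>l\<bar> * K * \<bar>t - s\<bar>)) \<longlongrightarrow> norm (emb (v_x t))) (at t)" by simp
qed

lemma W_tendsto: "((\<lambda>s. norm (emb (W s) - emb (W t))) \<longlongrightarrow> 0) (at t)"
proof (rule Lim_null_comparison)
  show "\<forall>\<^sub>F s in at t. norm (norm (emb (W s) - emb (W t))) \<le> (sqrt (2 * a) * norm (emb (\<lambda>_. 1))) * norm (emb (Q s) - emb (Q t))"
    using emb_W_diff_bound by (auto intro!: always_eventually)
  show "((\<lambda>s. (sqrt (2 * a) * norm (emb (\<lambda>_. 1))) * norm (emb (Q s) - emb (Q t))) \<longlongrightarrow> 0) (at t)"
    by (rule tendsto_mult_right_zero[OF Q_tendsto])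
qed

lemma F_tendsto:
  assumes t: "t \<in> {-S<..<S}" shows "((\<lambda>s. norm (emb (F s) - emb (F t))) \<longlongrightarrow> 0) (at t)"
proof (rule Lim_null_comparison)
  have ev: "\<forall>\<^sub>F s in at t. s \<in> {-S<..<S}" by (rule eventually_at_in_open') (use t in auto)
  then show "\<forall>\<^sub>F s in at t. norm (norm (emb (F s) - emb (F t))) \<le>
      (sqrt (2 * a) * norm (emb (Q s) - emb (Q t))) * Ln + K * norm (emb (W s) - emb (W t))"
    by (rule eventually_mono) (use t F_diff_norm in auto)
  have "((\<lambda>s. (sqrt (2 * a) * norm (emb (Q s) - emb (Q t))) * Ln + K * norm (emb (W s) - emb (W t))) \<longlongrightarrow>
     (sqrt (2 * a) * 0) * Ln + K * 0) (at t)"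
    by (intro tendsto_intros Q_tendsto W_tendsto)
  then show "((\<lambda>s. (sqrt (2 * a) * norm (emb (Q s) - emb (Q t))) * Ln + K * norm (emb (W s) - emb (W t))) \<longlongrightarrow> 0) (at t)"
    by simp
qed

text \<open>The equation expresses v through Q and \<open>zlog\<close> of U. As \<open>zlog\<close>
  is not Lipschitz, its difference is controlled through its x-derivative F instead.\<close>

lemma v_tendsto:
  assumes t: "t \<in> {-S<..<S}" shows "((\<lambda>s. emb (v s)) \<longlongrightarrow> emb (v t)) (at t)"
proof (rule LIM_zero_cancel, rule Lim_null_comparison)
  define c where "c = \<bar>l\<bar> * (sqrt (2 * a) * norm (emb (\<lambda>_. 1)))"
  have ev: "\<forall>\<^sub>F s in at t. s \<in> {-S<..<S}" by (rule eventually_at_in_open') (use t in auto)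
  then show "\<forall>\<^sub>F s in at t. norm (emb (v s) - emb (v t)) \<le> c * norm (emb (F s) - emb (F t)) + norm (emb (Q s) - emb (Q t))"
  proof (rule eventually_mono)
    fix s assume "s \<in> {-S<..<S}"
    then have s: "s \<in> {-S..S}" and t': "t \<in> {-S..S}" using t by auto
    define z where "z = (\<lambda>x. zlog (U s x) - zlog (U t x))"
    have z: "acd z (\<lambda>x. F s x - F t x)" unfolding z_def by (intro acd_diff zlog_acd s t')
    have zL: "z \<in> L2 \<Omega>" by (rule acd_L2[OF z])
    have QL: "(\<lambda>x. Q s x - Q t x) \<in> L2 \<Omega>" by (intro L2_diff acdD(1)[OF WQ])
    have nz: "norm (emb z) \<le> (sqrt (2 * a) * norm (emb (F s) - emb (F t))) * norm (emb (\<lambda>_. 1))"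
    proof (rule norm_emb_mono[OF L2_const zL])
      \<comment> \<open>Oddness supplies the common zero from which the x-derivative controls z
        uniformly.\<close>
      have z0: "z 0 = 0" by (simp add: z_def U_zero)
      have "cmod (z x) \<le> sqrt (2 * a) * norm (emb (F s) - emb (F t))" if "x \<in> {-a..a}" for x
      proof -
        have "cmod (z x - z 0) \<le> sqrt (2 * a) * norm (emb (\<lambda>x. F s x - F t x))"
          by (rule acd_diff_bound[OF z that]) (use a_pos in auto)
        then show ?thesis by (simp only: z0 diff_zero emb_diff[OF F_L2[OF s] F_L2[OF t']])
      qed
      then show "AE x in M. cmod (z x) \<le> sqrt (2 * a) * norm (emb (F s) - emb (F t)) * cmod 1"
        by (intro AE_M_I) auto
    qed (use a_pos in auto)
    have "AE x in M. v s x - v t x = (- \<i>) * (l *\<^sub>R z x - (Q s x - Q t x))"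
      using eqn[of s] eqn[of t]
    proof eventually_elim
      fix x assume e: "\<i> * v s x + Q s x = complex_of_real l * zlog (U s x)"
        "\<i> * v t x + Q t x = complex_of_real l * zlog (U t x)"
      have "l *\<^sub>R z x - (Q s x - Q t x) = \<i> * (v s x - v t x)"
        unfolding z_def scaleR_conv_of_real right_diff_distrib e[symmetric] by simp
      then show "v s x - v t x = (- \<i>) * (l *\<^sub>R z x - (Q s x - Q t x))" by simp
    qed
    from emb_cong_AE[OF L2_diff[OF v_L2 v_L2] this]
    have "norm (emb (v s) - emb (v t)) = norm (emb (\<lambda>x. (- \<i>) * (l *\<^sub>R z x - (Q s x - Q t x))))"
      by (simp add: emb_diff v_L2)
    also have "\<dots> = norm (l *\<^sub>R emb z - (emb (Q s) - emb (Q t)))"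
      unfolding norm_emb_cmult[OF L2_diff[OF L2_scaleR[OF zL] QL]]
      by (simp add: emb_diff emb_scaleR L2_scaleR zL QL acdD(1)[OF WQ])
    also have "\<dots> \<le> norm (l *\<^sub>R emb z) + norm (emb (Q s) - emb (Q t))" by (rule norm_triangle_ineq4)
    also have "\<dots> \<le> c * norm (emb (F s) - emb (F t)) + norm (emb (Q s) - emb (Q t))"
      using mult_left_mono[OF nz, of "\<bar>l\<bar>"] by (simp add: c_def mult_ac)
    finally show "norm (emb (v s) - emb (v t)) \<le> c * norm (emb (F s) - emb (F t)) + norm (emb (Q s) - emb (Q t))" .
  qed
  have "((\<lambda>s. c * norm (emb (F s) - emb (F t)) + norm (emb (Q s) - emb (Q t))) \<longlongrightarrow> c * 0 + 0) (at t)"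
    by (intro tendsto_intros F_tendsto Q_tendsto t)
  then show "((\<lambda>s. c * norm (emb (F s) - emb (F t)) + norm (emb (Q s) - emb (Q t))) \<longlongrightarrow> 0) (at t)" by simp
qed

text \<open>Strong continuity from continuity of the norm and lower semicontinuity along midpoints.\<close>

lemma v_x_tendsto:
  assumes t: "t \<in> {-S<..<S}" shows "((\<lambda>s. norm (emb (v_x s) - emb (v_x t))) \<longlongrightarrow> 0) (at t)"
proof -
  define A where "A = (\<lambda>s. norm (emb (v_x s)))"
  \<comment> \<open>The norms of the midpoints: once they tend to the norm at t, the parallelogram
    law forces the differences to 0.\<close>
  define X where "X = (\<lambda>s. norm ((1/2) *\<^sub>R (emb (v_x s) + emb (v_x t))))"
  have ev: "\<forall>\<^sub>F s in at t. s \<in> {-S<..<S}" by (rule eventually_at_in_open') (use t in auto)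
  have AA: "(A \<longlongrightarrow> A t) (at t)" unfolding A_def by (rule norm_v_x_tendsto[OF t])
  have "(X \<longlongrightarrow> A t) (at t)"
  proof (rule order_tendstoI)
    fix b assume "A t < b"
    have "((\<lambda>s. (A s + A t) / 2) \<longlongrightarrow> (A t + A t) / 2) (at t)" by (intro tendsto_intros AA) simp
    then have "\<forall>\<^sub>F s in at t. (A s + A t) / 2 < b" using \<open>A t < b\<close> by (intro order_tendstoD(2)) auto
    then show "\<forall>\<^sub>F s in at t. X s < b"
    proof (rule eventually_mono)
      fix s assume "(A s + A t) / 2 < b"
      moreover have "X s \<le> (A s + A t) / 2"
        using norm_triangle_ineq[of "emb (v_x s)" "emb (v_x t)"] by (simp add: X_def A_def)
      ultimately show "X s < b" by linarith
    qed
  next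
    fix b assume b: "b < A t"
    show "\<forall>\<^sub>F s in at t. b < X s"
    \<comment> \<open>Midpoints with norm at most b arbitrarily close to t would, in the limit, give
      v(t) an x-derivative of norm at most b < A t, against uniqueness.\<close>
    proof (rule ccontr)
      assume "\<not> (\<forall>\<^sub>F s in at t. b < X s)"
      then have freq: "\<exists>\<^sub>F s in at t. X s \<le> b" by (simp add: frequently_def not_le)
      obtain h g where hg: "acd h g" "AE x in M. h x = v t x" "norm (emb g) \<le> b"
      proof (rule acd_limit[OF v_L2, of t b])
        fix e :: real assume "e > 0"
        have "((\<lambda>s. (1/2) *\<^sub>R (emb (v s) - emb (v t))) \<longlongrightarrow> (1/2) *\<^sub>R (emb (v t) - emb (v t))) (at t)"
          by (intro tendsto_intros v_tendsto[OF t])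
        then have "((\<lambda>s. norm ((1/2) *\<^sub>R (emb (v s) - emb (v t)))) \<longlongrightarrow> 0) (at t)"
          by (intro tendsto_norm_zero) simp
        from eventually_conj[OF order_tendstoD(2)[OF this \<open>e > 0\<close>] ev]
        have "\<forall>\<^sub>F s in at t. norm ((1/2) *\<^sub>R (emb (v s) - emb (v t))) < e \<and> s \<in> {-S<..<S}" .
        then have "\<exists>s. X s \<le> b \<and> norm ((1/2) *\<^sub>R (emb (v s) - emb (v t))) < e \<and> s \<in> {-S<..<S}"
          using frequently_ex[OF frequently_eventually_frequently[OF freq]] by blast
        then obtain s where s: "X s \<le> b" "norm ((1/2) *\<^sub>R (emb (v s) - emb (v t))) < e" "s \<in> {-S<..<S}" by blast
        obtain f1 where f1: "acd f1 (v_x s)" "AE x in M. f1 x = v s x" using vx_v_x[OF s(3)] by (auto simp: vx_def)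
        obtain f2 where f2: "acd f2 (v_x t)" "AE x in M. f2 x = v t x" using vx_v_x[OF t] by (auto simp: vx_def)
        have e1: "emb f1 = emb (v s)" "emb f2 = emb (v t)"
          using emb_cong_AE[OF acd_L2[OF f1(1)] f1(2)] emb_cong_AE[OF acd_L2[OF f2(1)] f2(2)] by auto
        have half: "(\<lambda>x. complex_of_real (1/2) * (p x + q x)) = (\<lambda>x. (1/2) *\<^sub>R (p x + q x))" for p q :: "real \<Rightarrow> complex"
          by (simp add: scaleR_conv_of_real)
        have "acd (\<lambda>x. (1/2) *\<^sub>R (f1 x + f2 x)) (\<lambda>x. (1/2) *\<^sub>R (v_x s x + v_x t x))"
          unfolding half[symmetric] by (intro acd_cmult acd_add f1 f2)
        moreover have "emb (\<lambda>x. (1/2) *\<^sub>R (f1 x + f2 x)) - emb (v t) = (1/2) *\<^sub>R (emb (v s) - emb (v t))"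
        proof -
          have "emb (\<lambda>x. (1/2) *\<^sub>R (f1 x + f2 x)) = (1/2) *\<^sub>R (emb (v s) + emb (v t))"
            by (simp only: emb_scaleR emb_add L2_add acd_L2[OF f1(1)] acd_L2[OF f2(1)] e1)
          moreover have "(1/2) *\<^sub>R (y + z) - z = (1/2) *\<^sub>R (y - z)" for y z :: l2
          proof -
            have "(1/2) *\<^sub>R (y + z) - z = (1/2) *\<^sub>R (y + z) - ((1/2) *\<^sub>R z + (1/2) *\<^sub>R z)"
              by (simp flip: scaleR_add_left)
            then show ?thesis by (simp add: scaleR_add_right scaleR_diff_right)
          qed
          ultimately show ?thesis by simp
        qed
        moreover have "norm (emb (\<lambda>x. (1/2) *\<^sub>R (v_x s x + v_x t x))) \<le> b"
          using s(1) unfolding X_def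
          by (simp only: emb_scaleR emb_add L2_add vx_L2[OF vx_v_x[OF s(3)]] vx_L2[OF vx_v_x[OF t]])
        ultimately show "\<exists>f' g'. acd f' g' \<and> norm (emb f' - emb (v t)) < e \<and> norm (emb g') \<le> b"
          using s(2) by metis
      qed blast
      then have "vx t g" by (auto simp: vx_def)
      then have "emb g = emb (v_x t)" by (rule vx_unique[OF _ vx_v_x[OF t]])
      then show False using hg(3) b by (simp add: A_def)
    qed
  qed
  then have "((\<lambda>s. 2 * (A s)\<^sup>2 + 2 * (A t)\<^sup>2 - 4 * (X s)\<^sup>2) \<longlongrightarrow> 2 * (A t)\<^sup>2 + 2 * (A t)\<^sup>2 - 4 * (A t)\<^sup>2) (at t)"
    by (intro tendsto_intros AA)
  moreover have "2 * (A s)\<^sup>2 + 2 * (A t)\<^sup>2 - 4 * (X s)\<^sup>2 = (norm (emb (v_x s) - emb (v_x t)))\<^sup>2" for s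
  proof -
    have "(norm (p - q))\<^sup>2 = 2 * (norm p)\<^sup>2 + 2 * (norm q)\<^sup>2 - (norm (p + q))\<^sup>2" for p q :: l2
      by (simp add: power2_norm_eq_inner algebra_simps inner_commute)
    moreover have "4 * (X s)\<^sup>2 = (norm (emb (v_x s) + emb (v_x t)))\<^sup>2" by (simp add: X_def power_divide)
    ultimately show ?thesis by (simp add: A_def)
  qed
  ultimately have "((\<lambda>s. (norm (emb (v_x s) - emb (v_x t)))\<^sup>2) \<longlongrightarrow> 0) (at t)" by simp
  from tendsto_real_sqrt[OF this] show ?thesis by simp
qed

text \<open>The third x-derivative of u, read off from the x-derivative of the equation.\<close>

definition P :: "real \<Rightarrow> real \<Rightarrow> complex" where
  "P t x = complex_of_real l * F t x - \<i> * v_x t x"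

lemma acd_P:
  assumes "t \<in> {-S<..<S}"
  obtains Q' where "acd Q' (P t)" "AE x in M. Q' x = Q t x"
proof -
  have t: "t \<in> {-S..S}" using assms by auto
  obtain v' where v': "acd v' (v_x t)" "AE x in M. v' x = v t x" using vx_v_x[OF assms] by (auto simp: vx_def)
  show ?thesis
  proof (rule that)
    show "acd (\<lambda>x. complex_of_real l * zlog (U t x) - \<i> * v' x) (P t)"
      unfolding P_def[abs_def] by (intro acd_diff acd_cmult zlog_acd t v')
    show "AE x in M. complex_of_real l * zlog (U t x) - \<i> * v' x = Q t x"
      using eqn[of t] v'(2) by eventually_elim (simp add: algebra_simps)
  qed
qed

lemma P_tendsto:
  assumes t: "t \<in> {-S<..<S}" shows "((\<lambda>s. norm (emb (P s) - emb (P t))) \<longlongrightarrow> 0) (at t)"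
proof (rule Lim_null_comparison)
  have ev: "\<forall>\<^sub>F s in at t. s \<in> {-S<..<S}" by (rule eventually_at_in_open') (use t in auto)
  then show "\<forall>\<^sub>F s in at t. norm (norm (emb (P s) - emb (P t))) \<le> \<bar>l\<bar> * norm (emb (F s) - emb (F t)) + norm (emb (v_x s) - emb (v_x t))"
  proof (rule eventually_mono)
    fix s assume s: "s \<in> {-S<..<S}"
    have FL: "(\<lambda>x. F s x - F t x) \<in> L2 \<Omega>" by (intro L2_diff F_L2) (use s t in auto)
    have gL: "(\<lambda>x. v_x s x - v_x t x) \<in> L2 \<Omega>" by (intro L2_diff vx_L2[OF vx_v_x] s t)
    have PL: "P s \<in> L2 \<Omega>" "P t \<in> L2 \<Omega>" using acd_P[OF s] acd_P[OF t] acdD(1) by metis+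
    have "(\<lambda>x. P s x - P t x) = (\<lambda>x. l *\<^sub>R (F s x - F t x) - \<i> * (v_x s x - v_x t x))"
      by (auto simp: P_def scaleR_conv_of_real algebra_simps)
    then have "emb (P s) - emb (P t) = l *\<^sub>R emb (\<lambda>x. F s x - F t x) - emb (\<lambda>x. \<i> * (v_x s x - v_x t x))"
      by (simp only: emb_diff[OF PL, symmetric] emb_diff[OF L2_scaleR[OF FL] L2_cmult[OF gL]] emb_scaleR[OF FL])
    then have "norm (emb (P s) - emb (P t)) \<le> norm (l *\<^sub>R emb (\<lambda>x. F s x - F t x)) + norm (emb (\<lambda>x. \<i> * (v_x s x - v_x t x)))"
      by (simp only: norm_triangle_ineq4)
    also have "\<dots> = \<bar>l\<bar> * norm (emb (\<lambda>x. F s x - F t x)) + norm (emb (\<lambda>x. v_x s x - v_x t x))"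
      by (simp add: norm_emb_cmult[OF gL])
    also have "emb (\<lambda>x. F s x - F t x) = emb (F s) - emb (F t)" by (intro emb_diff F_L2) (use s t in auto)
    also have "emb (\<lambda>x. v_x s x - v_x t x) = emb (v_x s) - emb (v_x t)" by (intro emb_diff vx_L2[OF vx_v_x] s t)
    finally show "norm (norm (emb (P s) - emb (P t))) \<le> \<bar>l\<bar> * norm (emb (F s) - emb (F t)) + norm (emb (v_x s) - emb (v_x t))" by simp
  qed
  have "((\<lambda>s. \<bar>l\<bar> * norm (emb (F s) - emb (F t)) + norm (emb (v_x s) - emb (v_x t))) \<longlongrightarrow> \<bar>l\<bar> * 0 + 0) (at t)"
    by (intro tendsto_intros F_tendsto v_x_tendsto t)
  then show "((\<lambda>s. \<bar>l\<bar> * norm (emb (F s) - emb (F t)) + norm (emb (v_x s) - emb (v_x t))) \<longlongrightarrow> 0) (at t)" by simp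
qed

end

section \<open>The maximal time\<close>

context symm_interval
begin

lemma avg_cong:
  assumes "x \<in> {-a..a}" "\<And>y. y \<in> {-a..a} \<Longrightarrow> f y = g y" shows "avg f x = avg g x"
  unfolding avg_def
  by (rule Bochner_Integration.integral_cong[OF refl]) (use assms scale_mem in auto)

lemma avg_at_0: "avg f 0 = f 0"
  by (simp add: avg_def measure_restrict_space)

lemma Hs_norm_nonneg: "0 \<le> Hs_norm \<Omega> k f"
  unfolding Hs_norm_def by (intro real_sqrt_ge_zero sum_nonneg) auto

lemma ge_on_closure:
  assumes f: "continuous_on {-a..a} (f :: real \<Rightarrow> complex)" and ge: "\<And>x. x \<in> \<Omega> \<Longrightarrow> d \<le> cmod (f x)"
    and x: "x \<in> {-a..a}"
  shows "d \<le> cmod (f x)"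
proof -
  have cl: "closure \<Omega> = {-a..a}" using a_pos by simp
  have "continuous_on (closure \<Omega>) (\<lambda>x. cmod (f x))" unfolding cl by (intro continuous_intros f)
  then show ?thesis
    by (rule continuous_ge_on_closure) (use ge x cl in auto)
qed

end

context log_nls_flow
begin

text \<open>H2 continuity makes W, and hence its averages, uniformly close in x, so half of the
  lower bound survives nearby.\<close>

lemma nondegenerate_near:
  assumes "0 < d" and V: "\<And>x. x \<in> {-a..a} \<Longrightarrow> d \<le> cmod (avg (W t) x)"
  obtains e where "0 < e" "\<And>s x. \<bar>s - t\<bar> < e \<Longrightarrow> x \<in> {-a..a} \<Longrightarrow> d / 2 \<le> cmod (avg (W s) x)"
proof -
  have "((\<lambda>s. sqrt (2 * a) * norm (emb (Q s) - emb (Q t))) \<longlongrightarrow> 0) (at t)"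
    by (rule tendsto_mult_right_zero[OF Q_tendsto])
  then have "\<forall>\<^sub>F s in at t. sqrt (2 * a) * norm (emb (Q s) - emb (Q t)) < d / 2"
    using \<open>0 < d\<close> by (intro order_tendstoD(2)) auto
  then obtain e where e: "0 < e" "\<And>s. s \<noteq> t \<Longrightarrow> dist s t < e \<Longrightarrow> sqrt (2 * a) * norm (emb (Q s) - emb (Q t)) < d / 2"
    unfolding eventually_at by auto
  show ?thesis
  proof (rule that[OF e(1)])
    fix s x assume s: "\<bar>s - t\<bar> < e" and x: "x \<in> {-a..a}"
    have "sqrt (2 * a) * norm (emb (Q s) - emb (Q t)) \<le> d / 2"
      using e(2)[of s] s \<open>0 < d\<close> by (cases "s = t") (auto simp: dist_real_def less_imp_le)
    then have "cmod (W s y - W t y) \<le> d / 2" if "y \<in> {-a..a}" for y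
      using W_diff_bound[OF that, of s t] by linarith
    then have "cmod (avg (\<lambda>y. W s y - W t y) x) \<le> d / 2"
      by (intro avg_bound x continuous_on_diff W_cont)
    then have "cmod (avg (W s) x - avg (W t) x) \<le> d / 2" by (simp add: avg_diff[OF W_cont W_cont x])
    moreover have "cmod (avg (W t) x) \<le> cmod (avg (W s) x) + cmod (avg (W s) x - avg (W t) x)"
      using norm_triangle_sub[of "avg (W t) x" "avg (W s) x"] by (simp add: norm_minus_commute)
    ultimately show "d / 2 \<le> cmod (avg (W s) x)" using V[OF x] by linarith
  qed
qed

lemma cont_into_H3:
  assumes u: "\<And>t. AE x in M. U t x = u t x"
    and reg: "acd Q0 P0" "AE x in M. Q0 x = Q 0 x"
    and S: "0 < S" and d: "0 < d"
    and V: "\<And>t x. t \<in> {-S..S} \<Longrightarrow> x \<in> {-a..a} \<Longrightarrow> d \<le> cmod (avg (W t) x)"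
  shows "cont_into_Hs \<Omega> 3 {-S<..<S} u"
proof -
  interpret nondegenerate_flow a l U W Q v S d Q0 P0
    by unfold_locales (use assms in auto)
  \<comment> \<open>Q(t) is just some L2 representative; it is replaced by an absolutely continuous
    one with the same class in \<open>l2\<close>.\<close>
  have ex: "\<exists>Q'. acd (W t) Q' \<and> acd Q' (P t) \<and> emb Q' = emb (Q t)" if t: "t \<in> {-S<..<S}" for t
  proof -
    obtain Q' where Q': "acd Q' (P t)" "AE x in M. Q' x = Q t x" using acd_P[OF t] by blast
    have "acd (W t) Q'" by (rule acd_cong[OF WQ]) (use Q'(2) in \<open>auto elim: eventually_mono\<close>)
    then show ?thesis using Q' emb_cong_AE[OF acd_L2[OF Q'(1)] Q'(2)] by blast
  qed
  then obtain Q' where Q': "\<And>t. t \<in> {-S<..<S} \<Longrightarrow> acd (W t) (Q' t)" "\<And>t. t \<in> {-S<..<S} \<Longrightarrow> acd (Q' t) (P t)"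
    "\<And>t. t \<in> {-S<..<S} \<Longrightarrow> emb (Q' t) = emb (Q t)" by metis
  show ?thesis
    unfolding cont_into_Hs_def
  proof (intro conjI ballI)
    fix t assume t: "t \<in> {-S<..<S}"
    show "u t \<in> Hs \<Omega> 3" unfolding Hs_3_iff using UW Q'(1)[OF t] Q'(2)[OF t] u by blast
    define N where "N = (\<lambda>s. (norm (emb (U s) - emb (U t)))\<^sup>2 + (norm (emb (W s) - emb (W t)))\<^sup>2
      + (norm (emb (Q s) - emb (Q t)))\<^sup>2 + (norm (emb (P s) - emb (P t)))\<^sup>2)"
    have ev: "\<forall>\<^sub>F s in at t. s \<in> {-S<..<S}" by (rule eventually_at_in_open') (use t in auto)
    then have eq: "\<forall>\<^sub>F s in at t. sqrt (N s) = Hs_norm \<Omega> 3 (\<lambda>x. u s x - u t x)"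
    proof (rule eventually_mono)
      fix s assume s: "s \<in> {-S<..<S}"
      have "AE x in M. U s x - U t x = u s x - u t x" using u[of s] u[of t] by eventually_elim simp
      from Hs_norm_3[OF acd_diff[OF UW UW] acd_diff[OF Q'(1)[OF s] Q'(1)[OF t]] acd_diff[OF Q'(2)[OF s] Q'(2)[OF t]] this]
      have "(Hs_norm \<Omega> 3 (\<lambda>x. u s x - u t x))\<^sup>2 = N s"
        unfolding N_def emb_diff[OF acd_L2[OF UW] acd_L2[OF UW]] emb_diff[OF acd_L2[OF WQ] acd_L2[OF WQ]]
          emb_diff[OF acd_L2[OF Q'(2)[OF s]] acd_L2[OF Q'(2)[OF t]]]
          emb_diff[OF acdD(1)[OF Q'(2)[OF s]] acdD(1)[OF Q'(2)[OF t]]] Q'(3)[OF s] Q'(3)[OF t] .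
      then show "sqrt (N s) = Hs_norm \<Omega> 3 (\<lambda>x. u s x - u t x)"
        using Hs_norm_nonneg by (simp add: real_sqrt_unique)
    qed
    have "((\<lambda>s. emb (U s)) \<longlongrightarrow> emb (U t)) (at t)"
      using has_vector_derivative_continuous[OF U_der, of t] by (simp add: isCont_def)
    then have UT: "((\<lambda>s. norm (emb (U s) - emb (U t))) \<longlongrightarrow> 0) (at t)"
      by (intro tendsto_norm_zero LIM_zero)
    have "((\<lambda>s. sqrt (N s)) \<longlongrightarrow> sqrt (0\<^sup>2 + 0\<^sup>2 + 0\<^sup>2 + 0\<^sup>2)) (at t)"
      unfolding N_def by (intro tendsto_intros UT W_tendsto Q_tendsto P_tendsto t)
    then have "((\<lambda>s. Hs_norm \<Omega> 3 (\<lambda>x. u s x - u t x)) \<longlongrightarrow> 0) (at t)"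
      using Lim_transform_eventually[OF _ eq] by simp
    then show "((\<lambda>s. Hs_norm \<Omega> 3 (\<lambda>x. u s x - u t x)) \<longlongrightarrow> 0) (at t within {-S<..<S})"
      by (rule tendsto_within_subset) simp
  qed
qed

end

section \<open>Passage to the supremum and conclusion\<close>

lemma ereal_interval: "{t. - ereal S < ereal t \<and> ereal t < ereal S} = {-S<..<S}"
  by auto

text \<open>Each time below the supremum lies in the window of some member of A. These windows are
  open, so limits within them are full limits and do not depend on the window.\<close>

lemma cont_into_Hs_Sup:
  fixes u :: "real \<Rightarrow> real \<Rightarrow> complex"
  assumes "\<And>T'. T' \<in> A \<Longrightarrow> cont_into_Hs \<Omega> k {t. - T' < ereal t \<and> ereal t < T'} u"
  shows "cont_into_Hs \<Omega> k {t. - Sup A < ereal t \<and> ereal t < Sup A} u"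
  unfolding cont_into_Hs_def
proof (safe)
  have op: "open {t. - T' < ereal t \<and> ereal t < T'}" for T'
  proof -
    have "{t. - T' < ereal t \<and> ereal t < T'} = ereal -` {- T'<..<T'}" by auto
    then show ?thesis by (simp add: open_ereal_vimage)
  qed
  fix t assume t: "- Sup A < ereal t" "ereal t < Sup A"
  have "- ereal t < Sup A" by (rule ereal_uminus_less_reorder[THEN iffD1, OF t(1)])
  then have "max (ereal t) (- ereal t) < Sup A" using t(2) by simp
  then obtain T' where T': "T' \<in> A" "max (ereal t) (- ereal t) < T'" by (auto simp: less_Sup_iff)
  then have "ereal t < T'" "- ereal t < T'" unfolding max_less_iff_conj by blast+
  then have mem: "t \<in> {t. - T' < ereal t \<and> ereal t < T'}"
    using ereal_uminus_less_reorder[of "ereal t" T'] by blast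
  note c = assms[OF T'(1), unfolded cont_into_Hs_def]
  show "u t \<in> Hs \<Omega> k" using c mem by blast
  have "((\<lambda>s. Hs_norm \<Omega> k (\<lambda>x. u s x - u t x)) \<longlongrightarrow> 0) (at t within {t. - T' < ereal t \<and> ereal t < T'})"
    using c mem by blast
  then have "((\<lambda>s. Hs_norm \<Omega> k (\<lambda>x. u s x - u t x)) \<longlongrightarrow> 0) (at t)"
    by (simp only: at_within_open[OF mem op])
  then show "((\<lambda>s. Hs_norm \<Omega> k (\<lambda>x. u s x - u t x)) \<longlongrightarrow> 0)
      (at t within {t. - Sup A < ereal t \<and> ereal t < Sup A})"
    by (rule tendsto_within_subset) simp
qed

theorem proposition6p14:
  fixes l a :: real and \<phi> :: "real \<Rightarrow> complex" and u :: "real \<Rightarrow> real \<Rightarrow> complex"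
  assumes "l \<noteq> 0" and "a \<ge> 2"
    and "\<phi> \<in> D_odd a \<inter> Hs {-a<..<a} 3"
    and "wderiv {-a<..<a} 1 \<phi> \<in> H1_0 {-a<..<a}"
    and "logNLS_solution l a \<phi> u"
  shows "\<exists>T::ereal. 0 < T \<and>
      cont_into_Hs {-a<..<a} 3 {t. - T < ereal t \<and> ereal t < T} u \<and>
      (\<forall>T'>0. cont_into_Hs {-a<..<a} 3 {t. - T' < ereal t \<and> ereal t < T'} u \<longrightarrow> T' \<le> T) \<and>
      (T < \<infinity> \<longrightarrow>
        (INF (t, x) \<in> {t. - T \<le> ereal t \<and> ereal t \<le> T} \<times> {-a<..<a}.
           cmod (avg (dx {-a<..<a} (u t)) x)) = 0)"
proof -
  interpret symm_interval a by unfold_locales (use assms(2) in simp)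
  have u2: "u t \<in> Hs \<Omega> 2" and u_bc: "dx \<Omega> (u t) a = 0" "dx \<Omega> (u t) (-a) = 0" for t
    using assms(5) by (auto simp: logNLS_solution_def D_Neu_def)
  have "\<forall>t. \<exists>U W Q. acd U W \<and> acd W Q \<and> (AE x in M. U x = u t x)"
    using u2 by (simp add: Hs_2_iff)
  then obtain U W Q where UW: "\<And>t. acd (U t) (W t)" and WQ: "\<And>t. acd (W t) (Q t)"
    and Uu: "\<And>t. AE x in M. U t x = u t x" by metis
  have dx: "dx \<Omega> (u t) x = W t x" if "x \<in> {-a..a}" for t x
    by (rule dx_eq[OF UW WQ Uu that])
  have "\<forall>t. \<exists>v. has_L2_time_deriv \<Omega> u t v \<and>
        (AE x in M. \<i> * v x + wderiv \<Omega> 2 (u t) x = complex_of_real l * zlog (u t x))"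
    using assms(5) by (simp add: logNLS_solution_def)
  then obtain v where v: "\<And>t. has_L2_time_deriv \<Omega> u t (v t)"
    and veq: "\<And>t. AE x in M. \<i> * v t x + wderiv \<Omega> 2 (u t) x = complex_of_real l * zlog (u t x)" by metis
  have vL: "v t \<in> L2 \<Omega>" for t using v by (simp add: has_L2_time_deriv_def)
  have U0: "AE x in M. U 0 x = \<phi> x"
  proof -
    have "AE x in M. u 0 x = \<phi> x" using assms(5) by (simp add: logNLS_solution_def)
    with Uu[of 0] show ?thesis by eventually_elim simp
  qed
  have rep: "cont_rep \<Omega> \<phi> x = U 0 x" if "x \<in> {-a..a}" for x
    by (rule cont_rep_eq[OF acd_continuous[OF UW] U0 that])
  have \<phi>: "\<phi> \<in> D_odd a" "\<phi> \<in> Hs \<Omega> 3" using assms(3) by auto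
  interpret log_nls_flow a l U W Q v
  proof
    show "acd (U t) (W t)" "acd (W t) (Q t)" "v t \<in> L2 \<Omega>" for t by (rule UW WQ vL)+
    show "W t (-a) = 0" "W t a = 0" for t using dx[of a t] dx[of "-a" t] u_bc a_pos by auto
    show "((\<lambda>s. emb (U s)) has_vector_derivative emb (v t)) (at t)" for t
      using v[of t] by (simp only: has_L2_time_deriv_iff[of U u "v t" t, OF acd_L2[OF UW] Uu vL])
    show "AE x in M. \<i> * v t x + Q t x = complex_of_real l * zlog (U t x)" for t
      using veq[of t] Uu[of t] AE_wderiv[OF weak_derivs_of_acd(4)[OF UW Uu WQ], of t]
      by eventually_elim simp
    show "U 0 (- x) = - U 0 x" if "x \<in> {-a..a}" for x
    proof -
      have "cont_rep \<Omega> \<phi> (- x) = - cont_rep \<Omega> \<phi> x" using \<phi>(1) that by (simp add: D_odd_def)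
      then show ?thesis using rep[of x] rep[of "- x"] that by simp
    qed
    show "isCont (\<lambda>s. emb (Q s)) t" for t
      unfolding isCont_def
    proof (rule LIM_zero_cancel, rule Lim_null_comparison)
      show "((\<lambda>s. Hs_norm \<Omega> 2 (\<lambda>x. u s x - u t x)) \<longlongrightarrow> 0) (at t)"
        using assms(5) by (simp add: logNLS_solution_def cont_into_Hs_def)
      show "\<forall>\<^sub>F s in at t. norm (emb (Q s) - emb (Q t)) \<le> Hs_norm \<Omega> 2 (\<lambda>x. u s x - u t x)"
      proof (intro always_eventually allI)
        fix s
        have "AE x in M. U s x - U t x = u s x - u t x" using Uu[of s] Uu[of t] by eventually_elim simp
        from Hs_norm_2[OF acd_diff[OF UW UW] acd_diff[OF WQ WQ] this]
        have "(norm (emb (Q s) - emb (Q t)))\<^sup>2 \<le> (Hs_norm \<Omega> 2 (\<lambda>x. u s x - u t x))\<^sup>2"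
          by (simp add: emb_diff acdD(1)[OF WQ])
        then show "norm (emb (Q s) - emb (Q t)) \<le> Hs_norm \<Omega> 2 (\<lambda>x. u s x - u t x)"
          by (rule power2_le_imp_le[OF _ Hs_norm_nonneg])
      qed
    qed
  qed
  obtain U' W' Q0 P0 where 0: "acd U' W'" "acd W' Q0" "acd Q0 P0" "AE x in M. U' x = \<phi> x"
    using \<phi>(2) unfolding Hs_3_iff by blast
  have Q0: "AE x in M. Q0 x = Q 0 x"
    by (rule has_weak_deriv_unique[OF weak_derivs_of_acd(4)[OF 0(1,4,2)] weak_derivs_of_acd(4)[OF UW U0 WQ]])
  note H3 = cont_into_H3[OF Uu 0(3) Q0]
  \<comment> \<open>Extended reals admit an infinite time, and the supremum of A exists and is
    maximal by construction.\<close>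
  define A where "A = {T'::ereal. 0 < T' \<and> cont_into_Hs \<Omega> 3 {t. - T' < ereal t \<and> ereal t < T'} u}"
  \<comment> \<open>The only way into A: a uniform lower bound for the average on a closed time
    window.\<close>
  have A_I: "ereal S \<in> A" if "0 < S" "0 < d" "\<And>t x. t \<in> {-S..S} \<Longrightarrow> x \<in> {-a..a} \<Longrightarrow> d \<le> cmod (avg (W t) x)" for S d
    using H3[OF that] that(1) unfolding A_def mem_Collect_eq ereal_interval by simp
  define T where "T = Sup A"
  have avg_dx: "avg (dx \<Omega> (u t)) x = avg (W t) x" if "x \<in> {-a..a}" for t x
    by (rule avg_cong[OF that dx])
  have V_cont: "continuous_on {-a..a} (avg (W t))" for t by (rule continuous_on_avg[OF W_cont])
  have "0 < T"
  proof -
    \<comment> \<open>Off the origin the average is U/x, nonzero with U. At the origin it is the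
      derivative itself, whence the condition on the derivative of the datum at 0.\<close>
    have ne: "avg (W 0) x \<noteq> 0" if x: "x \<in> {-a..a}" for x
    proof (cases "x = 0")
      case True
      have "dx \<Omega> \<phi> 0 = W 0 0" by (rule dx_eq[OF UW WQ U0]) (use a_pos in simp)
      then show ?thesis using \<phi>(1) True by (simp add: avg_at_0 D_odd_def)
    next
      case False
      moreover have "\<forall>x\<in>{-a..a} - {0}. cont_rep \<Omega> \<phi> x \<noteq> 0" using \<phi>(1) by (simp add: D_odd_def)
      ultimately have "cont_rep \<Omega> \<phi> x \<noteq> 0" using x by blast
      then have "U 0 x \<noteq> 0" by (simp add: rep[OF x])
      then show ?thesis using acd_eq_avg[OF UW W_cont U_zero x, of 0] by auto
    qed
    \<comment> \<open>Compactness of [-a, a] turns the absence of zeros into a uniform lower bound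
      d.\<close>
    have "\<exists>x\<in>{-a..a}. \<forall>y\<in>{-a..a}. cmod (avg (W 0) x) \<le> cmod (avg (W 0) y)"
      by (rule continuous_attains_inf[OF compact_Icc _ continuous_on_norm[OF V_cont]]) (use a_pos in auto)
    then obtain x0 where x0: "x0 \<in> {-a..a}" "\<And>x. x \<in> {-a..a} \<Longrightarrow> cmod (avg (W 0) x0) \<le> cmod (avg (W 0) x)"
      by blast
    define d where "d = cmod (avg (W 0) x0)"
    have d: "0 < d" using ne[OF x0(1)] by (simp add: d_def)
    obtain e where e: "0 < e" "\<And>s x. \<bar>s - 0\<bar> < e \<Longrightarrow> x \<in> {-a..a} \<Longrightarrow> d / 2 \<le> cmod (avg (W s) x)"
      using nondegenerate_near[OF d, of 0] x0(2) unfolding d_def by blast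
    have "ereal (e / 2) \<in> A"
      by (rule A_I[of _ "d / 2"]) (use e d in auto)
    then have "ereal (e / 2) \<le> T" unfolding T_def by (rule Sup_upper)
    moreover have "0 < ereal (e / 2)" using e(1) by simp
    ultimately show ?thesis by (rule order_less_le_trans[rotated])
  qed
  moreover have "cont_into_Hs \<Omega> 3 {t. - T < ereal t \<and> ereal t < T} u"
    unfolding T_def by (rule cont_into_Hs_Sup) (simp add: A_def)
  moreover have "\<forall>T'>0. cont_into_Hs \<Omega> 3 {t. - T' < ereal t \<and> ereal t < T'} u \<longrightarrow> T' \<le> T"
    unfolding T_def by (auto simp: A_def intro: Sup_upper)
  moreover have "(INF (t, x) \<in> {t. - T \<le> ereal t \<and> ereal t \<le> T} \<times> \<Omega>. cmod (avg (dx \<Omega> (u t)) x)) = 0" if fin: "T < \<infinity>"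
  proof (rule ccontr)
    obtain r where r: "T = ereal r" "0 < r" using \<open>0 < T\<close> fin by (cases T) auto
    define J where "J = {t. - T \<le> ereal t \<and> ereal t \<le> T} \<times> \<Omega>"
    define f where "f = (\<lambda>(t, x). cmod (avg (dx \<Omega> (u t)) x))"
    assume "(INF (t, x) \<in> {t. - T \<le> ereal t \<and> ereal t \<le> T} \<times> \<Omega>. cmod (avg (dx \<Omega> (u t)) x)) \<noteq> 0"
    then have ne0: "Inf (f ` J) \<noteq> 0" by (simp add: f_def J_def)
    have J: "(t, x) \<in> J \<longleftrightarrow> t \<in> {-r..r} \<and> x \<in> \<Omega>" for t x by (auto simp: J_def r)
    \<comment> \<open>A real infimum is informative only for a nonempty set that is bounded
      below.\<close>
    have "(0, 0) \<in> J" unfolding J using r a_pos by simp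
    then have "0 \<le> Inf (f ` J)" by (intro cInf_greatest) (auto simp: f_def)
    define d where "d = Inf (f ` J)"
    have d: "0 < d" using ne0 \<open>0 \<le> Inf (f ` J)\<close> by (simp add: d_def)
    have bdd: "bdd_below (f ` J)" by (rule bdd_belowI[of _ 0]) (auto simp: f_def)
    \<comment> \<open>The infimum runs over the open interval; continuity of the average carries the
      bound to the endpoints.\<close>
    have V: "d \<le> cmod (avg (W t) x)" if t: "t \<in> {-r..r}" and x: "x \<in> {-a..a}" for t x
    proof (rule ge_on_closure[OF V_cont _ x])
      fix x assume x: "x \<in> \<Omega>"
      have "d \<le> f (t, x)" unfolding d_def by (rule cInf_lower[OF _ bdd]) (use t x J in blast)
      then show "d \<le> cmod (avg (W t) x)" using avg_dx[of x t] x by (simp add: f_def)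
    qed
    \<comment> \<open>Half of the bound persists beyond each end of the time window, so the window
      can be enlarged and T was not the supremum.\<close>
    obtain e1 where e1: "0 < e1" "\<And>s x. \<bar>s - r\<bar> < e1 \<Longrightarrow> x \<in> {-a..a} \<Longrightarrow> d / 2 \<le> cmod (avg (W s) x)"
      using nondegenerate_near[OF d V[of r]] r by auto
    obtain e2 where e2: "0 < e2" "\<And>s x. \<bar>s - (-r)\<bar> < e2 \<Longrightarrow> x \<in> {-a..a} \<Longrightarrow> d / 2 \<le> cmod (avg (W s) x)"
      using nondegenerate_near[OF d V[of "-r"]] r by auto
    define e where "e = min e1 e2 / 2"
    have e: "0 < e" "e < e1" "e < e2" using e1 e2 by (auto simp: e_def min_def)
    have "ereal (r + e) \<in> A"
    proof (rule A_I[of _ "d / 2"])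
      fix t x assume t: "t \<in> {-(r + e)..r + e}" and x: "x \<in> {-a..a}"
      consider "t \<in> {-r..r}" | "r < t" | "t < - r" by force
      then show "d / 2 \<le> cmod (avg (W t) x)"
      proof cases
        case 1 then show ?thesis using V[OF 1 x] d by linarith
      next
        case 2 then show ?thesis using t e by (intro e1(2) x) auto
      next
        case 3 then show ?thesis using t e by (intro e2(2) x) auto
      qed
    qed (use r e d in auto)
    then have "ereal (r + e) \<le> T" unfolding T_def by (rule Sup_upper)
    then show False using r e by simp
  qed
  ultimately show ?thesis by blast
qed

end
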